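(* The problem of listing the maximal connected induced directed acyclic subgraphs of a directed graph $G$ is proximity searchable, and it can be solved (every solution output exactly once) with $O(mn^2)$ time delay.
   Context: $G$ is a directed graph with $n$ vertices and $m$ edges (isolated vertices disregarded). A maximal connected induced directed acyclic subgraph is a set $S\subseteq V(G)$ such that $G[S]$ is acyclic and (weakly) connected, and no $S'\supsetneq S$ has both properties. A listing problem with universe $\mathcal{U}$ (here $V(G)$) and set $\mathcal{S}$ of solutions to list is proximity searchable if there exist $\tilde{\cap}:\mathcal{S}\times\mathcal{S}\to 2^{\mathcal{U}}$ and $\mathrm{neighbors}:\mathcal{S}\to 2^{\mathcal{S}}$ such that one solution can be found in time polynomial in $|\mathcal{U}|$, $\mathrm{neighbors}$ is computable in time polynomial in $|\mathcal{U}|$, and for any two distinct $S,S^*\in\mathcal{S}$ some $S'\in\mathrm{neighbors}(S)$ satisfies $|S'\,\tilde{\cap}\,S^*|>|S\,\tilde{\cap}\,S^*|$. Delay is the maximum time before the first output, between consecutive outputs, and after the last output. *)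

theory Defs
  imports
    "Graph_Theory.Graph_Theory"
    "HOL-Computational_Algebra.Polynomial"
begin

section \<open>Machine model\<close>

text \<open>
  A random access machine on natural numbers with unit costs, programmed in a structured language.
  The arithmetic is addition and truncated subtraction only; there is no multiplication, so
  unit-cost time is polynomially related to Turing machine time (Cook and Reckhow).
  A program is a fixed finite term, so it refers to finitely many registers and arrays, and
  evaluating one of its expressions takes a number of machine operations that is bounded
  independently of the input. Hence each simple command and each evaluation of a test counts as one
  step. Registers and (unbounded) arrays are initially zero where they do not hold input.
\<close>

datatype exp =
    Const nat
  | Reg nat
  | Cell nat exp
  | Add exp exp
  | Sub exp exp

datatype test =
    Eq exp exp
  | Less exp exp
  | Neg test
  | Conj test test

text \<open>
  A solution is output element by element: \<open>Put e\<close> appends one number to the output buffer, and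
  \<open>Flush\<close> marks the buffer content as one complete output and clears the buffer.
\<close>

datatype com =
    Skip
  | Assign nat exp
  | Store nat exp exp
  | Put exp
  | Flush
  | Seq com com
  | If test com com
  | While test com

record state =
  reg :: "nat \<Rightarrow> nat"
  cell :: "nat \<Rightarrow> nat \<Rightarrow> nat"
  buffer :: "nat list"

fun exp_val :: "exp \<Rightarrow> state \<Rightarrow> nat" where
  "exp_val (Const k) s = k"
| "exp_val (Reg x) s = reg s x"
| "exp_val (Cell a e) s = cell s a (exp_val e s)"
| "exp_val (Add e f) s = exp_val e s + exp_val f s"
| "exp_val (Sub e f) s = exp_val e s - exp_val f s"

fun test_val :: "test \<Rightarrow> state \<Rightarrow> bool" where
  "test_val (Eq e f) s \<longleftrightarrow> exp_val e s = exp_val f s"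
| "test_val (Less e f) s \<longleftrightarrow> exp_val e s < exp_val f s"
| "test_val (Neg b) s \<longleftrightarrow> \<not> test_val b s"
| "test_val (Conj b c) s \<longleftrightarrow> test_val b s \<and> test_val c s"

text \<open>
  A run yields one event per time step: a silent step \<open>Tick\<close>, or a step \<open>Out xs\<close> that completes
  the output of \<open>xs\<close>. The relation \<open>exec c s tr s'\<close> says that \<open>c\<close>, started in \<open>s\<close>, terminates in
  \<open>s'\<close> after the steps \<open>tr\<close>.
\<close>

datatype event = Tick | Out "nat list"

inductive exec :: "com \<Rightarrow> state \<Rightarrow> event list \<Rightarrow> state \<Rightarrow> bool" where
  Skip: "exec Skip s [Tick] s"
| Assign: "exec (Assign x e) s [Tick] (s\<lparr>reg := (reg s)(x := exp_val e s)\<rparr>)"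
| Store: "exec (Store a e f) s [Tick]
    (s\<lparr>cell := (cell s)(a := (cell s a)(exp_val e s := exp_val f s))\<rparr>)"
| Put: "exec (Put e) s [Tick] (s\<lparr>buffer := buffer s @ [exp_val e s]\<rparr>)"
| Flush: "exec Flush s [Out (buffer s)] (s\<lparr>buffer := []\<rparr>)"
| Seq: "exec c s tr s' \<Longrightarrow> exec d s' tr' s'' \<Longrightarrow> exec (Seq c d) s (tr @ tr') s''"
| IfTrue: "test_val b s \<Longrightarrow> exec c s tr s' \<Longrightarrow> exec (If b c d) s (Tick # tr) s'"
| IfFalse: "\<not> test_val b s \<Longrightarrow> exec d s tr s' \<Longrightarrow> exec (If b c d) s (Tick # tr) s'"
| WhileFalse: "\<not> test_val b s \<Longrightarrow> exec (While b c) s [Tick] s"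
| WhileTrue: "test_val b s \<Longrightarrow> exec c s tr s' \<Longrightarrow> exec (While b c) s' tr' s'' \<Longrightarrow>
    exec (While b c) s (Tick # tr @ tr') s''"

inductive_cases exec_elims:
  "exec Skip s tr s'" "exec (Assign x e) s tr s'" "exec (Store a e f) s tr s'"
  "exec (Put e) s tr s'" "exec Flush s tr s'" "exec (Seq c d) s tr s'"
  "exec (If b c d) s tr s'" "exec (While b c) s tr s'"

lemma exec_deterministic:
  "exec c s tr s' \<Longrightarrow> exec c s tr' s'' \<Longrightarrow> tr' = tr \<and> s'' = s'"
proof (induction arbitrary: tr' s'' rule: exec.induct)
  case (Seq c s tr1 s1 d tr2 s2)
  from Seq.prems show ?case
    by (rule exec_elims(6)) (use Seq.IH in blast)
next
  case (IfTrue b s c tr1 s1 d)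
  from IfTrue.prems show ?case
    by (rule exec_elims(7)) (use IfTrue.hyps(1) IfTrue.IH in blast)+
next
  case (IfFalse b s d tr1 s1 c)
  from IfFalse.prems show ?case
    by (rule exec_elims(7)) (use IfFalse.hyps(1) IfFalse.IH in blast)+
next
  case (WhileFalse b s c)
  from WhileFalse.prems show ?case
    by (rule exec_elims(8)) (use WhileFalse.hyps in simp_all)
next
  case (WhileTrue b s c tr1 s1 tr2 s2)
  from WhileTrue.prems show ?case
    by (rule exec_elims(8)) (use WhileTrue.hyps(1) WhileTrue.IH in blast)+
qed (auto elim: exec_elims(1-5))

text \<open>Array \<open>k\<close> initially holds the \<open>k\<close>-th input list, and register \<open>k\<close> its length.\<close>

definition initial :: "nat list list \<Rightarrow> state" where
  "initial inp = \<lparr>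
     reg = (\<lambda>k. if k < length inp then length (inp ! k) else 0),
     cell = (\<lambda>k i. if k < length inp \<and> i < length (inp ! k) then inp ! k ! i else 0),
     buffer = []\<rparr>"

fun outputs :: "event list \<Rightarrow> nat list list" where
  "outputs [] = []"
| "outputs (Tick # tr) = outputs tr"
| "outputs (Out xs # tr) = xs # outputs tr"

text \<open>
  The number of steps up to the first output, between consecutive outputs, and after the last one;
  the first argument counts the steps since the preceding output.
\<close>

fun gaps :: "nat \<Rightarrow> event list \<Rightarrow> nat list" where
  "gaps k [] = [k]"
| "gaps k (Tick # tr) = gaps (Suc k) tr"
| "gaps k (Out xs # tr) = Suc k # gaps 0 tr"

definition delay :: "event list \<Rightarrow> nat" where
  "delay tr = Max (set (gaps 0 tr))"


section \<open>Listing problems\<close>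

text \<open>
  The universe of an instance \<open>i\<close> is \<open>set (elems P i)\<close>. The list \<open>elems P i\<close> fixes the
  numbering through which programs refer to elements of the universe: number \<open>j\<close> stands for
  \<open>elems P i ! j\<close>.
\<close>

record ('i, 'u) listing_problem =
  instances :: "'i set"
  elems :: "'i \<Rightarrow> 'u list"
  encoding :: "'i \<Rightarrow> nat list list"
  solutions :: "'i \<Rightarrow> 'u set set"

definition represents :: "'u list \<Rightarrow> nat list \<Rightarrow> 'u set \<Rightarrow> bool" where
  "represents us xs S \<longleftrightarrow> distinct xs \<and> set xs \<subseteq> {..<length us} \<and> S = (\<lambda>j. us ! j) ` set xs"

definition lists_exactly_once ::
  "('i, 'u) listing_problem \<Rightarrow> 'i \<Rightarrow> event list \<Rightarrow> bool" where
  "lists_exactly_once P i tr \<longleftrightarrow>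
     (\<exists>Ss. distinct Ss \<and> set Ss = solutions P i \<and>
        list_all2 (represents (elems P i)) (outputs tr) Ss)"

definition listable_with_delay ::
  "('i, 'u) listing_problem \<Rightarrow> ('i \<Rightarrow> nat) \<Rightarrow> bool" where
  "listable_with_delay P f \<longleftrightarrow>
     (\<exists>c. \<forall>i\<in>instances P. \<exists>tr s.
        exec c (initial (encoding P i)) tr s \<and> lists_exactly_once P i tr \<and> delay tr \<le> f i)"

definition poly_time_solution :: "('i, 'u) listing_problem \<Rightarrow> bool" where
  "poly_time_solution P \<longleftrightarrow>
     (\<exists>c (p :: nat poly). \<forall>i\<in>instances P. \<exists>tr s xs S.
        exec c (initial (encoding P i)) tr s \<and>
        length tr \<le> poly p (card (set (elems P i))) \<and>
        outputs tr = [xs] \<and> represents (elems P i) xs S \<and> S \<in> solutions P i)"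

text \<open>The argument \<open>S\<close> is appended to the encoded instance as one more input list.\<close>

definition poly_time_neighbors ::
  "('i, 'u) listing_problem \<Rightarrow> ('i \<Rightarrow> 'u set \<Rightarrow> 'u set set) \<Rightarrow> bool" where
  "poly_time_neighbors P nbs \<longleftrightarrow>
     (\<exists>c (p :: nat poly). \<forall>i\<in>instances P. \<forall>S\<in>solutions P i. \<forall>xs.
        represents (elems P i) xs S \<longrightarrow>
        (\<exists>tr s Ss.
           exec c (initial (encoding P i @ [xs])) tr s \<and>
           length tr \<le> poly p (card (set (elems P i))) \<and>
           list_all2 (represents (elems P i)) (outputs tr) Ss \<and> set Ss = nbs i S))"

definition proximity_searchable :: "('i, 'u) listing_problem \<Rightarrow> bool" where
  "proximity_searchable P \<longleftrightarrow>
     (\<exists>(prox :: 'i \<Rightarrow> 'u set \<Rightarrow> 'u set \<Rightarrow> 'u set) (nbs :: 'i \<Rightarrow> 'u set \<Rightarrow> 'u set set).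
        (\<forall>i\<in>instances P. \<forall>S\<in>solutions P i. \<forall>T\<in>solutions P i. prox i S T \<subseteq> set (elems P i)) \<and>
        (\<forall>i\<in>instances P. \<forall>S\<in>solutions P i. nbs i S \<subseteq> solutions P i) \<and>
        poly_time_solution P \<and>
        poly_time_neighbors P nbs \<and>
        (\<forall>i\<in>instances P. \<forall>S\<in>solutions P i. \<forall>T\<in>solutions P i. S \<noteq> T \<longrightarrow>
           (\<exists>S'\<in>nbs i S. card (prox i S' T) > card (prox i S T))))"


section \<open>Maximal connected induced directed acyclic subgraphs\<close>

text \<open>
  \<open>connected\<close> is weak connectivity (and requires a nonempty vertex set); \<open>pre_digraph.cycle\<close>
  is a directed cycle, two antiparallel arcs being a cycle of length two.
\<close>

definition connected_acyclic_set :: "('a, 'b) pre_digraph \<Rightarrow> 'a set \<Rightarrow> bool" where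
  "connected_acyclic_set G S \<longleftrightarrow>
     S \<subseteq> verts G \<and> connected (G \<restriction> S) \<and> \<not> (\<exists>p. pre_digraph.cycle (G \<restriction> S) p)"

definition maximal_connected_acyclic_sets :: "('a, 'b) pre_digraph \<Rightarrow> 'a set set" where
  "maximal_connected_acyclic_sets G =
     {S. connected_acyclic_set G S \<and> \<not> (\<exists>S'. S \<subset> S' \<and> connected_acyclic_set G S')}"

text \<open>
  An instance is a finite simple digraph, nonempty and without isolated vertices, given by a list
  of its vertices and a list of its arcs, each in arbitrary order.
\<close>

type_synonym ('a, 'b) presented_digraph = "('a, 'b) pre_digraph \<times> 'a list \<times> 'b list"

definition presented_digraphs :: "('a, 'b) presented_digraph set" where
  "presented_digraphs = {(G, vs, as).
     digraph G \<and> verts G \<noteq> {} \<and>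
     (\<forall>v\<in>verts G. \<exists>a\<in>arcs G. tail G a = v \<or> head G a = v) \<and>
     distinct vs \<and> set vs = verts G \<and> distinct as \<and> set as = arcs G}"

definition position :: "'a list \<Rightarrow> 'a \<Rightarrow> nat" where
  "position vs v = (THE j. j < length vs \<and> vs ! j = v)"

text \<open>
  The input of a program is the number of vertices and the arc list; the vertices are numbered as
  they occur in \<open>vs\<close>, and the two lists give the tail and the head of each arc.
\<close>

fun encode_digraph :: "('a, 'b) presented_digraph \<Rightarrow> nat list list" where
  "encode_digraph (G, vs, as) =
     [[length vs], map (\<lambda>a. position vs (tail G a)) as, map (\<lambda>a. position vs (head G a)) as]"

definition connected_acyclic_listing :: "(('a, 'b) presented_digraph, 'a) listing_problem" where
  "connected_acyclic_listing = \<lparr>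
     instances = presented_digraphs,
     elems = (\<lambda>(G, vs, as). vs),
     encoding = encode_digraph,
     solutions = (\<lambda>(G, vs, as). maximal_connected_acyclic_sets G)\<rparr>"

end

theory Submission
  imports Defs "HOL-Library.Nat_Bijection"
begin

text \<open>
  Every connected acyclic digraph with at least two vertices has a source or a sink that is not a cut
  vertex. Hence the vertices of a solution \<open>T\<close> can be ordered such that every prefix is connected and
  every vertex has only in-neighbours or only out-neighbours among its predecessors. The proximity
  of \<open>S\<close> to \<open>T\<close> is the longest prefix of this order that lies in \<open>S\<close>. If \<open>v\<close> is the vertex following
  it and \<open>N\<close> is the set of out-neighbours or of in-neighbours of \<open>v\<close>, then \<open>v\<close> is a sink or a source of
  \<open>insert v (S - N)\<close>, which is therefore acyclic, and for one of the two choices of \<open>N\<close> its component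
  at \<open>v\<close> contains the prefix and \<open>v\<close>. So the at most \<open>2 n\<close> maximal extensions of these components
  serve as neighbours of \<open>S\<close>.

  A maximal extension tests every vertex at most once, and a test takes \<open>O(m)\<close> steps: the arcs are kept
  in an order in which a single pass propagates reachability within the current set. This
  gives \<open>O(m n)\<close> per extension and \<open>O(m n\<^sup>2)\<close> for all neighbours. Breadth-first search outputs
  a solution when it leaves the queue, and new solutions are recognized in \<open>O(n)\<close> steps by an
  array that is indexed with binary encodings of vertex sets.
\<close>

section \<open>Connected acyclic vertex sets and proximity\<close>

text \<open>A topological order of \<open>T\<close> alone would not do: its prefixes may be
  disconnected, whereas a prefix and the next vertex \<open>v\<close> must lie in one component.
  Removing sources and sinks that are not cut vertices and reversing the order of removal gives both
  properties. One choice of \<open>N\<close> works because \<open>v\<close> sends no arc to the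
  prefix or receives none from it, so deleting \<open>N\<close> leaves the prefix intact. Every
  solution containing the prefix and \<open>v\<close> is closer to \<open>T\<close>; hence a
  nonempty family of solutions closed under neighbours misses no \<open>T\<close>, as its member
  closest to \<open>T\<close> would have a still closer neighbour.

  For the time bound, reachability from a new vertex decides whether it closes a cycle, and the same
  marks tell how to restore the order of the arcs. Both phases of building a neighbour use one
  program: the component of \<open>v\<close> is found by a growth in which all tests succeed, and
  this growth also prepares the arc order for the maximal extension. A growth takes O((n + m) n)
  steps; as there are no isolated vertices, n + m is at most 3 m.\<close>

definition adjacent :: "('a \<times> 'a) set \<Rightarrow> 'a \<Rightarrow> 'a \<Rightarrow> bool" where
  "adjacent E a b \<longleftrightarrow> (a, b) \<in> E \<or> (b, a) \<in> E"

text \<open>Cuts replace paths: each later use exhibits an arc across a cut or consumes one. The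
  link to reachability is made in \<open>connected_induce_subgraph_iff\<close>.\<close>

definition connected_in :: "('a \<times> 'a) set \<Rightarrow> 'a set \<Rightarrow> bool" where
  "connected_in E X \<longleftrightarrow> X \<noteq> {} \<and>
     (\<forall>Y. Y \<subseteq> X \<and> Y \<noteq> {} \<and> Y \<noteq> X \<longrightarrow> (\<exists>a\<in>Y. \<exists>b\<in>X - Y. adjacent E a b))"

text \<open>Well-foundedness of the converse of \<open>E\<close> on \<open>X\<close>. Because
  \<open>z\<close> may equal \<open>y\<close>, loops are excluded as well, and the property passes
  to subsets at once.\<close>

definition acyclic_in :: "('a \<times> 'a) set \<Rightarrow> 'a set \<Rightarrow> bool" where
  "acyclic_in E X \<longleftrightarrow> (\<forall>Y\<subseteq>X. Y \<noteq> {} \<longrightarrow> (\<exists>y\<in>Y. \<forall>z\<in>Y. (y, z) \<notin> E))"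

definition dag_set :: "('a \<times> 'a) set \<Rightarrow> 'a set \<Rightarrow> bool" where
  "dag_set E X \<longleftrightarrow> connected_in E X \<and> acyclic_in E X"

definition maximal_dag_sets :: "('a \<times> 'a) set \<Rightarrow> 'a set \<Rightarrow> 'a set set" where
  "maximal_dag_sets E V = {X. X \<subseteq> V \<and> dag_set E X \<and> (\<forall>Y. X \<subset> Y \<and> Y \<subseteq> V \<longrightarrow> \<not> dag_set E Y)}"

lemma adjacent_sym: "adjacent E a b \<longleftrightarrow> adjacent E b a"
  by (auto simp: adjacent_def)

lemma connected_in_cut:
  assumes "connected_in E X" "Y \<subseteq> X" "Y \<noteq> {}" "Y \<noteq> X"
  shows "\<exists>a\<in>Y. \<exists>b\<in>X - Y. adjacent E a b"
  using assms by (auto simp: connected_in_def)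

text \<open>A cut may be replaced by its complement, so it suffices to consider cuts avoiding \<open>x\<close>.\<close>

lemma connected_in_avoidI:
  assumes "x \<in> X"
    and cut: "\<And>Y. Y \<subseteq> X \<Longrightarrow> Y \<noteq> {} \<Longrightarrow> x \<notin> Y \<Longrightarrow> \<exists>a\<in>Y. \<exists>b\<in>X - Y. adjacent E a b"
  shows "connected_in E X"
  unfolding connected_in_def
proof (intro conjI allI impI)
  show "X \<noteq> {}" using assms(1) by auto
  fix Y assume Y: "Y \<subseteq> X \<and> Y \<noteq> {} \<and> Y \<noteq> X"
  show "\<exists>a\<in>Y. \<exists>b\<in>X - Y. adjacent E a b"
  proof (cases "x \<in> Y")
    case False
    then show ?thesis using Y cut by blast
  next
    case True
    then have "\<exists>a\<in>X - Y. \<exists>b\<in>X - (X - Y). adjacent E a b"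
      using Y by (intro cut) auto
    then show ?thesis using Y adjacent_sym[of E] by blast
  qed
qed

lemma connected_in_singleton: "connected_in E {v}"
  by (rule connected_in_avoidI[of v]) auto

lemma connected_in_insert:
  assumes X: "connected_in E X" and a: "a \<in> X" "adjacent E a u"
  shows "connected_in E (insert u X)"
proof (rule connected_in_avoidI[of u])
  fix Y assume Y: "Y \<subseteq> insert u X" "Y \<noteq> {}" "u \<notin> Y"
  then show "\<exists>a\<in>Y. \<exists>b\<in>insert u X - Y. adjacent E a b"
    using connected_in_cut[OF X, of Y] a by (cases "Y = X") blast+
qed simp

section \<open>Sinks and sources of acyclic sets\<close>

lemma acyclic_in_subset: "acyclic_in E X \<Longrightarrow> Y \<subseteq> X \<Longrightarrow> acyclic_in E Y"
  unfolding acyclic_in_def by blast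

lemma acyclic_in_sink: "acyclic_in E X \<Longrightarrow> X \<noteq> {} \<Longrightarrow> \<exists>y\<in>X. \<forall>z\<in>X. (y, z) \<notin> E"
  unfolding acyclic_in_def by blast

text \<open>The definition yields sinks only. Remove a sink \<open>y\<close>: a source of the rest
  is a source of \<open>X\<close>, since no arc leaves \<open>y\<close>.\<close>

lemma acyclic_in_source:
  assumes "finite X" "acyclic_in E X" "X \<noteq> {}"
  shows "\<exists>y\<in>X. \<forall>z\<in>X. (z, y) \<notin> E"
  using assms
proof (induction "card X" arbitrary: X rule: less_induct)
  case less
  obtain y where y: "y \<in> X" "\<forall>z\<in>X. (y, z) \<notin> E"
    using acyclic_in_sink less.prems by blast
  show ?case
  proof (cases "X = {y}")
    case True
    then show ?thesis using y by auto
  next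
    case False
    then have "\<exists>x\<in>X - {y}. \<forall>z\<in>X - {y}. (z, x) \<notin> E"
      using less.prems y(1) by (intro less.hyps)
        (auto intro: acyclic_in_subset simp: card_gt_0_iff)
    then show ?thesis using y by blast
  qed
qed

lemma acyclic_in_insert_sink:
  assumes "acyclic_in E Z" "\<forall>z\<in>insert v Z. (v, z) \<notin> E"
  shows "acyclic_in E (insert v Z)"
  unfolding acyclic_in_def
proof (intro allI impI)
  fix Y assume Y: "Y \<subseteq> insert v Z" "Y \<noteq> {}"
  show "\<exists>y\<in>Y. \<forall>z\<in>Y. (y, z) \<notin> E"
  proof (cases "v \<in> Y")
    case True
    then show ?thesis using assms(2) Y by blast
  next
    case False
    then show ?thesis using assms(1) Y unfolding acyclic_in_def by (simp add: subset_insert)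
  qed
qed

text \<open>A sink of \<open>Y - {v}\<close> stays a sink of \<open>Y\<close> because no arc enters
  \<open>v\<close>.\<close>

lemma acyclic_in_insert_source:
  assumes "acyclic_in E Z" "\<forall>z\<in>insert v Z. (z, v) \<notin> E"
  shows "acyclic_in E (insert v Z)"
  unfolding acyclic_in_def
proof (intro allI impI)
  fix Y assume Y: "Y \<subseteq> insert v Z" "Y \<noteq> {}"
  show "\<exists>y\<in>Y. \<forall>z\<in>Y. (y, z) \<notin> E"
  proof (cases "Y - {v} = {}")
    case True
    then have "Y = {v}" using Y by auto
    then show ?thesis using assms(2) by auto
  next
    case False
    then obtain y where "y \<in> Y - {v}" "\<forall>z\<in>Y - {v}. (y, z) \<notin> E"
      using assms(1) Y unfolding acyclic_in_def by (metis Diff_subset_conv insert_is_Un)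
    then show ?thesis using assms(2) Y by blast
  qed
qed

text \<open>On a finite set an acyclic relation has a well-founded converse; this is the bridge to
  \<open>acyclic\<close>.\<close>

lemma acyclic_in_iff:
  assumes "finite X"
  shows "acyclic_in E X \<longleftrightarrow> acyclic (E \<inter> X \<times> X)"
proof
  assume ac: "acyclic_in E X"
  have "wf ((E \<inter> X \<times> X)\<inverse>)"
  proof (rule wfI_min)
    fix x and Q :: "'a set" assume x: "x \<in> Q"
    show "\<exists>z\<in>Q. \<forall>y. (y, z) \<in> (E \<inter> X \<times> X)\<inverse> \<longrightarrow> y \<notin> Q"
    proof (cases "Q \<inter> X = {}")
      case True
      then show ?thesis using x by auto
    next
      case False
      then obtain y where "y \<in> Q \<inter> X" "\<forall>z\<in>Q \<inter> X. (y, z) \<notin> E"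
        using ac unfolding acyclic_in_def by (meson Int_lower2)
      then show ?thesis by (intro bexI[of _ y]) auto
    qed
  qed
  then show "acyclic (E \<inter> X \<times> X)" using wf_acyclic acyclic_converse by blast
next
  assume "acyclic (E \<inter> X \<times> X)"
  then have wf: "wf ((E \<inter> X \<times> X)\<inverse>)"
    using assms finite_acyclic_wf_converse by (metis finite_Int finite_SigmaI)
  show "acyclic_in E X" unfolding acyclic_in_def
  proof (intro allI impI)
    fix Y assume Y: "Y \<subseteq> X" "Y \<noteq> {}"
    then obtain y where "y \<in> Y" "\<And>z. (z, y) \<in> (E \<inter> X \<times> X)\<inverse> \<Longrightarrow> z \<notin> Y"
      using wfE_min[OF wf] by blast
    then show "\<exists>y\<in>Y. \<forall>z\<in>Y. (y, z) \<notin> E" using Y by blast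
  qed
qed

text \<open>
  If the source or sink at hand is a cut vertex, recursion into a part that it separates from \<open>r\<close>
  finds another one.
\<close>

lemma removable_source_or_sink:
  assumes "finite D" "connected_in E D" "acyclic_in E D" "r \<in> D" "D \<noteq> {r}"
  shows "\<exists>y\<in>D. y \<noteq> r \<and> connected_in E (D - {y}) \<and>
    ((\<forall>z\<in>D. (y, z) \<notin> E) \<or> (\<forall>z\<in>D. (z, y) \<notin> E))"
  using assms
proof (induction "card D" arbitrary: D r rule: less_induct)
  case less
  note D = less.prems
  obtain t where t: "t \<in> D" "\<forall>z\<in>D. (t, z) \<notin> E"
    using acyclic_in_sink D by blast
  obtain s where s: "s \<in> D" "\<forall>z\<in>D. (z, s) \<notin> E"
    using acyclic_in_source D by blast
  \<comment> \<open>A vertex that is both source and sink of \<open>D\<close> would be isolated,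
    against connectivity of \<open>D\<close>. So one of \<open>s\<close> and \<open>t\<close>
    differs from \<open>r\<close>.\<close>
  have "s \<noteq> t"
  proof
    assume "s = t"
    moreover have "\<exists>a\<in>{t}. \<exists>b\<in>D - {t}. adjacent E a b"
      using D t(1) by (intro connected_in_cut) auto
    ultimately show False using s t by (auto simp: adjacent_def)
  qed
  then obtain x where x: "x \<in> D" "x \<noteq> r" "(\<forall>z\<in>D. (x, z) \<notin> E) \<or> (\<forall>z\<in>D. (z, x) \<notin> E)"
    using s t by metis
  show ?case
  proof (cases "connected_in E (D - {x})")
    case True
    then show ?thesis using x by blast
  next
    case False
    \<comment> \<open>\<open>C\<close> is a union of components of \<open>D - {x}\<close> away from
      \<open>r\<close>; only \<open>x\<close> joins it to the rest of \<open>D\<close>.\<close>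
    then obtain C where C: "C \<subseteq> D - {x}" "C \<noteq> {}" "r \<notin> C"
      "\<not> (\<exists>a\<in>C. \<exists>b\<in>D - {x} - C. adjacent E a b)"
      using connected_in_avoidI[of r "D - {x}" E] D(4) x(2) by blast
    \<comment> \<open>An arc of \<open>D\<close> that leaves a part of \<open>C\<close> can end only
      in \<open>C\<close> or at \<open>x\<close>.\<close>
    have con: "connected_in E (insert x C)"
    proof (rule connected_in_avoidI[of x])
      fix Y assume Y: "Y \<subseteq> insert x C" "Y \<noteq> {}" "x \<notin> Y"
      then have "\<exists>a\<in>Y. \<exists>b\<in>D - Y. adjacent E a b"
        using C x by (intro connected_in_cut D) auto
      then show "\<exists>a\<in>Y. \<exists>b\<in>insert x C - Y. adjacent E a b" using C Y by blast
    qed simp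
    have fin: "finite C" using C(1) D(1) finite_subset by auto
    have sub: "insert x C \<subset> D" using C x D(4) by auto
    then have "card (insert x C) < card D" using D(1) psubset_card_mono by blast
    moreover have ac: "acyclic_in E (insert x C)"
      using D(3) sub acyclic_in_subset by (metis psubset_imp_subset)
    moreover have ne: "insert x C \<noteq> {x}" using C by auto
    ultimately obtain y where y: "y \<in> insert x C" "y \<noteq> x" "connected_in E (insert x C - {y})"
      "(\<forall>z\<in>insert x C. (y, z) \<notin> E) \<or> (\<forall>z\<in>insert x C. (z, y) \<notin> E)"
      using less.hyps[of "insert x C" x] fin con ac ne by blast
    have yC: "y \<in> C" using y by auto
    have out: "\<not> adjacent E a b" if "a \<in> C" "b \<in> D" "b \<notin> insert x C" for a b
      using that C by auto
    \<comment> \<open>Cuts that meet \<open>C\<close> are crossed inside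
      \<open>insert x C - {y}\<close>. The other cuts are crossed by an arc of \<open>D\<close> that
      avoids \<open>y\<close>, since no arc joins \<open>y\<close> to a vertex outside
      \<open>insert x C\<close>.\<close>
    have "connected_in E (D - {y})"
    proof (rule connected_in_avoidI[of x])
      show "x \<in> D - {y}" using x y by auto
      fix Z assume Z: "Z \<subseteq> D - {y}" "Z \<noteq> {}" "x \<notin> Z"
      show "\<exists>a\<in>Z. \<exists>b\<in>D - {y} - Z. adjacent E a b"
      proof (cases "Z \<inter> C = {}")
        case False
        have "\<exists>a\<in>Z \<inter> C. \<exists>b\<in>insert x C - {y} - Z \<inter> C. adjacent E a b"
          using Z False y(2) by (intro connected_in_cut[OF y(3)]) auto
        then show ?thesis using sub Z by blast
      next
        case True
        have "\<exists>a\<in>Z. \<exists>b\<in>D - Z. adjacent E a b"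
          using Z x by (intro connected_in_cut[OF D(2)]) auto
        then obtain a b where ab: "a \<in> Z" "b \<in> D - Z" "adjacent E a b" by auto
        moreover have "b \<noteq> y" using out[of b a] ab True Z yC adjacent_sym[of E] by blast
        ultimately show ?thesis by auto
      qed
    qed
    moreover have "(\<forall>z\<in>D. (y, z) \<notin> E) \<or> (\<forall>z\<in>D. (z, y) \<notin> E)"
      using y(4) out[OF yC] unfolding adjacent_def by blast
    ultimately show ?thesis using yC C(1,3) by (intro bexI[of _ y]) auto
  qed
qed

section \<open>Building orders and proximity\<close>

definition build_order :: "('a \<times> 'a) set \<Rightarrow> 'a set \<Rightarrow> 'a list \<Rightarrow> bool" where
  "build_order E T xs \<longleftrightarrow> distinct xs \<and> set xs = T \<and>
     (\<forall>j<length xs. connected_in E (insert (xs ! j) (set (take j xs))) \<and>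
        ((\<forall>y\<in>set (take j xs). (xs ! j, y) \<notin> E) \<or> (\<forall>y\<in>set (take j xs). (y, xs ! j) \<notin> E)))"

text \<open>The order is found from its end: \<open>removable_source_or_sink\<close>, with an
  arbitrary root \<open>r\<close>, supplies the last vertex, and induction orders the rest.\<close>

lemma build_order_exists:
  assumes "finite T" "connected_in E T" "acyclic_in E T"
  shows "\<exists>xs. build_order E T xs"
  using assms
proof (induction "card T" arbitrary: T rule: less_induct)
  case less
  obtain r where r: "r \<in> T" using less.prems by (auto simp: connected_in_def)
  show ?case
  proof (cases "T = {r}")
    case True
    then have "build_order E T [r]" by (auto simp: build_order_def connected_in_singleton)
    then show ?thesis by blast
  next
    case False
    then obtain y where y: "y \<in> T" "connected_in E (T - {y})"
      "(\<forall>z\<in>T. (y, z) \<notin> E) \<or> (\<forall>z\<in>T. (z, y) \<notin> E)"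
      using removable_source_or_sink[OF less.prems r] by blast
    then obtain xs where xs: "build_order E (T - {y}) xs"
      using less.hyps[of "T - {y}"] less.prems acyclic_in_subset[of E T "T - {y}"]
      by (metis Diff_subset card_Diff1_less finite_Diff)
    have T: "insert y (set xs) = T" using xs y(1) by (auto simp: build_order_def)
    have "build_order E T (xs @ [y])"
      unfolding build_order_def
    proof (intro conjI allI impI)
      show "distinct (xs @ [y])" "set (xs @ [y]) = T" using xs y(1) by (auto simp: build_order_def)
      fix j assume j: "j < length (xs @ [y])"
      show "connected_in E (insert ((xs @ [y]) ! j) (set (take j (xs @ [y]))))"
        "(\<forall>z\<in>set (take j (xs @ [y])). ((xs @ [y]) ! j, z) \<notin> E) \<or>
         (\<forall>z\<in>set (take j (xs @ [y])). (z, (xs @ [y]) ! j) \<notin> E)"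
      proof (atomize(full), cases "j < length xs")
        case True
        then show "connected_in E (insert ((xs @ [y]) ! j) (set (take j (xs @ [y])))) \<and>
          ((\<forall>z\<in>set (take j (xs @ [y])). ((xs @ [y]) ! j, z) \<notin> E) \<or>
          (\<forall>z\<in>set (take j (xs @ [y])). (z, (xs @ [y]) ! j) \<notin> E))"
          using xs by (simp add: build_order_def nth_append)
      next
        case False
        then have "j = length xs" using j by auto
        then show "connected_in E (insert ((xs @ [y]) ! j) (set (take j (xs @ [y])))) \<and>
          ((\<forall>z\<in>set (take j (xs @ [y])). ((xs @ [y]) ! j, z) \<notin> E) \<or>
          (\<forall>z\<in>set (take j (xs @ [y])). (z, (xs @ [y]) ! j) \<notin> E))"
          using T y(3) less.prems(2) by auto
      qed
    qed
    then show ?thesis by blast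
  qed
qed

text \<open>The chosen order depends on \<open>E\<close> and \<open>T\<close> only, so proximities
  to the same \<open>T\<close> are prefixes of one list and can be compared.\<close>

definition proximity :: "('a \<times> 'a) set \<Rightarrow> 'a set \<Rightarrow> 'a set \<Rightarrow> 'a set" where
  "proximity E S T = set (takeWhile (\<lambda>x. x \<in> S) (SOME xs. build_order E T xs))"

lemma proximity_subset:
  assumes "finite T" "dag_set E T"
  shows "proximity E S T \<subseteq> T"
proof -
  have "build_order E T (SOME xs. build_order E T xs)"
    using build_order_exists assms by (metis dag_set_def someI_ex)
  then show ?thesis unfolding proximity_def build_order_def using set_takeWhileD by fastforce
qed

definition neighbourhoods :: "('a \<times> 'a) set \<Rightarrow> 'a \<Rightarrow> 'a set set" where
  "neighbourhoods E v = {{y. (v, y) \<in> E}, {y. (y, v) \<in> E}}"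

text \<open>No solution is constructed here. The conclusion isolates what a neighbour has to
  achieve: it must contain the next prefix \<open>insert v P\<close>. The set \<open>N\<close> can
  be removed from \<open>S\<close> without touching \<open>P\<close>.\<close>

lemma proximity_increases:
  assumes T: "finite T" "dag_set E T" and ST: "\<not> T \<subseteq> S"
  obtains v P N where "v \<in> T - S" "P \<subseteq> S" "connected_in E (insert v P)"
    "N \<in> neighbourhoods E v" "P \<inter> N = {}"
    "\<And>S'. insert v P \<subseteq> S' \<Longrightarrow> card (proximity E S T) < card (proximity E S' T)"
proof -
  define xs where "xs = (SOME xs. build_order E T xs)"
  have xs: "build_order E T xs"
    unfolding xs_def using build_order_exists T by (metis dag_set_def someI_ex)
  define j where "j = length (takeWhile (\<lambda>x. x \<in> S) xs)"
  have tk: "takeWhile (\<lambda>x. x \<in> S) xs = take j xs"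
    unfolding j_def by (rule takeWhile_eq_take)
  have "j < length xs"
  proof (rule ccontr)
    assume "\<not> j < length xs"
    then have "takeWhile (\<lambda>x. x \<in> S) xs = xs" using tk by simp
    then have "set xs \<subseteq> S" using set_takeWhileD by (metis subsetI)
    then show False using xs ST by (simp add: build_order_def)
  qed
  then have v: "xs ! j \<notin> S" "xs ! j \<in> T"
    using nth_length_takeWhile[of "\<lambda>x. x \<in> S" xs] xs unfolding j_def[symmetric] build_order_def by auto
  have P: "set (take j xs) \<subseteq> S" using set_takeWhileD[of _ "\<lambda>x. x \<in> S" xs] unfolding tk by auto
  have "card (proximity E S T) < card (proximity E S' T)" if S': "insert (xs ! j) (set (take j xs)) \<subseteq> S'" for S'
  proof -
    have "takeWhile (\<lambda>x. x \<in> S') xs = take (Suc j) xs @ takeWhile (\<lambda>x. x \<in> S') (drop (Suc j) xs)"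
    proof -
      have "takeWhile (\<lambda>x. x \<in> S') (take (Suc j) xs @ drop (Suc j) xs) =
        take (Suc j) xs @ takeWhile (\<lambda>x. x \<in> S') (drop (Suc j) xs)"
        using S' \<open>j < length xs\<close> by (intro takeWhile_append2) (auto simp: take_Suc_conv_app_nth)
      then show ?thesis by simp
    qed
    then have sub: "set (take (Suc j) xs) \<subseteq> proximity E S' T"
      unfolding proximity_def xs_def[symmetric] by auto
    have d: "distinct (take i xs)" for i using xs by (simp add: build_order_def)
    have "card (proximity E S T) = j"
      unfolding proximity_def xs_def[symmetric] tk using d[of j] \<open>j < length xs\<close> by (simp add: distinct_card)
    moreover have "card (set (take (Suc j) xs)) = Suc j"
      using d[of "Suc j"] \<open>j < length xs\<close> by (simp add: distinct_card del: take_Suc)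
    moreover have "card (set (take (Suc j) xs)) \<le> card (proximity E S' T)"
      by (rule card_mono[OF _ sub]) (simp add: proximity_def)
    ultimately show ?thesis by simp
  qed
  moreover have conn: "connected_in E (insert (xs ! j) (set (take j xs)))"
    and dir: "(\<forall>y\<in>set (take j xs). (xs ! j, y) \<notin> E) \<or> (\<forall>y\<in>set (take j xs). (y, xs ! j) \<notin> E)"
    using xs \<open>j < length xs\<close> by (simp_all add: build_order_def)
  moreover obtain N where "N \<in> neighbourhoods E (xs ! j)" "set (take j xs) \<inter> N = {}"
    using dir by (auto simp: neighbourhoods_def)
  ultimately show ?thesis using v P that[of "xs ! j" "set (take j xs)" N] by simp
qed

section \<open>Growing a connected acyclic set\<close>

definition candidates :: "('a \<times> 'a) set \<Rightarrow> 'a set \<Rightarrow> 'a set \<Rightarrow> 'a set" where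
  "candidates E X T = {b. b \<notin> T \<and> (\<exists>a\<in>X. adjacent E a b)}"

text \<open>In a pair \<open>(X, T)\<close>, \<open>X\<close> is the current set and \<open>T\<close> consists of the vertices excluded from testing.\<close>

fun grow_step :: "('a::linorder \<times> 'a) set \<Rightarrow> 'a set \<times> 'a set \<Rightarrow> 'a set \<times> 'a set" where
  "grow_step E (X, T) =
    (if candidates E X T = {} then (X, T)
     else let u = Min (candidates E X T)
       in (if acyclic_in E (insert u X) then insert u X else X, insert u T))"

text \<open>A step that finds a candidate adds it to \<open>T\<close>, and a step without candidates
  idles, so \<open>card V\<close> steps always suffice. Taking the minimal candidate makes the
  result a function of the arguments, to which the program can be held exactly.\<close>

definition grown :: "('a::linorder \<times> 'a) set \<Rightarrow> nat \<Rightarrow> 'a set \<Rightarrow> 'a set \<Rightarrow> 'a set" where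
  "grown E k X T = fst ((grow_step E ^^ k) (X, T))"

definition completion :: "('a::linorder \<times> 'a) set \<Rightarrow> 'a set \<Rightarrow> 'a set \<Rightarrow> 'a set" where
  "completion E V X = grown E (card V) X X"

text \<open>The first growth may test vertices of \<open>S - N\<close> only, so it explores the
  component of \<open>v\<close> in \<open>insert v (S - N)\<close>; \<open>completion\<close> then
  admits all vertices.\<close>

definition neighbour :: "('a::linorder \<times> 'a) set \<Rightarrow> 'a set \<Rightarrow> 'a set \<Rightarrow> 'a \<Rightarrow> 'a set \<Rightarrow> 'a set" where
  "neighbour E V S v N = completion E V (grown E (card V) {v} (insert v (V - S \<union> N)))"

definition neighbour_sets :: "('a::linorder \<times> 'a) set \<Rightarrow> 'a set \<Rightarrow> 'a set \<Rightarrow> 'a set set" where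
  "neighbour_sets E V S = (\<Union>v\<in>V - S. neighbour E V S v ` neighbourhoods E v)"

text \<open>A rejected vertex stays rejected, because the current set only grows and acyclicity
  passes to subsets. The last clause holds since every step before the candidates run out enlarges
  the excluded set.\<close>

lemma grow_invariant:
  fixes E :: "('a::linorder \<times> 'a) set"
  assumes E: "E \<subseteq> V \<times> V" and V: "finite V" and X: "X \<subseteq> T" "T \<subseteq> V" "dag_set E X"
    and eq: "(grow_step E ^^ k) (X, T) = (X', T')"
  shows "X \<subseteq> X' \<and> X' \<subseteq> T' \<and> T \<subseteq> T' \<and> T' \<subseteq> V \<and> X' \<inter> T \<subseteq> X \<and> dag_set E X' \<and>
    (\<forall>u\<in>T' - T. u \<in> X' \<or> \<not> acyclic_in E (insert u X')) \<and>
    (candidates E X' T' = {} \<or> card T' \<ge> k + card T)"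
  using eq
proof (induction k arbitrary: X' T')
  case 0
  then show ?case using X by auto
next
  case (Suc k)
  obtain Y U where YU: "(grow_step E ^^ k) (X, T) = (Y, U)" by fastforce
  note IH = Suc.IH[OF YU]
  have step: "(X', T') = grow_step E (Y, U)" using Suc.prems YU by simp
  show ?case
  proof (cases "candidates E Y U = {}")
    case True
    then show ?thesis using IH step by simp
  next
    case False
    define u where "u = Min (candidates E Y U)"
    have cV: "candidates E Y U \<subseteq> V" using E by (auto simp: candidates_def adjacent_def)
    then have "u \<in> candidates E Y U"
      unfolding u_def using False V by (intro Min_in) (auto intro: finite_subset)
    then have u: "u \<notin> U" "u \<in> V" "\<exists>a\<in>Y. adjacent E a u" using cV by (auto simp: candidates_def)
    have T': "T' = insert u U" and X': "X' = (if acyclic_in E (insert u Y) then insert u Y else Y)"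
      using step False by (simp_all add: u_def Let_def)
    have dag: "dag_set E X'"
    proof (cases "acyclic_in E (insert u Y)")
      case True
      then show ?thesis using IH u(3) connected_in_insert[of E Y _ u] unfolding X' dag_set_def by auto
    next
      case False
      then show ?thesis using IH unfolding X' by simp
    qed
    have "Y \<subseteq> X'" using X' by auto
    then have "\<not> acyclic_in E (insert w X')" if "\<not> acyclic_in E (insert w Y)" for w
      using that acyclic_in_subset by (metis insert_mono)
    then have "\<forall>w\<in>T' - T. w \<in> X' \<or> \<not> acyclic_in E (insert w X')"
      using IH X' T' \<open>Y \<subseteq> X'\<close> by auto
    moreover have "card T' \<ge> Suc k + card T"
      using IH False u V T' by (auto simp: finite_subset card_insert_if)
    ultimately show ?thesis using IH dag X' T' u by (auto split: if_splits)
  qed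
qed

lemma grown_properties:
  fixes E :: "('a::linorder \<times> 'a) set"
  assumes E: "E \<subseteq> V \<times> V" and V: "finite V" and X: "X \<subseteq> T" "T \<subseteq> V" "dag_set E X"
  defines "X' \<equiv> grown E (card V) X T"
  shows "X \<subseteq> X'" "X' \<subseteq> V" "X' \<inter> T \<subseteq> X" "dag_set E X'"
    "\<And>a u. a \<in> X' \<Longrightarrow> adjacent E a u \<Longrightarrow> u \<notin> X' \<Longrightarrow> u \<notin> T \<Longrightarrow> \<not> acyclic_in E (insert u X')"
proof -
  obtain T' where eq: "(grow_step E ^^ card V) (X, T) = (X', T')"
    unfolding X'_def grown_def by (metis prod.collapse)
  note inv = grow_invariant[OF E V X eq]
  then show "X \<subseteq> X'" "X' \<subseteq> V" "X' \<inter> T \<subseteq> X" "dag_set E X'" by auto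
  \<comment> \<open>Otherwise all \<open>card V\<close> steps enlarged the excluded set, which would
    now be all of \<open>V\<close> and leave no candidate.\<close>
  have "candidates E X' T' = {}"
  proof (rule ccontr)
    assume c: "candidates E X' T' \<noteq> {}"
    then have "T' = V" using inv V by (metis add_leD1 card_seteq)
    then show False using c E by (auto simp: candidates_def adjacent_def)
  qed
  then show "\<not> acyclic_in E (insert u X')" if "a \<in> X'" "adjacent E a u" "u \<notin> X'" "u \<notin> T" for a u
    using inv that by (auto simp: candidates_def)
qed

text \<open>Stability under adding single vertices is enough: a larger connected set
  \<open>Y\<close> has a vertex \<open>u\<close> outside the completion but adjacent to it. Adding
  just \<open>u\<close> stays inside the acyclic set \<open>Y\<close>, so \<open>u\<close> cannot
  have been rejected.\<close>

lemma completion_maximal: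
  fixes E :: "('a::linorder \<times> 'a) set"
  assumes E: "E \<subseteq> V \<times> V" and V: "finite V" and X: "X \<subseteq> V" "dag_set E X"
  shows "X \<subseteq> completion E V X" "completion E V X \<in> maximal_dag_sets E V"
proof -
  note g = grown_properties[OF E V order.refl X, folded completion_def]
  show "X \<subseteq> completion E V X" using g(1) .
  have "\<not> dag_set E Y" if Y: "completion E V X \<subset> Y" "Y \<subseteq> V" for Y
  proof
    assume "dag_set E Y"
    then have con: "connected_in E Y" and ac: "acyclic_in E Y" by (auto simp: dag_set_def)
    have "completion E V X \<noteq> {}" using g(4) by (auto simp: dag_set_def connected_in_def)
    then obtain a u where "a \<in> completion E V X" "u \<in> Y - completion E V X" "adjacent E a u"
      using connected_in_cut[OF con, of "completion E V X"] Y by blast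
    then show False
      using g(1) g(5)[of a u] Y ac acyclic_in_subset[of E Y "insert u (completion E V X)"] by auto
  qed
  then show "completion E V X \<in> maximal_dag_sets E V"
    using g by (simp add: maximal_dag_sets_def)
qed

section \<open>Neighbours of a solution\<close>

lemma dag_set_singleton: "irrefl E \<Longrightarrow> dag_set E {v}"
  by (auto simp: dag_set_def connected_in_singleton acyclic_in_def irrefl_def subset_singleton_iff)

text \<open>For the second claim: the first growth stays inside \<open>insert v (S - N)\<close>,
  which is acyclic because \<open>v\<close> is a sink or a source of it. So no test fails, and
  connectivity of \<open>insert v P\<close> carries the growth to all of \<open>P\<close>.\<close>

lemma neighbour_properties:
  fixes E :: "('a::linorder \<times> 'a) set"
  assumes E: "E \<subseteq> V \<times> V" "irrefl E" and V: "finite V" and S: "acyclic_in E S" "S \<subseteq> V"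
    and v: "v \<in> V - S" and N: "N \<in> neighbourhoods E v"
  shows "neighbour E V S v N \<in> maximal_dag_sets E V"
    and "P \<subseteq> S \<Longrightarrow> connected_in E (insert v P) \<Longrightarrow> P \<inter> N = {} \<Longrightarrow> insert v P \<subseteq> neighbour E V S v N"
proof -
  define T where "T = insert v (V - S \<union> N)"
  define X where "X = grown E (card V) {v} T"
  have T: "{v} \<subseteq> T" "T \<subseteq> V" using v N E by (auto simp: T_def neighbourhoods_def)
  note g = grown_properties[OF E(1) V T dag_set_singleton[OF E(2)], folded X_def]
  have nb: "neighbour E V S v N = completion E V X"
    by (simp add: neighbour_def X_def T_def)
  note c = completion_maximal[OF E(1) V g(2,4)]
  show "neighbour E V S v N \<in> maximal_dag_sets E V" using c nb by simp
  assume P: "P \<subseteq> S" "connected_in E (insert v P)" "P \<inter> N = {}"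
  have acS: "acyclic_in E (insert v (S - N))"
  proof -
    have "acyclic_in E (S - N)" using S acyclic_in_subset by blast
    moreover have "(v, v) \<notin> E" using E(2) by (auto simp: irrefl_def)
    ultimately show ?thesis
      using N acyclic_in_insert_sink[of E "S - N" v] acyclic_in_insert_source[of E "S - N" v]
      by (auto simp: neighbourhoods_def)
  qed
  have "insert v P \<subseteq> X"
  proof (rule ccontr)
    assume "\<not> insert v P \<subseteq> X"
    then obtain a b where ab: "a \<in> insert v P \<inter> X" "b \<in> insert v P - insert v P \<inter> X" "adjacent E a b"
      using connected_in_cut[OF P(2), of "insert v P \<inter> X"] g(1) by blast
    then have "b \<notin> T" using P v g(1) by (auto simp: T_def)
    moreover have "insert b X \<subseteq> insert v (S - N)"
      using g(2,3) ab P by (auto simp: T_def)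
    ultimately show False using g(5)[of a b] ab acyclic_in_subset[OF acS] by blast
  qed
  then show "insert v P \<subseteq> neighbour E V S v N" using c(1) nb by auto
qed

lemma neighbour_sets_maximal:
  fixes E :: "('a::linorder \<times> 'a) set"
  assumes "E \<subseteq> V \<times> V" "irrefl E" "finite V" "S \<in> maximal_dag_sets E V"
  shows "neighbour_sets E V S \<subseteq> maximal_dag_sets E V"
proof -
  have S: "acyclic_in E S" "S \<subseteq> V" using assms(4) by (auto simp: maximal_dag_sets_def dag_set_def)
  show ?thesis
    unfolding neighbour_sets_def using neighbour_properties(1)[OF assms(1-3) S] by blast
qed

lemma neighbour_sets_proximity:
  fixes E :: "('a::linorder \<times> 'a) set"
  assumes E: "E \<subseteq> V \<times> V" "irrefl E" and V: "finite V"
    and S: "S \<in> maximal_dag_sets E V" and T: "T \<in> maximal_dag_sets E V" and ST: "S \<noteq> T"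
  shows "\<exists>S'\<in>neighbour_sets E V S. card (proximity E S T) < card (proximity E S' T)"
proof -
  have S': "acyclic_in E S" "S \<subseteq> V" using S unfolding maximal_dag_sets_def dag_set_def by blast+
  have T': "T \<subseteq> V" "dag_set E T" using T unfolding maximal_dag_sets_def by blast+
  have "\<not> T \<subset> S" using S' T S unfolding maximal_dag_sets_def by blast
  then have "\<not> T \<subseteq> S" using ST by blast
  from proximity_increases[OF finite_subset[OF T'(1) V] T'(2) this]
  obtain v P N where v: "v \<in> T - S" "P \<subseteq> S" "connected_in E (insert v P)"
    "N \<in> neighbourhoods E v" "P \<inter> N = {}"
    and less: "\<And>S'. insert v P \<subseteq> S' \<Longrightarrow> card (proximity E S T) < card (proximity E S' T)"
    by metis
  then have vV: "v \<in> V - S" using T' by blast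
  have "neighbour E V S v N \<in> neighbour_sets E V S"
    using vV v(4) unfolding neighbour_sets_def by blast
  then show ?thesis
    using less[OF neighbour_properties(2)[OF E V S' vV v(4,2,3,5)]] by blast
qed

text \<open>If \<open>T\<close> were missed, a member of \<open>Q\<close> of greatest proximity to
  \<open>T\<close> would have a neighbour, again in \<open>Q\<close>, of greater proximity. Hence
  the search reaches every solution from any start.\<close>

lemma neighbour_closed_eq_maximal:
  fixes E :: "('a::linorder \<times> 'a) set"
  assumes E: "E \<subseteq> V \<times> V" "irrefl E" and V: "finite V"
    and Q: "Q \<subseteq> maximal_dag_sets E V" "Q \<noteq> {}" "\<And>S. S \<in> Q \<Longrightarrow> neighbour_sets E V S \<subseteq> Q"
  shows "Q = maximal_dag_sets E V"
proof (rule ccontr)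
  assume "Q \<noteq> maximal_dag_sets E V"
  then obtain T where T: "T \<in> maximal_dag_sets E V" "T \<notin> Q" using Q by auto
  have "Q \<subseteq> Pow V" using Q(1) by (auto simp: maximal_dag_sets_def)
  then have "finite Q" using V by (meson finite_Pow_iff finite_subset)
  then have fin: "finite ((\<lambda>S. card (proximity E S T)) ` Q)" by simp
  then have "Max ((\<lambda>S. card (proximity E S T)) ` Q) \<in> (\<lambda>S. card (proximity E S T)) ` Q"
    using Q(2) by (intro Max_in) auto
  then obtain S where S: "S \<in> Q" "card (proximity E S T) = Max ((\<lambda>S. card (proximity E S T)) ` Q)"
    by auto
  have max: "card (proximity E S' T) \<le> card (proximity E S T)" if "S' \<in> Q" for S'
    using that fin S(2) by simp
  have "S \<in> maximal_dag_sets E V" "S \<noteq> T" using S(1) Q(1) T(2) by auto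
  then obtain S' where S': "S' \<in> neighbour_sets E V S" "card (proximity E S T) < card (proximity E S' T)"
    using neighbour_sets_proximity[OF E V _ T(1)] by blast
  then have "S' \<in> Q" using Q(3)[OF S(1)] by blast
  then show False using max[of S'] S'(2) by simp
qed

section \<open>Arc lists in topological order\<close>

text \<open>Among the arcs inside \<open>X\<close>, those that enter a vertex come before those that
  leave it; arcs with an end outside \<open>X\<close> are unrestricted. Ordering arcs instead of
  vertices lets a pass run over the arc list itself.\<close>

definition topological :: "'a set \<Rightarrow> ('a \<times> 'a) list \<Rightarrow> bool" where
  "topological X L \<longleftrightarrow> sorted_wrt (\<lambda>p q. \<not> (p \<in> X \<times> X \<and> q \<in> X \<times> X \<and> snd q = fst p)) L"

lemma topological_Cons:
  "topological X ((a, b) # L) \<longleftrightarrow>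
    (\<forall>c. a \<in> X \<longrightarrow> b \<in> X \<longrightarrow> c \<in> X \<longrightarrow> (c, a) \<notin> set L) \<and> topological X L"
  by (auto simp: topological_def)

text \<open>No arc after \<open>(a, b)\<close> enters \<open>a\<close>. So a set that contains both
  ends still has a sink when this arc is added, namely a sink of the set without \<open>a\<close>. A
  lone loop meets the order condition, hence the assumption on loops.\<close>

lemma topological_acyclic_in:
  assumes "\<forall>(a, b)\<in>set L. a \<noteq> b" "topological X L"
  shows "acyclic_in (set L) X"
  using assms
proof (induction L)
  case Nil
  then show ?case by (auto simp: acyclic_in_def)
next
  case (Cons p L)
  obtain a b where p: "p = (a, b)" by fastforce
  have ab: "a \<noteq> b" using Cons.prems p by auto
  have first: "\<And>c. a \<in> X \<Longrightarrow> b \<in> X \<Longrightarrow> c \<in> X \<Longrightarrow> (c, a) \<notin> set L" and "topological X L"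
    using Cons.prems(2) unfolding p topological_Cons by blast+
  then have IH: "acyclic_in (set L) X" using Cons.IH Cons.prems(1) by auto
  show ?case unfolding acyclic_in_def p
  proof (intro allI impI)
    fix Y assume Y: "Y \<subseteq> X" "Y \<noteq> {}"
    show "\<exists>y\<in>Y. \<forall>z\<in>Y. (y, z) \<notin> set ((a, b) # L)"
    proof (cases "a \<in> Y \<and> b \<in> Y")
      case False
      obtain y where "y \<in> Y" "\<forall>z\<in>Y. (y, z) \<notin> set L"
        using IH Y unfolding acyclic_in_def by meson
      then show ?thesis using False by (intro bexI[of _ y]) auto
    next
      case True
      then have "Y - {a} \<noteq> {}" "Y - {a} \<subseteq> X" using ab Y by auto
      then obtain y where "y \<in> Y - {a}" "\<forall>z\<in>Y - {a}. (y, z) \<notin> set L"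
        using IH unfolding acyclic_in_def by meson
      moreover have "(y, a) \<notin> set L" using first True Y \<open>y \<in> Y - {a}\<close> by auto
      ultimately show ?thesis by (intro bexI[of _ y]) auto
    qed
  qed
qed

section \<open>Reachability in one pass\<close>

fun propagate :: "'a set \<Rightarrow> ('a \<times> 'a) list \<Rightarrow> 'a set \<Rightarrow> 'a set" where
  "propagate X [] M = M"
| "propagate X ((a, b) # L) M = propagate X L (if a \<in> M \<and> b \<in> X then insert b M else M)"

lemma propagate_append: "propagate X (L @ L') M = propagate X L' (propagate X L M)"
  by (induction X L M rule: propagate.induct) auto

lemma propagate_increasing: "M \<subseteq> propagate X L M"
  by (induction X L M rule: propagate.induct) (auto split: if_splits)

lemma propagate_subset: "M \<subseteq> X \<Longrightarrow> propagate X L M \<subseteq> X"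
  by (induction X L M rule: propagate.induct) (auto split: if_splits)

lemma propagate_predecessor:
  "z \<in> propagate X L M \<Longrightarrow> z \<in> M \<or> (\<exists>x\<in>propagate X L M. (x, z) \<in> set L)"
proof (induction X L M rule: propagate.induct)
  case (2 X a b L M)
  have "a \<in> M \<Longrightarrow> a \<in> propagate X ((a, b) # L) M"
    using propagate_increasing[of M] by blast
  then show ?case using 2 by (auto split: if_splits)
qed auto

lemma propagate_sound:
  assumes "M \<subseteq> X" "z \<in> propagate X L M"
  shows "\<exists>y\<in>M. (y, z) \<in> (set L \<inter> X \<times> X)\<^sup>*"
  using assms
proof (induction X L M rule: propagate.induct)
  case (1 X M)
  then show ?case by auto
next
  case (2 X a b L M)
  let ?M = "if a \<in> M \<and> b \<in> X then insert b M else M"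
  obtain y where y: "y \<in> ?M" "(y, z) \<in> (set L \<inter> X \<times> X)\<^sup>*"
    using 2 by (auto split: if_splits)
  have yz: "(y, z) \<in> (set ((a, b) # L) \<inter> X \<times> X)\<^sup>*"
    by (rule rtrancl_mono[THEN subsetD, OF _ y(2)]) auto
  show ?case
  proof (cases "y \<in> M")
    case False
    then have "a \<in> M" "y = b" "b \<in> X" using y by (auto split: if_splits)
    then have "(a, y) \<in> set ((a, b) # L) \<inter> X \<times> X" using 2 by auto
    then show ?thesis using yz \<open>a \<in> M\<close> by (meson converse_rtrancl_into_rtrancl)
  qed (use yz in blast)
qed

text \<open>When the arc \<open>(a, b)\<close> is processed, \<open>a\<close> already has its final
  mark, because the arcs inside \<open>X\<close> that enter \<open>a\<close> have all been processed
  before. This is why one pass is enough.\<close>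

lemma propagate_closed:
  assumes "topological X L" "M \<subseteq> X" "(x, y) \<in> set L" "x \<in> propagate X L M" "y \<in> X"
  shows "y \<in> propagate X L M"
  using assms
proof (induction X L M rule: propagate.induct)
  case (2 X a b L M)
  let ?M = "if a \<in> M \<and> b \<in> X then insert b M else M"
  have M: "?M \<subseteq> X" using 2 by auto
  show ?case
  proof (cases "(x, y) \<in> set L")
    case True
    then show ?thesis using 2 M by (auto simp: topological_Cons)
  next
    case False
    then have xy: "x = a" "y = b" using 2 by auto
    \<comment> \<open>Either \<open>a\<close> is marked in time, or the arc is a loop, or the mark
      of \<open>a\<close> comes from a later arc \<open>(w, a)\<close>, which the order
      forbids.\<close>
    consider "a \<in> M" | "a = b" | w where "(w, a) \<in> set L" "w \<in> propagate X L ?M"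
      using propagate_predecessor[of x X L ?M] 2 xy by (auto split: if_splits)
    then show ?thesis
    proof cases
      case 1
      then have "b \<in> ?M" using 2 xy by auto
      then have "b \<in> propagate X L ?M" by (rule subsetD[OF propagate_increasing])
      then show ?thesis using xy by (simp only: propagate.simps)
    next
      case 2
      then show ?thesis using \<open>x \<in> propagate X ((a, b) # L) M\<close> xy by simp
    next
      case 3
      have "a \<in> X" using propagate_subset[OF M] 2 xy by auto
      then show ?thesis using 3 propagate_subset[OF M] 2(2) \<open>y \<in> X\<close> xy
        by (auto simp: topological_Cons)
    qed
  qed
qed auto

text \<open>
  Suppose that \<open>L\<close> lists the arcs of a digraph in an order that is topological on \<open>X\<close>, and that \<open>M\<close> is
  the set of vertices of \<open>X\<close> that a new vertex \<open>u\<close> reaches. This stable rearrangement is then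
  topological on \<open>insert u X\<close> unless an arc leads from \<open>M\<close> to \<open>u\<close>.
\<close>

definition rearranged :: "'a \<Rightarrow> 'a set \<Rightarrow> ('a \<times> 'a) list \<Rightarrow> ('a \<times> 'a) list" where
  "rearranged u M L =
    filter (\<lambda>(a, b). b \<noteq> u \<and> a \<noteq> u \<and> a \<notin> M) L @ filter (\<lambda>(a, b). b = u) L @
    filter (\<lambda>(a, b). b \<noteq> u \<and> a = u) L @ filter (\<lambda>(a, b). b \<noteq> u \<and> a \<noteq> u \<and> a \<in> M) L"

lemma set_rearranged: "set (rearranged u M L) = set L"
  by (auto simp: rearranged_def)

lemma length_rearranged: "length (rearranged u M L) = length L"
  by (induction L) (auto simp: rearranged_def)

lemma sorted_wrt_filterI:
  assumes "sorted_wrt R L" "\<And>p q. p \<in> set L \<Longrightarrow> q \<in> set L \<Longrightarrow> P p \<Longrightarrow> P q \<Longrightarrow> R p q \<Longrightarrow> R' p q"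
  shows "sorted_wrt R' (filter P L)"
  using assms by (induction L) auto

text \<open>Inside \<open>insert u X\<close>, arcs of the last two blocks of
  \<open>rearranged\<close> end in \<open>M\<close>, by closure. The first two blocks have no tail
  in \<open>M\<close>, provided that no arc leads from \<open>M\<close> to \<open>u\<close>, and
  \<open>u\<close> is entered only in the second block and left only in the third. Otherwise the old
  order is kept. Conversely, an arc from \<open>M\<close> to \<open>u\<close> closes a cycle with a
  path from \<open>u\<close> to its tail.\<close>

lemma insertion_test:
  assumes L: "\<forall>(a, b)\<in>set L. a \<noteq> b" and X: "topological X L" "u \<notin> X"
  defines "M \<equiv> propagate X L {y \<in> X. (u, y) \<in> set L}"
  shows "\<forall>x\<in>M. (x, u) \<notin> set L \<Longrightarrow> topological (insert u X) (rearranged u M L)"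
    and "finite X \<Longrightarrow> acyclic_in (set L) (insert u X) \<longleftrightarrow> (\<forall>x\<in>M. (x, u) \<notin> set L)"
proof -
  have M: "M \<subseteq> X" unfolding M_def by (rule propagate_subset) auto
  have closed: "y \<in> M" if "(x, y) \<in> set L" "x \<in> M \<or> x = u" "y \<in> X" for x y
  proof (cases "x = u")
    case True
    then show ?thesis using that propagate_increasing[of "{y \<in> X. (u, y) \<in> set L}" X L] by (auto simp: M_def)
  next
    case False
    then show ?thesis using that propagate_closed[OF X(1), of "{y \<in> X. (u, y) \<in> set L}" x y] by (auto simp: M_def)
  qed
  have top: "topological (insert u X) (rearranged u M L)" if no: "\<forall>x\<in>M. (x, u) \<notin> set L"
    unfolding topological_def rearranged_def sorted_wrt_append
    using L X(2) M no closed
    by (intro conjI ballI sorted_wrt_filterI[OF X(1)[unfolded topological_def]]) (auto 4 3)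
  then show "\<forall>x\<in>M. (x, u) \<notin> set L \<Longrightarrow> topological (insert u X) (rearranged u M L)" .
  assume fin: "finite X"
  show "acyclic_in (set L) (insert u X) \<longleftrightarrow> (\<forall>x\<in>M. (x, u) \<notin> set L)"
  proof
    assume no: "\<forall>x\<in>M. (x, u) \<notin> set L"
    show "acyclic_in (set L) (insert u X)"
      using topological_acyclic_in[OF _ top[OF no]] L by (simp add: set_rearranged)
  next
    assume ac: "acyclic_in (set L) (insert u X)"
    show "\<forall>x\<in>M. (x, u) \<notin> set L"
    proof (intro ballI notI)
      fix x assume x: "x \<in> M" "(x, u) \<in> set L"
      let ?R = "set L \<inter> insert u X \<times> insert u X"
      obtain y where y: "y \<in> X" "(u, y) \<in> set L" "(y, x) \<in> (set L \<inter> X \<times> X)\<^sup>*"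
        using propagate_sound[of "{y \<in> X. (u, y) \<in> set L}" X x L] x unfolding M_def by auto
      have "(y, x) \<in> ?R\<^sup>*" by (rule rtrancl_mono[THEN subsetD, OF _ y(3)]) auto
      moreover have "(u, y) \<in> ?R" "(x, u) \<in> ?R" using x y M by auto
      ultimately have "(u, u) \<in> ?R\<^sup>+" by (meson rtrancl_into_trancl1 rtrancl_into_trancl2 trancl.trancl_into_trancl)
      then show False using ac fin by (auto simp: acyclic_in_iff acyclic_def)
    qed
  qed
qed

section \<open>Program logic\<close>

text \<open>Total correctness with a step bound, for stretches without output. Such a stretch lies
  within a single gap, so outputs need attention only in the queue loop.\<close>

definition wp :: "nat \<Rightarrow> com \<Rightarrow> (state \<Rightarrow> bool) \<Rightarrow> state \<Rightarrow> bool" where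
  "wp t c Q s \<longleftrightarrow> (\<exists>tr s'. exec c s tr s' \<and> length tr \<le> t \<and> outputs tr = [] \<and> Q s')"

fun written_regs :: "com \<Rightarrow> nat set" where
  "written_regs (Assign x e) = {x}"
| "written_regs (Seq c d) = written_regs c \<union> written_regs d"
| "written_regs (If b c d) = written_regs c \<union> written_regs d"
| "written_regs (While b c) = written_regs c"
| "written_regs _ = {}"

fun written_cells :: "com \<Rightarrow> nat set" where
  "written_cells (Store a e f) = {a}"
| "written_cells (Seq c d) = written_cells c \<union> written_cells d"
| "written_cells (If b c d) = written_cells c \<union> written_cells d"
| "written_cells (While b c) = written_cells c"
| "written_cells _ = {}"

fun silent :: "com \<Rightarrow> bool" where
  "silent Flush = False"
| "silent (Seq c d) \<longleftrightarrow> silent c \<and> silent d"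
| "silent (If b c d) \<longleftrightarrow> silent c \<and> silent d"
| "silent (While b c) \<longleftrightarrow> silent c"
| "silent _ = True"

text \<open>The buffer is left open because \<open>silent\<close> commands may use
  \<open>Put\<close>; \<open>quiet\<close> commands keep it, by \<open>exec_quiet\<close>.\<close>

definition frame :: "nat set \<Rightarrow> nat set \<Rightarrow> state \<Rightarrow> state \<Rightarrow> bool" where
  "frame W A s s' \<longleftrightarrow> (\<forall>x. x \<notin> W \<longrightarrow> reg s' x = reg s x) \<and> (\<forall>a. a \<notin> A \<longrightarrow> cell s' a = cell s a)"

abbreviation preserved :: "com \<Rightarrow> state \<Rightarrow> state \<Rightarrow> bool" where
  "preserved c \<equiv> frame (written_regs c) (written_cells c)"

lemma frame_trans: "frame W A s s' \<Longrightarrow> frame W A s' s'' \<Longrightarrow> frame W A s s''"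
  by (simp add: frame_def)

lemma frame_mono: "frame W A s s' \<Longrightarrow> W \<subseteq> W' \<Longrightarrow> A \<subseteq> A' \<Longrightarrow> frame W' A' s s'"
  unfolding frame_def by blast

lemma exec_preserved: "exec c s tr s' \<Longrightarrow> silent c \<Longrightarrow> preserved c s s'"
proof (induction rule: exec.induct)
  case (Seq c s tr s' d tr' s'')
  then have "preserved (com.Seq c d) s s'" "preserved (com.Seq c d) s' s''"
    by (auto elim!: frame_mono)
  then show ?case by (rule frame_trans)
next
  case (WhileTrue b s c tr s' tr' s'')
  then have "preserved (While b c) s s'" "preserved (While b c) s' s''" by auto
  then show ?case by (rule frame_trans)
qed (auto simp: frame_def)

fun quiet :: "com \<Rightarrow> bool" where
  "quiet (Put e) = False"
| "quiet Flush = False"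
| "quiet (Seq c d) \<longleftrightarrow> quiet c \<and> quiet d"
| "quiet (If b c d) \<longleftrightarrow> quiet c \<and> quiet d"
| "quiet (While b c) \<longleftrightarrow> quiet c"
| "quiet _ = True"

lemma exec_quiet: "exec c s tr s' \<Longrightarrow> quiet c \<Longrightarrow> buffer s' = buffer s"
  by (induction rule: exec.induct) auto

lemma outputs_append: "outputs (tr @ tr') = outputs tr @ outputs tr'"
  by (induction tr rule: outputs.induct) auto

lemma wp_weaken:
  "wp t c Q s \<Longrightarrow> t \<le> t' \<Longrightarrow> (\<And>s'. Q s' \<Longrightarrow> Q' s') \<Longrightarrow> wp t' c Q' s"
  unfolding wp_def by (meson order_trans)

lemma wp_preserved: "wp t c Q s \<Longrightarrow> silent c \<Longrightarrow> wp t c (\<lambda>s'. Q s' \<and> preserved c s s') s"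
  unfolding wp_def using exec_preserved by blast

lemma wp_quiet: "wp t c Q s \<Longrightarrow> quiet c \<Longrightarrow> wp t c (\<lambda>s'. Q s' \<and> buffer s' = buffer s) s"
  unfolding wp_def using exec_quiet by blast

text \<open>The continuation receives the frame of \<open>c\<close>, so intermediate assertions need
  to mention only what \<open>c\<close> changes.\<close>

lemma wp_Seq:
  assumes "wp t c P s" "silent c" "\<And>s'. P s' \<Longrightarrow> preserved c s s' \<Longrightarrow> wp t' d Q s'"
    and "t + t' \<le> b"
  shows "wp b (Seq c d) Q s"
proof -
  obtain tr s' where 1: "exec c s tr s'" "length tr \<le> t" "outputs tr = []" "P s'"
    using assms(1) by (auto simp: wp_def)
  then obtain tr' s'' where 2: "exec d s' tr' s''" "length tr' \<le> t'" "outputs tr' = []" "Q s''"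
    using assms(2,3) exec_preserved by (metis wp_def)
  show ?thesis unfolding wp_def
    using exec.Seq[OF 1(1) 2(1)] 1 2 assms(4) by (intro exI[of _ "tr @ tr'"] exI[of _ s'']) (auto simp: outputs_append)
qed

lemma wp_If:
  assumes "test_val b s \<Longrightarrow> wp t c Q s" "\<not> test_val b s \<Longrightarrow> wp t d Q s" "Suc t \<le> t'"
  shows "wp t' (If b c d) Q s"
proof (cases "test_val b s")
  case True
  then obtain tr s' where "exec c s tr s'" "length tr \<le> t" "outputs tr = []" "Q s'"
    using assms(1) by (auto simp: wp_def)
  then show ?thesis unfolding wp_def using exec.IfTrue[OF True] assms(3)
    by (intro exI[of _ "Tick # tr"] exI[of _ s']) auto
next
  case False
  then obtain tr s' where "exec d s tr s'" "length tr \<le> t" "outputs tr = []" "Q s'"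
    using assms(2) by (auto simp: wp_def)
  then show ?thesis unfolding wp_def using exec.IfFalse[OF False] assms(3)
    by (intro exI[of _ "Tick # tr"] exI[of _ s']) auto
qed

section \<open>Loop-free commands and counting loops\<close>

fun simple :: "com \<Rightarrow> bool" where
  "simple (Seq c d) \<longleftrightarrow> simple c \<and> simple d"
| "simple (If b c d) \<longleftrightarrow> simple c \<and> simple d"
| "simple (While b c) = False"
| "simple Flush = False"
| "simple _ = True"

fun run :: "com \<Rightarrow> state \<Rightarrow> state" where
  "run (Assign x e) s = s\<lparr>reg := (reg s)(x := exp_val e s)\<rparr>"
| "run (Store a e f) s = s\<lparr>cell := (cell s)(a := (cell s a)(exp_val e s := exp_val f s))\<rparr>"
| "run (Put e) s = s\<lparr>buffer := buffer s @ [exp_val e s]\<rparr>"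
| "run (Seq c d) s = run d (run c s)"
| "run (If b c d) s = (if test_val b s then run c s else run d s)"
| "run _ s = s"

fun cost :: "com \<Rightarrow> nat" where
  "cost (Seq c d) = cost c + cost d"
| "cost (If b c d) = Suc (max (cost c) (cost d))"
| "cost _ = 1"

text \<open>Loop-free code is verified by rewriting with \<open>run\<close>; \<open>cost\<close>
  charges the dearer branch of a conditional.\<close>

lemma wp_simple:
  assumes "simple c" "Q (run c s)" "cost c \<le> t"
  shows "wp t c Q s"
proof -
  have "simple c \<Longrightarrow> \<exists>tr. exec c s tr (run c s) \<and> length tr \<le> cost c \<and> outputs tr = []" for s
  proof (induction c arbitrary: s)
    case (Seq c d)
    obtain tr where "exec c s tr (run c s)" "length tr \<le> cost c" "outputs tr = []"
      using Seq by auto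
    moreover obtain tr' where "exec d (run c s) tr' (run d (run c s))" "length tr' \<le> cost d" "outputs tr' = []"
      using Seq by force
    ultimately show ?case using exec.Seq by (intro exI[of _ "tr @ tr'"]) (auto simp: outputs_append)
  next
    case (If b c d)
    show ?case
    proof (cases "test_val b s")
      case True
      then obtain tr where "exec c s tr (run c s)" "length tr \<le> cost c" "outputs tr = []"
        using If by auto
      then show ?thesis using exec.IfTrue[OF True] True by (intro exI[of _ "Tick # tr"]) auto
    next
      case False
      then obtain tr where "exec d s tr (run d s)" "length tr \<le> cost d" "outputs tr = []"
        using If by auto
      then show ?thesis using exec.IfFalse[OF False] False by (intro exI[of _ "Tick # tr"]) auto
    qed
  next
    case Skip
    show ?case by (intro exI[of _ "[Tick]"]) (auto intro: exec.intros)
  next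
    case (Assign x e)
    show ?case by (intro exI[of _ "[Tick]"]) (auto intro: exec.intros)
  next
    case (Put e)
    show ?case by (intro exI[of _ "[Tick]"]) (auto intro: exec.intros)
  next
    case (Store a e f)
    show ?case by (intro exI[of _ "[Tick]"]) (auto intro: exec.intros)
  qed auto
  then show ?thesis using assms unfolding wp_def by (meson order_trans)
qed

definition For :: "nat \<Rightarrow> exp \<Rightarrow> com \<Rightarrow> com" where
  "For r e c = Seq (Assign r (Const 0))
     (While (Less (Reg r) e) (Seq c (Assign r (Add (Reg r) (Const 1)))))"

lemma For_simps [simp]:
  "written_regs (For r e c) = insert r (written_regs c)"
  "written_cells (For r e c) = written_cells c"
  "silent (For r e c) = silent c"
  "quiet (For r e c) = quiet c"
  by (auto simp: For_def)

text \<open>The summand \<open>2\<close> pays for the initialisation and the failing test,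
  \<open>k + 2\<close> for a round with its test and increment. The bound \<open>e\<close> is
  evaluated anew in every round, so its value has to be the same in all states that the frame
  allows.\<close>

lemma wp_For:
  assumes c: "silent c"
    and e: "\<And>s'. preserved (For r e c) s s' \<Longrightarrow> exp_val e s' = N"
    and init: "I 0 (s\<lparr>reg := (reg s)(r := 0)\<rparr>)"
    and step: "\<And>i s'. i < N \<Longrightarrow> I i s' \<Longrightarrow> reg s' r = i \<Longrightarrow> preserved (For r e c) s s' \<Longrightarrow>
      wp k c (\<lambda>s''. reg s'' r = i \<and> I (Suc i) (s''\<lparr>reg := (reg s'')(r := Suc i)\<rparr>)) s'"
    and post: "\<And>s'. I N s' \<Longrightarrow> preserved (For r e c) s s' \<Longrightarrow> Q s'"
    and t: "2 + N * (k + 2) \<le> t"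
  shows "wp t (For r e c) Q s"
proof -
  let ?c = "Seq c (Assign r (Add (Reg r) (Const 1)))"
  let ?w = "While (Less (Reg r) e) ?c"
  have loop: "\<exists>tr s''. exec ?w s' tr s'' \<and> length tr \<le> Suc (j * (k + 2)) \<and> outputs tr = [] \<and> Q s''"
    if "i + j = N" "I i s'" "reg s' r = i" "preserved (For r e c) s s'" for i j s'
    using that
  proof (induction j arbitrary: i s')
    case 0
    then have "exec ?w s' [Tick] s'" using e by (intro exec.WhileFalse) auto
    moreover have "Q s'" using post 0 by simp
    ultimately show ?case by (intro exI[of _ "[Tick]"] exI[of _ s']) auto
  next
    case (Suc j)
    obtain tr u where u: "exec c s' tr u" "length tr \<le> k" "outputs tr = []" "reg u r = i"
      "I (Suc i) (u\<lparr>reg := (reg u)(r := Suc i)\<rparr>)"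
      using step[of i s'] Suc.prems by (auto simp: wp_def)
    let ?u = "u\<lparr>reg := (reg u)(r := Suc i)\<rparr>"
    have "exec (Assign r (Add (Reg r) (Const 1))) u [Tick] ?u"
      using exec.Assign[of r "Add (Reg r) (Const 1)" u] u(4) by simp
    then have body: "exec ?c s' (tr @ [Tick]) ?u" using u(1) by (intro exec.Seq)
    have "frame (written_regs c) (written_cells c) s' u" using exec_preserved u(1) c by blast
    then have "preserved (For r e c) s ?u" using Suc.prems(4) by (auto simp: frame_def)
    then obtain tr' u' where u': "exec ?w ?u tr' u'" "length tr' \<le> Suc (j * (k + 2))" "outputs tr' = []" "Q u'"
      using Suc.IH[of "Suc i" ?u] Suc.prems u(5) by auto
    have "test_val (Less (Reg r) e) s'" using e Suc.prems by simp
    then have "exec ?w s' (Tick # (tr @ [Tick]) @ tr') u'" using body u'(1) by (rule exec.WhileTrue)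
    then show ?case using u u' by (intro exI[of _ "Tick # (tr @ [Tick]) @ tr'"] exI[of _ u']) (auto simp: outputs_append)
  qed
  let ?s = "s\<lparr>reg := (reg s)(r := 0)\<rparr>"
  have s: "exec (Assign r (Const 0)) s [Tick] ?s"
    using exec.Assign[of r "Const 0" s] by simp
  obtain tr s' where "exec ?w ?s tr s'" "length tr \<le> Suc (N * (k + 2))" "outputs tr = []" "Q s'"
    using loop[of 0 N ?s] init by (auto simp: frame_def)
  then show ?thesis unfolding wp_def For_def using exec.Seq[OF s] t
    by (intro exI[of _ "[Tick] @ tr"] exI[of _ s']) (auto simp: outputs_append)
qed

lemma wp_For_simple:
  assumes c: "simple c" "silent c" "r \<notin> written_regs c"
    and e: "\<And>s'. preserved (For r e c) s s' \<Longrightarrow> exp_val e s' = N"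
    and init: "I 0 (s\<lparr>reg := (reg s)(r := 0)\<rparr>)"
    and step: "\<And>i s'. i < N \<Longrightarrow> I i s' \<Longrightarrow> reg s' r = i \<Longrightarrow> preserved (For r e c) s s' \<Longrightarrow>
      I (Suc i) ((run c s')\<lparr>reg := (reg (run c s'))(r := Suc i)\<rparr>)"
    and post: "\<And>s'. I N s' \<Longrightarrow> preserved (For r e c) s s' \<Longrightarrow> Q s'"
    and t: "2 + N * (cost c + 2) \<le> t"
  shows "wp t (For r e c) Q s"
proof (rule wp_For[where I = I and k = "cost c"])
  fix i s' assume i: "i < N" "I i s'" "reg s' r = i" "preserved (For r e c) s s'"
  have reg_run: "simple c \<Longrightarrow> r \<notin> written_regs c \<Longrightarrow> reg (run c s) r = reg s r" for c and s :: state
    by (induction c arbitrary: s) auto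
  show "wp (cost c) c (\<lambda>s''. reg s'' r = i \<and> I (Suc i) (s''\<lparr>reg := (reg s'')(r := Suc i)\<rparr>)) s'"
    using step[OF i] i(3) reg_run c by (intro wp_simple) auto
qed (use assms in auto)

section \<open>The program that grows a set\<close>

text \<open>
  Registers: the numbers of arcs \<open>rA\<close> (part of the input) and of vertices \<open>rN\<close>; loop indices \<open>rI\<close>,
  \<open>rJ\<close>, \<open>rG\<close>, \<open>rV\<close>; candidate \<open>rU\<close>; cycle flag \<open>rF\<close>; binary encoding \<open>rM\<close> of a set and current
  power of two \<open>rP\<close>; read and write positions \<open>rR\<close>, \<open>rW\<close> of the queue.

  Arrays: tails \<open>aT\<close> and heads \<open>aH\<close> of the arcs in the current order; characteristic vectors of the
  solution being expanded (\<open>aS\<close>), of the set being grown (\<open>aX\<close>) and of the vertices excluded from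
  testing (\<open>aD\<close>); reachability marks \<open>aM\<close>; buffers \<open>aB\<close>, \<open>aC\<close> for rearranging the arcs; the queue
  \<open>aQ\<close> of characteristic vectors; \<open>aL\<close>, nonzero at the encodings of the sets found so far.
\<close>

abbreviation (input) "rA \<equiv> (1 :: nat)"
abbreviation (input) "rN \<equiv> (4 :: nat)"
abbreviation (input) "rI \<equiv> (5 :: nat)"
abbreviation (input) "rJ \<equiv> (6 :: nat)"
abbreviation (input) "rU \<equiv> (7 :: nat)"
abbreviation (input) "rF \<equiv> (8 :: nat)"
abbreviation (input) "rG \<equiv> (9 :: nat)"
abbreviation (input) "rV \<equiv> (10 :: nat)"
abbreviation (input) "rM \<equiv> (11 :: nat)"
abbreviation (input) "rP \<equiv> (12 :: nat)"
abbreviation (input) "rR \<equiv> (13 :: nat)"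
abbreviation (input) "rW \<equiv> (14 :: nat)"

abbreviation (input) "aT \<equiv> (1 :: nat)"
abbreviation (input) "aH \<equiv> (2 :: nat)"
abbreviation (input) "aS \<equiv> (4 :: nat)"
abbreviation (input) "aX \<equiv> (5 :: nat)"
abbreviation (input) "aD \<equiv> (6 :: nat)"
abbreviation (input) "aM \<equiv> (7 :: nat)"
abbreviation (input) "aB \<equiv> (8 :: nat)"
abbreviation (input) "aC \<equiv> (9 :: nat)"
abbreviation (input) "aQ \<equiv> (10 :: nat)"
abbreviation (input) "aL \<equiv> (11 :: nat)"

abbreviation cur :: "nat \<Rightarrow> exp" where "cur a \<equiv> Cell a (Reg rI)"
abbreviation nonzero :: "exp \<Rightarrow> test" where "nonzero e \<equiv> Neg (Eq e (Const 0))"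

definition scan_end :: "nat \<Rightarrow> nat \<Rightarrow> com" where
  "scan_end a b = If (Conj (nonzero (Cell aX (cur a)))
     (Conj (Eq (Cell aD (cur b)) (Const 0)) (Less (cur b) (Reg rU)))) (Assign rU (cur b)) Skip"

text \<open>The initial value \<open>rN\<close> exceeds every vertex: it is neutral for the minimum
  and, if it survives, signals that there is no candidate. Each arc is inspected from both
  ends.\<close>

definition find_candidate :: com where
  "find_candidate = Seq (Assign rU (Reg rN)) (For rI (Reg rA) (Seq (scan_end aT aH) (scan_end aH aT)))"

definition mark_init :: com where
  "mark_init = For rI (Reg rN) (Store aM (Reg rI) (Const 0))"

definition mark_successors :: com where
  "mark_successors = For rI (Reg rA)
     (If (Conj (Eq (cur aT) (Reg rU)) (nonzero (Cell aX (cur aH)))) (Store aM (cur aH) (Const 2)) Skip)"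

definition mark_propagate :: com where
  "mark_propagate = For rI (Reg rA)
     (If (Conj (Eq (Cell aM (cur aT)) (Const 2)) (nonzero (Cell aX (cur aH))))
       (Store aM (cur aH) (Const 2)) Skip)"

definition detect_cycle :: com where
  "detect_cycle = Seq (Assign rF (Const 0)) (For rI (Reg rA)
     (If (Conj (Eq (cur aH) (Reg rU)) (Eq (Cell aM (cur aT)) (Const 2))) (Assign rF (Const 1)) Skip))"

definition collect :: "test \<Rightarrow> com" where
  "collect b = For rI (Reg rA) (If b (Seq (Store aB (Reg rJ) (cur aT))
     (Seq (Store aC (Reg rJ) (cur aH)) (Assign rJ (Add (Reg rJ) (Const 1))))) Skip)"

definition copy_back :: com where
  "copy_back = For rI (Reg rA) (Seq (Store aT (Reg rI) (cur aB)) (Store aH (Reg rI) (cur aC)))"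

text \<open>Reached vertices carry \<open>2\<close>, the others \<open>0\<close>, and
  \<open>rearrange\<close> puts \<open>1\<close> on the candidate itself. So the three values of
  \<open>k\<close> select the three blocks of arcs that do not enter the candidate.\<close>

definition marked :: "nat \<Rightarrow> test" where
  "marked k = Conj (Neg (Eq (cur aH) (Reg rU))) (Eq (Cell aM (cur aT)) (Const k))"

definition rearrange :: com where
  "rearrange = Seq (Store aM (Reg rU) (Const 1)) (Seq (Assign rJ (Const 0))
     (Seq (collect (marked 0)) (Seq (collect (Eq (cur aH) (Reg rU)))
     (Seq (collect (marked 1)) (Seq (collect (marked 2)) copy_back)))))"

definition test_candidate :: com where
  "test_candidate = Seq mark_init (Seq mark_successors (Seq mark_propagate (Seq detect_cycle
     (Seq (Store aD (Reg rU) (Const 1))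
       (If (Eq (Reg rF) (Const 0)) (Seq (Store aX (Reg rU) (Const 1)) rearrange) Skip)))))"

definition grow :: com where
  "grow = For rG (Reg rN) (Seq find_candidate (If (Less (Reg rU) (Reg rN)) test_candidate Skip))"

lemmas program_defs = find_candidate_def scan_end_def mark_init_def mark_successors_def
  mark_propagate_def detect_cycle_def collect_def copy_back_def marked_def rearrange_def
  test_candidate_def grow_def

section \<open>Memory representation and single passes\<close>

definition bits :: "nat \<Rightarrow> (nat \<Rightarrow> nat) \<Rightarrow> nat set \<Rightarrow> bool" where
  "bits n f X \<longleftrightarrow> (\<forall>i<n. f i = (if i \<in> X then 1 else 0))"

definition holds_list :: "nat \<Rightarrow> nat \<Rightarrow> (nat \<times> nat) list \<Rightarrow> state \<Rightarrow> bool" where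
  "holds_list a b L s \<longleftrightarrow> (\<forall>i<length L. cell s a i = fst (L ! i) \<and> cell s b i = snd (L ! i))"

lemma candidates_empty: "candidates {} X T = {}"
  by (simp add: candidates_def adjacent_def)

lemma candidates_insert:
  "candidates (insert (a, b) F) X T = candidates F X T \<union>
     (if a \<in> X \<and> b \<notin> T then {b} else {}) \<union> (if b \<in> X \<and> a \<notin> T then {a} else {})"
  by (auto simp: candidates_def adjacent_def)

lemma run_scan_end:
  "reg (run (scan_end a b) s) rU =
    (if cell s aX (cell s a (reg s rI)) \<noteq> 0 \<and> cell s aD (cell s b (reg s rI)) = 0
     then min (cell s b (reg s rI)) else id) (reg s rU)"
  "reg (run (scan_end a b) s) rI = reg s rI"
  "cell (run (scan_end a b) s) = cell s"
  by (simp_all add: scan_end_def min_def)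

locale numbered_digraph =
  fixes n m :: nat and E :: "(nat \<times> nat) set"
  assumes arcs_subset: "E \<subseteq> {..<n} \<times> {..<n}" and arcs_irrefl: "irrefl E" and n_pos: "0 < n"
begin

text \<open>The order \<open>L\<close> changes during a run, and later postconditions quantify it
  existentially; its length and its set of entries stay fixed.\<close>

definition stored :: "(nat \<times> nat) list \<Rightarrow> state \<Rightarrow> bool" where
  "stored L s \<longleftrightarrow> reg s rN = n \<and> reg s rA = m \<and> length L = m \<and> set L = E \<and> holds_list aT aH L s"

lemma stored_nth:
  assumes "stored L s" "i < m"
  obtains a b where "L ! i = (a, b)" "cell s aT i = a" "cell s aH i = b" "a < n" "b < n" "a \<noteq> b" "(a, b) \<in> E"
proof -
  obtain a b where "L ! i = (a, b)" by fastforce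
  moreover have "L ! i \<in> E" using assms by (auto simp: stored_def)
  ultimately show ?thesis using that[of a b] assms arcs_subset arcs_irrefl
    by (auto simp: stored_def holds_list_def irrefl_def)
qed

lemma stored_frame:
  "stored L s \<Longrightarrow> frame W A s s' \<Longrightarrow> rN \<notin> W \<Longrightarrow> rA \<notin> W \<Longrightarrow> aT \<notin> A \<Longrightarrow> aH \<notin> A \<Longrightarrow> stored L s'"
  by (auto simp: stored_def frame_def holds_list_def)

abbreviation sz :: nat where "sz \<equiv> n + m"

lemma find_candidate_correct:
  assumes L: "stored L s" and X: "bits n (cell s aX) X" "bits n (cell s aD) T"
  shows "wp (10 * sz) find_candidate
    (\<lambda>s'. reg s' rU = (if candidates E X T = {} then n else Min (candidates E X T))) s"
  unfolding find_candidate_def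
proof (rule wp_Seq[where t = 1 and t' = "2 + m * 6" and P = "\<lambda>s'. reg s' rU = n"])
  show "wp 1 (Assign rU (Reg rN)) (\<lambda>s'. reg s' rU = n) s"
    using L by (intro wp_simple) (auto simp: stored_def)
  show "silent (Assign rU (Reg rN))" by simp
  fix s1 assume s1: "reg s1 rU = n" "preserved (Assign rU (Reg rN)) s s1"
  then have L1: "stored L s1" using L stored_frame by simp
  have X1: "bits n (cell s1 aX) X" "bits n (cell s1 aD) T" using X s1(2) by (simp_all add: frame_def)
  let ?C = "\<lambda>i. candidates (set (take i L)) X T"
  have sub: "?C i \<subseteq> {..<n}" for i
    using set_take_subset[of i L] arcs_subset L by (auto simp: candidates_def adjacent_def stored_def)
  then have fin: "finite (?C i)" for i using finite_subset by blast
  show "wp (2 + m * 6) (For rI (Reg rA) (Seq (scan_end aT aH) (scan_end aH aT)))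
     (\<lambda>s'. reg s' rU = (if candidates E X T = {} then n else Min (candidates E X T))) s1"
  \<comment> \<open>Inserting \<open>n\<close> keeps the minimum defined while no candidate has been
    seen.\<close>
  proof (rule wp_For_simple[where N = m and I = "\<lambda>i s'. reg s' rU = Min (insert n (?C i))"])
    fix i s2 assume i: "i < m" "reg s2 rU = Min (insert n (?C i))" "reg s2 rI = i"
      and p: "preserved (For rI (Reg rA) (Seq (scan_end aT aH) (scan_end aH aT))) s1 s2"
    have L2: "stored L s2" and X2: "bits n (cell s2 aX) X" "bits n (cell s2 aD) T"
      using L1 X1 p by (auto simp: stored_def holds_list_def frame_def scan_end_def)
    obtain a b where ab: "L ! i = (a, b)" "cell s2 aT i = a" "cell s2 aH i = b" "a < n" "b < n"
      using stored_nth[OF L2 i(1)] by metis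
    have tk: "set (take (Suc i) L) = insert (a, b) (set (take i L))"
      using ab i(1) L by (simp add: take_Suc_conv_app_nth stored_def)
    define D where "D = insert n (?C i)"
    have D: "finite D" "D \<noteq> {}" "reg s2 rU = Min D" using fin i(2) by (auto simp: D_def)
    have eq: "insert n (B \<union> A \<union> A') = A' \<union> (A \<union> insert n B)" for A A' B :: "nat set" by blast
    have C: "insert n (?C (Suc i)) = (if b \<in> X \<and> a \<notin> T then {a} else {}) \<union>
        ((if a \<in> X \<and> b \<notin> T then {b} else {}) \<union> D)"
      unfolding tk candidates_insert eq D_def ..
    have min: "Min (insert n (?C (Suc i))) = (if b \<in> X \<and> a \<notin> T then min a else id)
        ((if a \<in> X \<and> b \<notin> T then min b else id) (reg s2 rU))"
      unfolding C D(3) using D(1,2) by simp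
    have "cell s2 aX a = (if a \<in> X then 1 else 0)" "cell s2 aX b = (if b \<in> X then 1 else 0)"
      "cell s2 aD a = (if a \<in> T then 1 else 0)" "cell s2 aD b = (if b \<in> T then 1 else 0)"
      using X2 ab by (simp_all add: bits_def)
    then show "reg (run (Seq (scan_end aT aH) (scan_end aH aT)) s2
        \<lparr>reg := (reg (run (Seq (scan_end aT aH) (scan_end aH aT)) s2))(rI := Suc i)\<rparr>) rU =
        Min (insert n (?C (Suc i)))"
      unfolding min using ab(2,3) i(3) by (cases "a \<in> X"; cases "b \<in> X") (simp_all add: run_scan_end)
  next
    fix s2 assume s2: "reg s2 rU = Min (insert n (?C m))"
    have "?C m = candidates E X T" using L by (simp add: stored_def)
    \<comment> \<open>All candidates are below \<open>n\<close>, so \<open>n\<close> remains only if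
      there is none.\<close>
    moreover have "Min (insert n (?C m)) = Min (?C m)" if "?C m \<noteq> {}"
    proof -
      have "Min (?C m) < n" using Min_in[OF fin that] sub[of m] by blast
      then show ?thesis using Min_insert[OF fin that, of n] by simp
    qed
    ultimately show "reg s2 rU = (if candidates E X T = {} then n else Min (candidates E X T))"
      using s2 by auto
  qed (use s1 L1 in \<open>auto simp: scan_end_def stored_def frame_def candidates_empty\<close>)
qed (use n_pos in auto)

lemma mark_init_correct:
  assumes L: "stored L s"
  shows "wp (3 * sz + 2) mark_init (\<lambda>s'. \<forall>j<n. cell s' aM j = 0) s"
  unfolding mark_init_def
  by (rule wp_For_simple[where N = n and I = "\<lambda>i s'. \<forall>j<i. cell s' aM j = 0"])
    (use L in \<open>auto simp: stored_def frame_def less_Suc_eq\<close>)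

lemma mark_successors_correct:
  assumes L: "stored L s" and X: "bits n (cell s aX) X" and M: "\<forall>j<n. cell s aM j = 0"
    and u: "reg s rU = u"
  shows "wp (4 * sz + 2) mark_successors
    (\<lambda>s'. \<forall>j<n. cell s' aM j = (if j \<in> X \<and> (u, j) \<in> E then 2 else 0)) s"
  unfolding mark_successors_def
proof (rule wp_For_simple[where N = m and
      I = "\<lambda>i s'. \<forall>j<n. cell s' aM j = (if j \<in> X \<and> (u, j) \<in> set (take i L) then 2 else 0)"])
  let ?c = "If (Conj (Eq (cur aT) (Reg rU)) (nonzero (Cell aX (cur aH)))) (Store aM (cur aH) (Const 2)) Skip"
  fix i s2 assume i: "i < m" "\<forall>j<n. cell s2 aM j = (if j \<in> X \<and> (u, j) \<in> set (take i L) then 2 else 0)"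
      "reg s2 rI = i" and p: "preserved (For rI (Reg rA) ?c) s s2"
  have L2: "stored L s2" and X2: "bits n (cell s2 aX) X" "reg s2 rU = u"
    using L X u p by (auto simp: stored_def holds_list_def frame_def)
  obtain a b where ab: "L ! i = (a, b)" "cell s2 aT i = a" "cell s2 aH i = b" "a < n" "b < n"
    using stored_nth[OF L2 i(1)] by metis
  have tk: "set (take (Suc i) L) = insert (a, b) (set (take i L))"
    using ab i(1) L by (simp add: take_Suc_conv_app_nth stored_def)
  show "\<forall>j<n. cell (run ?c s2\<lparr>reg := (reg (run ?c s2))(rI := Suc i)\<rparr>) aM j =
     (if j \<in> X \<and> (u, j) \<in> set (take (Suc i) L) then 2 else 0)"
    unfolding tk using ab i(2,3) X2 by (auto simp: bits_def)
qed (use L M in \<open>auto simp: stored_def frame_def\<close>)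

lemma mark_propagate_correct:
  assumes L: "stored L s" and X: "bits n (cell s aX) X"
    and M: "\<forall>j<n. cell s aM j = (if j \<in> M then 2 else 0)"
  shows "wp (4 * sz + 2) mark_propagate
    (\<lambda>s'. \<forall>j<n. cell s' aM j = (if j \<in> propagate X L M then 2 else 0)) s"
  unfolding mark_propagate_def
proof (rule wp_For_simple[where N = m and
      I = "\<lambda>i s'. \<forall>j<n. cell s' aM j = (if j \<in> propagate X (take i L) M then 2 else 0)"])
  let ?c = "If (Conj (Eq (Cell aM (cur aT)) (Const 2)) (nonzero (Cell aX (cur aH))))
    (Store aM (cur aH) (Const 2)) Skip"
  fix i s2 assume i: "i < m"
      "\<forall>j<n. cell s2 aM j = (if j \<in> propagate X (take i L) M then 2 else 0)"
      "reg s2 rI = i" and p: "preserved (For rI (Reg rA) ?c) s s2"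
  have L2: "stored L s2" and X2: "bits n (cell s2 aX) X"
    using L X p by (auto simp: stored_def holds_list_def frame_def)
  obtain a b where ab: "L ! i = (a, b)" "cell s2 aT i = a" "cell s2 aH i = b" "a < n" "b < n"
    using stored_nth[OF L2 i(1)] by metis
  have tk: "take (Suc i) L = take i L @ [(a, b)]"
    using ab i(1) L by (simp add: take_Suc_conv_app_nth stored_def)
  show "\<forall>j<n. cell (run ?c s2\<lparr>reg := (reg (run ?c s2))(rI := Suc i)\<rparr>) aM j =
     (if j \<in> propagate X (take (Suc i) L) M then 2 else 0)"
    unfolding tk propagate_append using ab i(2,3) X2 by (auto simp: bits_def)
qed (use L M in \<open>auto simp: stored_def frame_def\<close>)

lemma detect_cycle_correct:
  assumes L: "stored L s" and M: "\<forall>j<n. cell s aM j = (if j \<in> M then 2 else 0)"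
    and u: "reg s rU = u"
  shows "wp (4 * sz + 3) detect_cycle
    (\<lambda>s'. reg s' rF = (if \<exists>x\<in>M. (x, u) \<in> E then 1 else 0)) s"
  unfolding detect_cycle_def
proof (rule wp_Seq[where t = 1 and t' = "4 * sz + 2" and P = "\<lambda>s'. reg s' rF = 0"])
  show "wp 1 (Assign rF (Const 0)) (\<lambda>s'. reg s' rF = 0) s" by (intro wp_simple) auto
  fix s1 assume s1: "reg s1 rF = 0" "preserved (Assign rF (Const 0)) s s1"
  let ?c = "If (Conj (Eq (cur aH) (Reg rU)) (Eq (Cell aM (cur aT)) (Const 2))) (Assign rF (Const 1)) Skip"
  show "wp (4 * sz + 2) (For rI (Reg rA) ?c)
      (\<lambda>s'. reg s' rF = (if \<exists>x\<in>M. (x, u) \<in> E then 1 else 0)) s1"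
  proof (rule wp_For_simple[where N = m and
        I = "\<lambda>i s'. reg s' rF = (if \<exists>x\<in>M. (x, u) \<in> set (take i L) then 1 else 0)"])
    fix i s2 assume i: "i < m" "reg s2 rF = (if \<exists>x\<in>M. (x, u) \<in> set (take i L) then 1 else 0)"
      "reg s2 rI = i" and p: "preserved (For rI (Reg rA) ?c) s1 s2"
    have L2: "stored L s2" and M2: "\<forall>j<n. cell s2 aM j = (if j \<in> M then 2 else 0)" "reg s2 rU = u"
      using L M u s1(2) p by (auto simp: stored_def holds_list_def frame_def)
    obtain a b where ab: "L ! i = (a, b)" "cell s2 aT i = a" "cell s2 aH i = b" "a < n" "b < n"
      using stored_nth[OF L2 i(1)] by metis
    have tk: "set (take (Suc i) L) = insert (a, b) (set (take i L))"
      using ab i(1) L by (simp add: take_Suc_conv_app_nth stored_def)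
    show "reg (run ?c s2\<lparr>reg := (reg (run ?c s2))(rI := Suc i)\<rparr>) rF =
        (if \<exists>x\<in>M. (x, u) \<in> set (take (Suc i) L) then 1 else 0)"
      unfolding tk using ab i(2,3) M2 by auto
  qed (use s1 L in \<open>auto simp: stored_def frame_def\<close>)
qed auto

text \<open>\<open>K\<close> is what earlier passes have collected, so successive passes concatenate
  their blocks. The test \<open>b\<close> has to be stable under the writes of the pass itself, to
  \<open>rI\<close>, \<open>rJ\<close>, \<open>aB\<close> and \<open>aC\<close>.\<close>

lemma collect_correct:
  assumes L: "stored L s" and K: "holds_list aB aC K s" "reg s rJ = length K"
    and b: "\<And>i s'. i < m \<Longrightarrow> reg s' rI = i \<Longrightarrow> frame {rI, rJ} {aB, aC} s s' \<Longrightarrow> test_val b s' \<longleftrightarrow> P (L ! i)"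
  shows "wp (6 * sz + 2) (collect b)
    (\<lambda>s'. holds_list aB aC (K @ filter P L) s' \<and> reg s' rJ = length (K @ filter P L)) s"
  unfolding collect_def
proof (rule wp_For_simple[where N = m and I = "\<lambda>i s'. holds_list aB aC (K @ filter P (take i L)) s' \<and>
      reg s' rJ = length (K @ filter P (take i L))"])
  let ?c = "If b (Seq (Store aB (Reg rJ) (cur aT))
     (Seq (Store aC (Reg rJ) (cur aH)) (Assign rJ (Add (Reg rJ) (Const 1))))) Skip"
  fix i s2 assume i: "i < m" "holds_list aB aC (K @ filter P (take i L)) s2 \<and>
      reg s2 rJ = length (K @ filter P (take i L))" "reg s2 rI = i"
    and p: "preserved (For rI (Reg rA) ?c) s s2"
  have p': "frame {rI, rJ} {aB, aC} s s2" using p by (auto simp: frame_def)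
  then have L2: "stored L s2" using L stored_frame by simp
  obtain x y where ab: "L ! i = (x, y)" "cell s2 aT i = x" "cell s2 aH i = y"
    using stored_nth[OF L2 i(1)] by metis
  have tk: "take (Suc i) L = take i L @ [(x, y)]"
    using ab i(1) L by (simp add: take_Suc_conv_app_nth stored_def)
  show "holds_list aB aC (K @ filter P (take (Suc i) L)) (run ?c s2\<lparr>reg := (reg (run ?c s2))(rI := Suc i)\<rparr>) \<and>
      reg (run ?c s2\<lparr>reg := (reg (run ?c s2))(rI := Suc i)\<rparr>) rJ = length (K @ filter P (take (Suc i) L))"
    unfolding tk using ab i b[OF i(1,3) p'] by (auto simp: holds_list_def nth_append less_Suc_eq)
qed (use L K in \<open>auto simp: stored_def frame_def holds_list_def\<close>)

lemma copy_back_correct: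
  assumes L: "stored L s" and K: "holds_list aB aC K s" "length K = m" "set K = E"
  shows "wp (4 * sz + 2) copy_back (stored K) s"
  unfolding copy_back_def
  by (rule wp_For_simple[where N = m and I = "\<lambda>i s'. \<forall>j<i. cell s' aT j = fst (K ! j) \<and> cell s' aH j = snd (K ! j)"])
    (use L K in \<open>auto simp: stored_def frame_def holds_list_def less_Suc_eq\<close>)

text \<open>The bound consists of four collecting passes of \<open>6 * sz + 2\<close> steps, one
  copy of \<open>4 * sz + 2\<close> steps and two single commands.\<close>

lemma rearrange_correct:
  assumes L: "stored L s" and M: "\<forall>j<n. cell s aM j = (if j \<in> M then 2 else 0)" and u: "reg s rU = u" "u \<notin> M"
  shows "wp (28 * sz + 12) rearrange (stored (rearranged u M L)) s"
proof -
  let ?L1 = "filter (\<lambda>(a, b). b \<noteq> u \<and> a \<noteq> u \<and> a \<notin> M) L" and ?L2 = "filter (\<lambda>(a, b). b = u) L"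
    and ?L3 = "filter (\<lambda>(a, b). b \<noteq> u \<and> a = u) L" and ?L4 = "filter (\<lambda>(a, b). b \<noteq> u \<and> a \<noteq> u \<and> a \<in> M) L"
  let ?M = "\<lambda>s. stored L s \<and> (\<forall>j<n. cell s aM j = (if j = u then 1 else if j \<in> M then 2 else 0)) \<and> reg s rU = u"
  let ?K = "\<lambda>K s. holds_list aB aC K s \<and> reg s rJ = length K"
  have keep: "?M s'" if "preserved (collect b) s s'" "?M s" for s s' b
    using that by (auto simp: stored_def holds_list_def frame_def collect_def)
  have marked: "test_val (marked k) s' \<longleftrightarrow> (case L ! i of (a, b) \<Rightarrow> b \<noteq> u \<and>
      (if a = u then 1 else if a \<in> M then 2 else 0) = k)"
    if asm: "?M s" "i < m" "reg s' rI = i" "frame {rI, rJ} {aB, aC} s s'" for s s' i k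
  proof -
    have s': "stored L s'" "reg s' rU = u" "\<forall>j<n. cell s' aM j = (if j = u then 1 else if j \<in> M then 2 else 0)"
      using asm by (auto simp: stored_def holds_list_def frame_def)
    obtain a b where "L ! i = (a, b)" "cell s' aT i = a" "cell s' aH i = b" "a < n"
      using stored_nth[OF s'(1) asm(2)] by metis
    then show ?thesis using s' asm(3) by (simp add: marked_def)
  qed
  have into: "test_val (Eq (cur aH) (Reg rU)) s' \<longleftrightarrow> (case L ! i of (a, b) \<Rightarrow> b = u)"
    if asm: "?M s" "i < m" "reg s' rI = i" "frame {rI, rJ} {aB, aC} s s'" for s s' i
  proof -
    have s': "stored L s'" "reg s' rU = u" using asm by (auto simp: stored_def holds_list_def frame_def)
    obtain a b where "L ! i = (a, b)" "cell s' aH i = b"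
      using stored_nth[OF s'(1) asm(2)] by metis
    then show ?thesis using s' asm(3) by simp
  qed
  have coll: "wp (6 * sz + 2) (collect b) (?K (K @ filter P L)) s"
    if asm: "?M s" "?K K s" "\<And>i s'. i < m \<Longrightarrow> reg s' rI = i \<Longrightarrow> frame {rI, rJ} {aB, aC} s s' \<Longrightarrow>
      test_val b s' \<longleftrightarrow> P (L ! i)" for b K P s
    using asm(1,2) by (intro collect_correct[where L = L]) (simp_all add: asm(3))
  have coll_into: "wp (6 * sz + 2) (collect (Eq (cur aH) (Reg rU))) (?K (K @ ?L2)) s"
    if "?M s" "?K K s" for K s
    by (rule coll[OF that]) (rule into[OF that(1)])
  have coll_0: "wp (6 * sz + 2) (collect (marked 0)) (?K (K @ ?L1)) s"
    if "?M s" "?K K s" for K s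
    by (rule coll[OF that], subst marked[OF that(1)], assumption+)
      (use u in \<open>auto split: prod.splits\<close>)
  have coll_1: "wp (6 * sz + 2) (collect (marked 1)) (?K (K @ ?L3)) s"
    if "?M s" "?K K s" for K s
    by (rule coll[OF that], subst marked[OF that(1)], assumption+)
      (use u in \<open>auto split: prod.splits\<close>)
  have coll_2: "wp (6 * sz + 2) (collect (marked 2)) (?K (K @ ?L4)) s"
    if "?M s" "?K K s" for K s
    by (rule coll[OF that], subst marked[OF that(1)], assumption+)
      (use u in \<open>auto split: prod.splits\<close>)
  show ?thesis
    unfolding rearrange_def
  proof (rule wp_Seq[where t = 1 and t' = "28 * sz + 11" and P = ?M])
    show "wp 1 (Store aM (Reg rU) (Const 1)) ?M s"
      using assms by (intro wp_simple) (auto simp: stored_def holds_list_def)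
    fix s1 assume s1: "?M s1"
    show "wp (28 * sz + 11) (Seq (Assign rJ (Const 0))
      (Seq (collect (marked 0)) (Seq (collect (Eq (cur aH) (Reg rU)))
      (Seq (collect (marked 1)) (Seq (collect (marked 2)) copy_back))))) (stored (rearranged u M L)) s1"
    proof (rule wp_Seq[where t = 1 and t' = "28 * sz + 10" and P = "\<lambda>s. ?M s \<and> ?K [] s"])
      show "wp 1 (Assign rJ (Const 0)) (\<lambda>s. ?M s \<and> ?K [] s) s1"
        using s1 by (intro wp_simple) (auto simp: stored_def holds_list_def)
      fix s2 assume s2: "?M s2 \<and> ?K [] s2"
      show "wp (28 * sz + 10) (Seq (collect (marked 0)) (Seq (collect (Eq (cur aH) (Reg rU)))
        (Seq (collect (marked 1)) (Seq (collect (marked 2)) copy_back)))) (stored (rearranged u M L)) s2"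
      proof (rule wp_Seq[where t = "6 * sz + 2" and t' = "22 * sz + 8" and P = "?K ?L1"])
        show "wp (6 * sz + 2) (collect (marked 0)) (?K ?L1) s2"
          using coll_0[of s2 "[]"] s2 by simp
        fix s3 assume "?K ?L1 s3" "preserved (collect (marked 0)) s2 s3"
        then have s3: "?K ?L1 s3" "?M s3" using keep s2 by blast+
        show "wp (22 * sz + 8) (Seq (collect (Eq (cur aH) (Reg rU)))
          (Seq (collect (marked 1)) (Seq (collect (marked 2)) copy_back))) (stored (rearranged u M L)) s3"
        proof (rule wp_Seq[where t = "6 * sz + 2" and t' = "16 * sz + 6" and P = "?K (?L1 @ ?L2)"])
          show "wp (6 * sz + 2) (collect (Eq (cur aH) (Reg rU))) (?K (?L1 @ ?L2)) s3"
            by (rule coll_into) (use s3 in auto)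
          fix s4 assume "?K (?L1 @ ?L2) s4" "preserved (collect (Eq (cur aH) (Reg rU))) s3 s4"
          then have s4: "?K (?L1 @ ?L2) s4" "?M s4" using keep s3 by blast+
          show "wp (16 * sz + 6) (Seq (collect (marked 1)) (Seq (collect (marked 2)) copy_back))
            (stored (rearranged u M L)) s4"
          proof (rule wp_Seq[where t = "6 * sz + 2" and t' = "10 * sz + 4" and P = "?K ((?L1 @ ?L2) @ ?L3)"])
            show "wp (6 * sz + 2) (collect (marked 1)) (?K ((?L1 @ ?L2) @ ?L3)) s4"
              by (rule coll_1) (use s4 in auto)
            fix s5 assume "?K ((?L1 @ ?L2) @ ?L3) s5" "preserved (collect (marked 1)) s4 s5"
            then have s5: "?K ((?L1 @ ?L2) @ ?L3) s5" "?M s5" using keep s4 by blast+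
            show "wp (10 * sz + 4) (Seq (collect (marked 2)) copy_back) (stored (rearranged u M L)) s5"
            proof (rule wp_Seq[where t = "6 * sz + 2" and t' = "4 * sz + 2" and
                  P = "?K (((?L1 @ ?L2) @ ?L3) @ ?L4)"])
              show "wp (6 * sz + 2) (collect (marked 2)) (?K (((?L1 @ ?L2) @ ?L3) @ ?L4)) s5"
                by (rule coll_2) (use s5 in auto)
              fix s6 assume "?K (((?L1 @ ?L2) @ ?L3) @ ?L4) s6" "preserved (collect (marked 2)) s5 s6"
              then have s6: "?K (((?L1 @ ?L2) @ ?L3) @ ?L4) s6" "?M s6" using keep s5 by blast+
              show "wp (4 * sz + 2) copy_back (stored (rearranged u M L)) s6"
              proof -
                have "((?L1 @ ?L2) @ ?L3) @ ?L4 = rearranged u M L" by (simp add: rearranged_def)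
                then show ?thesis using s6
                  by (intro copy_back_correct[where L = L])
                    (auto simp: set_rearranged length_rearranged stored_def)
              qed
            qed (auto simp: program_defs)
          qed (auto simp: program_defs)
        qed (auto simp: program_defs)
      qed (auto simp: program_defs)
    qed (auto simp: program_defs)
  qed (auto simp: program_defs)
qed

end

text \<open>Powers of two arise by doubling, as the machine cannot multiply; so \<open>rM\<close>
  becomes \<open>set_encode\<close> of the set after \<open>n\<close> rounds. Vectors lie side by
  side in \<open>aQ\<close>, and advancing \<open>rW\<close> cell by cell avoids computing
  addresses.\<close>

definition enqueue :: com where
  "enqueue = Seq (Assign rM (Const 0)) (Seq (Assign rP (Const 1))
     (Seq (For rI (Reg rN) (Seq (If (nonzero (cur aX)) (Assign rM (Add (Reg rM) (Reg rP))) Skip)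
        (Assign rP (Add (Reg rP) (Reg rP)))))
     (If (Eq (Cell aL (Reg rM)) (Const 0))
       (Seq (Store aL (Reg rM) (Const 1))
         (For rI (Reg rN) (Seq (Store aQ (Reg rW) (cur aX)) (Assign rW (Add (Reg rW) (Const 1))))))
       Skip)))"

text \<open>With \<open>aT\<close> and \<open>aH\<close> for \<open>a\<close> and \<open>b\<close>
  the out-neighbours of \<open>rV\<close> are excluded, with the arrays exchanged the in-neighbours.
  Subtraction from \<open>1\<close> complements the bits of \<open>aS\<close>.\<close>

definition exclude :: "nat \<Rightarrow> nat \<Rightarrow> com" where
  "exclude a b = Seq (For rI (Reg rN) (Seq (Store aD (Reg rI) (Sub (Const 1) (cur aS))) (Store aX (Reg rI) (Const 0))))
     (Seq (Store aX (Reg rV) (Const 1)) (Seq (Store aD (Reg rV) (Const 1))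
       (For rI (Reg rA) (If (Eq (cur a) (Reg rV)) (Store aD (cur b) (Const 1)) Skip))))"

definition complete :: com where
  "complete = Seq (For rI (Reg rN) (Store aD (Reg rI) (cur aX))) (Seq grow enqueue)"

definition make_neighbour :: "nat \<Rightarrow> nat \<Rightarrow> com" where
  "make_neighbour a b = Seq (exclude a b) (Seq grow complete)"

definition make_neighbours :: com where
  "make_neighbours = For rV (Reg rN)
     (If (Eq (Cell aS (Reg rV)) (Const 0)) (Seq (make_neighbour aT aH) (make_neighbour aH aT)) Skip)"

lemmas program_defs' = program_defs enqueue_def exclude_def complete_def make_neighbour_def make_neighbours_def

lemma written:
  "written_regs find_candidate = {rU, rI}" "written_cells find_candidate = {}"
  "written_regs test_candidate = {rI, rF, rJ}" "written_cells test_candidate = {aM, aD, aX, aB, aC, aT, aH}"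
  "written_regs grow = {rG, rU, rI, rF, rJ}" "written_cells grow = {aM, aD, aX, aB, aC, aT, aH}"
  "written_regs enqueue = {rM, rP, rI, rW}" "written_cells enqueue = {aL, aQ}"
  "written_regs (exclude a b) = {rI}" "written_cells (exclude a b) = {aD, aX}"
  "written_regs complete = {rG, rU, rI, rF, rJ, rM, rP, rW}"
  "written_cells complete = {aM, aD, aX, aB, aC, aT, aH, aL, aQ}"
  "written_regs (make_neighbour a b) = {rG, rU, rI, rF, rJ, rM, rP, rW}"
  "written_cells (make_neighbour a b) = {aM, aD, aX, aB, aC, aT, aH, aL, aQ}"
  "written_regs make_neighbours = {rV, rG, rU, rI, rF, rJ, rM, rP, rW}"
  "written_cells make_neighbours = {aM, aD, aX, aB, aC, aT, aH, aL, aQ}"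
  by (auto simp: program_defs')

lemma quiet_programs:
  "quiet find_candidate" "quiet test_candidate" "quiet grow" "quiet enqueue" "quiet (exclude a b)" "quiet complete"
  "quiet (make_neighbour a b)" "quiet make_neighbours"
  by (simp_all add: program_defs')

lemma quiet_silent: "quiet c \<Longrightarrow> silent c"
  by (induction c) auto

lemmas silent_programs = quiet_programs[THEN quiet_silent]

context numbered_digraph
begin

section \<open>Correctness of testing and growing\<close>

definition working :: "(nat \<times> nat) list \<Rightarrow> nat set \<Rightarrow> nat set \<Rightarrow> state \<Rightarrow> bool" where
  "working L X T s \<longleftrightarrow> stored L s \<and> topological X L \<and> bits n (cell s aX) X \<and> bits n (cell s aD) T"

text \<open>By \<open>insertion_test\<close> the flag decides acyclicity. The arcs are rearranged
  only on acceptance: a rejection leaves \<open>X\<close> unchanged, so the old order remains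
  topological.\<close>

lemma test_candidate_correct:
  assumes W: "working L X T s" and u: "reg s rU = u" "u < n" "u \<notin> X" and X: "X \<subseteq> {..<n}"
  shows "wp (43 * sz + 24) test_candidate
    (\<lambda>s'. \<exists>L'. working L' (if acyclic_in E (insert u X) then insert u X else X) (insert u T) s') s"
  unfolding test_candidate_def
proof (rule wp_Seq[where t = "3 * sz + 2" and t' = "40 * sz + 22"])
  define M where "M = propagate X L {y \<in> X. (u, y) \<in> E}"
  have L: "stored L s" "bits n (cell s aX) X" "bits n (cell s aD) T" "topological X L"
    using W by (auto simp: working_def)
  have LE: "set L = E" "\<forall>(a, b)\<in>set L. a \<noteq> b" using L(1) arcs_irrefl by (auto simp: stored_def irrefl_def)
  have MX: "M \<subseteq> X" unfolding M_def by (rule propagate_subset) auto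
  have fin: "finite X" using X finite_subset by blast
  note ins = insertion_test[OF LE(2) L(4) u(3), unfolded LE(1), folded M_def]
  let ?P = "\<lambda>s. stored L s \<and> bits n (cell s aX) X \<and> bits n (cell s aD) T \<and> reg s rU = u"
  have keep: "?P s'" if "preserved c s s'" "?P s"
    "written_regs c \<inter> {rN, rA, rU} = {}" "written_cells c \<inter> {aT, aH, aX, aD} = {}" for c s s'
    using that by (auto simp: stored_def holds_list_def frame_def)
  show "wp (3 * sz + 2) mark_init (\<lambda>s'. \<forall>j<n. cell s' aM j = 0) s"
    using L by (intro mark_init_correct)
  fix s1 assume 1: "\<forall>j<n. cell s1 aM j = 0" "preserved mark_init s s1"
  have P1: "?P s1" by (rule keep[OF 1(2)]) (use L u in \<open>auto simp: program_defs\<close>)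
  show "wp (40 * sz + 22) (Seq mark_successors (Seq mark_propagate (Seq detect_cycle
     (Seq (Store aD (Reg rU) (Const 1))
       (If (Eq (Reg rF) (Const 0)) (Seq (Store aX (Reg rU) (Const 1)) rearrange) Skip)))))
     (\<lambda>s'. \<exists>L'. working L' (if acyclic_in E (insert u X) then insert u X else X) (insert u T) s') s1"
  proof (rule wp_Seq[where t = "4 * sz + 2" and t' = "36 * sz + 20"])
    show "wp (4 * sz + 2) mark_successors
      (\<lambda>s'. \<forall>j<n. cell s' aM j = (if j \<in> X \<and> (u, j) \<in> E then 2 else 0)) s1"
      by (rule mark_successors_correct) (use P1 1 in auto)
    fix s2 assume 2: "\<forall>j<n. cell s2 aM j = (if j \<in> X \<and> (u, j) \<in> E then 2 else 0)" "preserved mark_successors s1 s2"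
    have P2: "?P s2" by (rule keep[OF 2(2) P1]) (auto simp: program_defs)
    show "wp (36 * sz + 20) (Seq mark_propagate (Seq detect_cycle
     (Seq (Store aD (Reg rU) (Const 1))
       (If (Eq (Reg rF) (Const 0)) (Seq (Store aX (Reg rU) (Const 1)) rearrange) Skip))))
     (\<lambda>s'. \<exists>L'. working L' (if acyclic_in E (insert u X) then insert u X else X) (insert u T) s') s2"
    proof (rule wp_Seq[where t = "4 * sz + 2" and t' = "32 * sz + 18"])
      show "wp (4 * sz + 2) mark_propagate (\<lambda>s'. \<forall>j<n. cell s' aM j = (if j \<in> M then 2 else 0)) s2"
        unfolding M_def by (rule mark_propagate_correct) (use P2 2 in auto)
      fix s3 assume 3: "\<forall>j<n. cell s3 aM j = (if j \<in> M then 2 else 0)" "preserved mark_propagate s2 s3"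
      have P3: "?P s3" by (rule keep[OF 3(2) P2]) (auto simp: program_defs)
      show "wp (32 * sz + 18) (Seq detect_cycle (Seq (Store aD (Reg rU) (Const 1))
       (If (Eq (Reg rF) (Const 0)) (Seq (Store aX (Reg rU) (Const 1)) rearrange) Skip)))
       (\<lambda>s'. \<exists>L'. working L' (if acyclic_in E (insert u X) then insert u X else X) (insert u T) s') s3"
      proof (rule wp_Seq[where t = "4 * sz + 3" and t' = "28 * sz + 15"])
        show "wp (4 * sz + 3) detect_cycle (\<lambda>s'. reg s' rF = (if \<exists>x\<in>M. (x, u) \<in> E then 1 else 0)) s3"
          by (rule detect_cycle_correct) (use P3 3 in auto)
        fix s4 assume 4: "reg s4 rF = (if \<exists>x\<in>M. (x, u) \<in> E then 1 else 0)" "preserved detect_cycle s3 s4"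
        have P4: "?P s4" by (rule keep[OF 4(2) P3]) (auto simp: program_defs)
        have M4: "\<forall>j<n. cell s4 aM j = (if j \<in> M then 2 else 0)"
          using 4(2) 3(1) by (simp add: frame_def program_defs)
        let ?R = "\<lambda>s. stored L s \<and> bits n (cell s aX) X \<and> bits n (cell s aD) (insert u T) \<and> reg s rU = u \<and>
          reg s rF = reg s4 rF \<and> (\<forall>j<n. cell s aM j = (if j \<in> M then 2 else 0))"
        show "wp (28 * sz + 15) (Seq (Store aD (Reg rU) (Const 1))
          (If (Eq (Reg rF) (Const 0)) (Seq (Store aX (Reg rU) (Const 1)) rearrange) Skip))
          (\<lambda>s'. \<exists>L'. working L' (if acyclic_in E (insert u X) then insert u X else X) (insert u T) s') s4"
        proof (rule wp_Seq[where t = 1 and t' = "28 * sz + 14" and P = ?R])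
          show "wp 1 (Store aD (Reg rU) (Const 1)) ?R s4"
            using P4 M4 by (intro wp_simple) (auto simp: stored_def holds_list_def bits_def)
          fix s5 assume 5: "?R s5"
          show "wp (28 * sz + 14) (If (Eq (Reg rF) (Const 0)) (Seq (Store aX (Reg rU) (Const 1)) rearrange) Skip)
            (\<lambda>s'. \<exists>L'. working L' (if acyclic_in E (insert u X) then insert u X else X) (insert u T) s') s5"
          proof (rule wp_If[where t = "28 * sz + 13"])
            assume "\<not> test_val (Eq (Reg rF) (Const 0)) s5"
            then have "\<not> acyclic_in E (insert u X)" using 4 5 ins(2) fin by (auto split: if_splits)
            then show "wp (28 * sz + 13) Skip
              (\<lambda>s'. \<exists>L'. working L' (if acyclic_in E (insert u X) then insert u X else X) (insert u T) s') s5"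
              using 5 L(4) by (intro wp_simple) (auto simp: working_def)
          next
            assume "test_val (Eq (Reg rF) (Const 0)) s5"
            then have no: "\<forall>x\<in>M. (x, u) \<notin> E" using 4 5 by (auto split: if_splits)
            let ?S = "\<lambda>s. stored L s \<and> bits n (cell s aX) (insert u X) \<and> bits n (cell s aD) (insert u T) \<and>
              reg s rU = u \<and> (\<forall>j<n. cell s aM j = (if j \<in> M then 2 else 0))"
            show "wp (28 * sz + 13) (Seq (Store aX (Reg rU) (Const 1)) rearrange)
              (\<lambda>s'. \<exists>L'. working L' (if acyclic_in E (insert u X) then insert u X else X) (insert u T) s') s5"
            proof (rule wp_Seq[where t = 1 and t' = "28 * sz + 12" and P = ?S])
              show "wp 1 (Store aX (Reg rU) (Const 1)) ?S s5"
                using 5 by (intro wp_simple) (auto simp: stored_def holds_list_def bits_def)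
              fix s6 assume 6: "?S s6"
              have "wp (28 * sz + 12) rearrange (stored (rearranged u M L)) s6"
                using 6 MX u by (intro rearrange_correct) auto
              then have "wp (28 * sz + 12) rearrange
                (\<lambda>s'. stored (rearranged u M L) s' \<and> preserved rearrange s6 s') s6"
                by (rule wp_preserved) (simp add: program_defs)
              then show "wp (28 * sz + 12) rearrange
                (\<lambda>s'. \<exists>L'. working L' (if acyclic_in E (insert u X) then insert u X else X) (insert u T) s') s6"
              proof (rule wp_weaken)
                fix s7 assume "stored (rearranged u M L) s7 \<and> preserved rearrange s6 s7"
                then have "working (rearranged u M L) (insert u X) (insert u T) s7"
                  using 6 ins(1)[OF no] by (auto simp: working_def frame_def program_defs)
                then show "\<exists>L'. working L' (if acyclic_in E (insert u X) then insert u X else X) (insert u T) s7"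
                  using ins(2)[OF fin] no by auto
              qed simp
            qed auto
          qed auto
        qed auto
      qed (auto simp: program_defs)
    qed (auto simp: program_defs)
  qed (auto simp: program_defs)
qed (auto simp: program_defs)

text \<open>A round simulates one \<open>grow_step\<close> in \<open>10 * sz + 43 * sz + 25\<close>
  steps, at most \<open>78 * sz\<close> because \<open>sz\<close> is positive. Loop overhead raises
  \<open>78\<close> to \<open>82\<close>.\<close>

lemma grow_correct:
  assumes W: "working L X T s" and X: "dag_set E X" "X \<subseteq> T" "T \<subseteq> {..<n}"
  shows "wp (82 * n * sz) grow (\<lambda>s'. \<exists>L' T'. working L' (grown E n X T) T' s') s"
  unfolding grow_def
proof (rule wp_For[where N = n and k = "78 * sz" and
      I = "\<lambda>i s'. \<exists>L'. (\<lambda>(X, T). working L' X T s') ((grow_step E ^^ i) (X, T))"])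
  let ?c = "Seq find_candidate (If (Less (Reg rU) (Reg rN)) test_candidate Skip)"
  fix i s1 assume i: "i < n" "\<exists>L'. (\<lambda>(X, T). working L' X T s1) ((grow_step E ^^ i) (X, T))" "reg s1 rG = i"
  obtain Y U where YU: "(grow_step E ^^ i) (X, T) = (Y, U)" by fastforce
  then obtain L1 where L1: "working L1 Y U s1" using i by auto
  have Y: "Y \<subseteq> U" "U \<subseteq> {..<n}"
    using grow_invariant[OF arcs_subset _ X(2,3,1) YU] by auto
  have fin: "finite (candidates E Y U)" and sub: "candidates E Y U \<subseteq> {..<n}"
    using arcs_subset finite_subset[of "candidates E Y U" "{..<n}"] by (auto simp: candidates_def adjacent_def)
  define u where "u = (if candidates E Y U = {} then n else Min (candidates E Y U))"
  have "wp (78 * sz) ?c (\<lambda>s'. \<exists>L'. (\<lambda>(X, T). working L' X T s') (grow_step E (Y, U))) s1"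
  proof (rule wp_Seq[where t = "10 * sz" and t' = "43 * sz + 24 + 1"])
    show "wp (10 * sz) find_candidate (\<lambda>s'. reg s' rU = u) s1"
      unfolding u_def by (rule find_candidate_correct) (use L1 in \<open>auto simp: working_def\<close>)
    fix s2 assume 2: "reg s2 rU = u" "preserved find_candidate s1 s2"
    then have L2: "working L1 Y U s2"
      using L1 by (auto simp: working_def written frame_def stored_def holds_list_def)
    show "wp (43 * sz + 24 + 1) (If (Less (Reg rU) (Reg rN)) test_candidate Skip)
      (\<lambda>s'. \<exists>L'. (\<lambda>(X, T). working L' X T s') (grow_step E (Y, U))) s2"
    proof (rule wp_If[where t = "43 * sz + 24"])
      have rN: "reg s2 rN = n" using L2 by (auto simp: working_def stored_def)
      show "wp (43 * sz + 24) Skip (\<lambda>s'. \<exists>L'. (\<lambda>(X, T). working L' X T s') (grow_step E (Y, U))) s2"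
        if "\<not> test_val (Less (Reg rU) (Reg rN)) s2"
      proof -
        have "candidates E Y U = {}"
        proof (rule ccontr)
          assume ne: "candidates E Y U \<noteq> {}"
          then have "u < n" using Min_in[OF fin ne] sub by (auto simp: u_def)
          then show False using that rN 2 by simp
        qed
        then show ?thesis using L2 by (intro wp_simple) auto
      qed
      assume "test_val (Less (Reg rU) (Reg rN)) s2"
      then have "u < n" using rN 2 by simp
      then have ne: "candidates E Y U \<noteq> {}" by (auto simp: u_def)
      then have "u \<in> candidates E Y U" using Min_in[OF fin ne] by (simp add: u_def)
      then have "u \<notin> U" by (simp add: candidates_def)
      have step: "grow_step E (Y, U) = (if acyclic_in E (insert u Y) then insert u Y else Y, insert u U)"
        using ne by (simp add: u_def Let_def)
      show "wp (43 * sz + 24) test_candidate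
        (\<lambda>s'. \<exists>L'. (\<lambda>(X, T). working L' X T s') (grow_step E (Y, U))) s2"
        unfolding step prod.case
        by (rule test_candidate_correct[OF L2 2(1) \<open>u < n\<close>]) (use \<open>u \<notin> U\<close> Y in auto)
    qed auto
  qed (use n_pos in \<open>auto simp: silent_programs\<close>)
  then have "wp (78 * sz) ?c
    (\<lambda>s'. (\<exists>L'. (\<lambda>(X, T). working L' X T s') (grow_step E (Y, U))) \<and> preserved ?c s1 s') s1"
    by (rule wp_preserved) (simp add: silent_programs)
  then show "wp (78 * sz) ?c (\<lambda>s''. reg s'' rG = i \<and>
      (\<exists>L'. (\<lambda>(X, T). working L' X T (s''\<lparr>reg := (reg s'')(rG := Suc i)\<rparr>)) ((grow_step E ^^ Suc i) (X, T)))) s1"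
  proof (rule wp_weaken)
    fix s' assume s': "(\<exists>L'. (\<lambda>(X, T). working L' X T s') (grow_step E (Y, U))) \<and> preserved ?c s1 s'"
    have "reg s' rG = i" using s' i(3) by (auto simp: frame_def written)
    moreover have "working L' X T (s'\<lparr>reg := (reg s')(rG := Suc i)\<rparr>) = working L' X T s'" for L' X T
      by (simp add: working_def stored_def holds_list_def)
    ultimately show "reg s' rG = i \<and>
      (\<exists>L'. (\<lambda>(X, T). working L' X T (s'\<lparr>reg := (reg s')(rG := Suc i)\<rparr>)) ((grow_step E ^^ Suc i) (X, T)))"
      using s' YU by (simp del: grow_step.simps add: case_prod_beta)
  qed simp
next
  have "2 + n * (78 * sz + 2) \<le> 2 * (n * sz) + n * (78 * sz + 2 * sz)"
    using n_pos by (intro add_mono mult_le_mono2) (auto simp: Suc_le_eq)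
  then show "2 + n * (78 * sz + 2) \<le> 82 * n * sz" by (simp add: algebra_simps)
qed (use W in \<open>auto simp: silent_programs working_def stored_def holds_list_def frame_def written grown_def case_prod_beta\<close>)

end

section \<open>Neighbours and the queue of found solutions\<close>

definition enqueued :: "'a \<Rightarrow> 'a list \<Rightarrow> 'a list" where
  "enqueued X Qs = (if X \<in> set Qs then Qs else Qs @ [X])"

lemma enqueued_append: "\<exists>Rs. enqueued X Qs = Qs @ Rs \<and> set (enqueued X Qs) = insert X (set Qs)"
  by (auto simp: enqueued_def)

context numbered_digraph
begin

text \<open>\<open>Qs\<close> records all sets ever found: reading advances \<open>rR\<close> but
  removes nothing. So \<open>distinct\<close> also rules out that a set is found again after its
  output.\<close>

definition queue :: "nat set list \<Rightarrow> state \<Rightarrow> bool" where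
  "queue Qs s \<longleftrightarrow> distinct Qs \<and> (\<forall>Q\<in>set Qs. Q \<subseteq> {..<n}) \<and> reg s rW = length Qs * n \<and>
     (\<forall>k<length Qs. \<forall>i<n. cell s aQ (k * n + i) = (if i \<in> Qs ! k then 1 else 0)) \<and>
     (\<forall>x. cell s aL x = 0 \<longleftrightarrow> x \<notin> set_encode ` set Qs)"

lemma set_encode_less_Suc:
  "set_encode (X \<inter> {..<Suc i}) = set_encode (X \<inter> {..<i}) + (if i \<in> X then 2 ^ i else 0)"
proof (cases "i \<in> X")
  case True
  then have "X \<inter> {..<Suc i} = insert i (X \<inter> {..<i})" by auto
  then show ?thesis using True by simp
next
  case False
  then have "X \<inter> {..<Suc i} = X \<inter> {..<i}" by (auto simp: less_Suc_eq)
  then show ?thesis using False by simp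
qed

lemma size_bounds: "n \<le> n * sz" "sz \<le> n * sz" "m \<le> n * sz" "Suc 0 \<le> n * sz"
  "1 + (9 * n + 7) \<le> 17 * (n * sz)" "4 * n + 2 + (4 * m + 4) \<le> 10 * (n * sz)"
  "3 * n + 2 + 99 * (n * sz) \<le> 104 * (n * sz)"
proof -
  define w where "w = n * sz"
  have "1 * sz \<le> w" "n * 1 \<le> w" unfolding w_def using n_pos by (intro mult_le_mono; simp)+
  then show "n \<le> n * sz" "sz \<le> n * sz" "m \<le> n * sz" "Suc 0 \<le> n * sz"
    unfolding w_def[symmetric] using n_pos by simp_all
  then show "1 + (9 * n + 7) \<le> 17 * (n * sz)" "4 * n + 2 + (4 * m + 4) \<le> 10 * (n * sz)"
    "3 * n + 2 + 99 * (n * sz) \<le> 104 * (n * sz)"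
    unfolding w_def[symmetric] by simp_all
qed

lemma enqueue_correct:
  assumes s: "reg s rN = n" "bits n (cell s aX) X" "queue Qs s" and X: "X \<subseteq> {..<n}"
  shows "wp (17 * (n * sz)) enqueue (queue (enqueued X Qs)) s"
  unfolding enqueue_def
proof (rule wp_Seq[where t = 1 and t' = "9 * n + 7" and P = "\<lambda>s'. reg s' rM = 0"])
  let ?L = "For rI (Reg rN) (Seq (If (nonzero (cur aX)) (Assign rM (Add (Reg rM) (Reg rP))) Skip)
    (Assign rP (Add (Reg rP) (Reg rP))))"
  let ?A = "For rI (Reg rN) (Seq (Store aQ (Reg rW) (cur aX)) (Assign rW (Add (Reg rW) (Const 1))))"
  show "wp 1 (Assign rM (Const 0)) (\<lambda>s'. reg s' rM = 0) s" by (intro wp_simple) auto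
  fix s1 assume 1: "reg s1 rM = 0" "preserved (Assign rM (Const 0)) s s1"
  show "wp (9 * n + 7) (Seq (Assign rP (Const 1)) (Seq ?L
    (If (Eq (Cell aL (Reg rM)) (Const 0)) (Seq (Store aL (Reg rM) (Const 1)) ?A) Skip))) (queue (enqueued X Qs)) s1"
  proof (rule wp_Seq[where t = 1 and t' = "9 * n + 6" and P = "\<lambda>s'. reg s' rM = 0 \<and> reg s' rP = 1"])
    show "wp 1 (Assign rP (Const 1)) (\<lambda>s'. reg s' rM = 0 \<and> reg s' rP = 1) s1"
      using 1 by (intro wp_simple) auto
    fix s2 assume 2: "reg s2 rM = 0 \<and> reg s2 rP = 1" "preserved (Assign rP (Const 1)) s1 s2"
    have s2: "reg s2 rN = n" "bits n (cell s2 aX) X" "queue Qs s2"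
      using s 1(2) 2(2) by (auto simp: frame_def queue_def)
    show "wp (9 * n + 6) (Seq ?L (If (Eq (Cell aL (Reg rM)) (Const 0)) (Seq (Store aL (Reg rM) (Const 1)) ?A) Skip))
      (queue (enqueued X Qs)) s2"
    proof (rule wp_Seq[where t = "5 * n + 2" and t' = "4 * n + 3 + 1" and P = "\<lambda>s'. reg s' rM = set_encode X"])
      show "wp (5 * n + 2) ?L (\<lambda>s'. reg s' rM = set_encode X) s2"
      proof (rule wp_For_simple[where N = n and
            I = "\<lambda>i s'. reg s' rM = set_encode (X \<inter> {..<i}) \<and> reg s' rP = 2 ^ i"])
        show "reg s' rM = set_encode X" if "reg s' rM = set_encode (X \<inter> {..<n}) \<and> reg s' rP = 2 ^ n" for s'
          using that X by (simp add: Int_absorb2)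
      qed (use s2 2(1) in \<open>auto simp: frame_def bits_def set_encode_less_Suc\<close>)
      fix s3 assume 3: "reg s3 rM = set_encode X" "preserved ?L s2 s3"
      have s3: "reg s3 rN = n" "bits n (cell s3 aX) X" "queue Qs s3"
        using s2 3(2) by (auto simp: frame_def queue_def)
      \<comment> \<open>All sets involved are subsets of \<open>{..<n}\<close>, and
        \<open>set_encode\<close> is injective on finite sets.\<close>
      have inj: "set_encode X \<in> set_encode ` set Qs \<longleftrightarrow> X \<in> set Qs"
        using X s3(3) set_encode_eq finite_subset[OF _ finite_lessThan[of n]]
        by (metis (no_types, lifting) image_iff queue_def)
      have "\<forall>x. cell s3 aL x = 0 \<longleftrightarrow> x \<notin> set_encode ` set Qs"
        using s3(3) unfolding queue_def by (elim conjE)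
      then have free: "cell s3 aL (set_encode X) = 0 \<longleftrightarrow> X \<notin> set Qs" using inj by simp
      show "wp (4 * n + 3 + 1) (If (Eq (Cell aL (Reg rM)) (Const 0)) (Seq (Store aL (Reg rM) (Const 1)) ?A) Skip)
        (queue (enqueued X Qs)) s3"
      proof (rule wp_If[where t = "4 * n + 3"])
        assume "\<not> test_val (Eq (Cell aL (Reg rM)) (Const 0)) s3"
        then have "X \<in> set Qs" using 3(1) free by simp
        then show "wp (4 * n + 3) Skip (queue (enqueued X Qs)) s3"
          using s3(3) by (intro wp_simple) (auto simp: enqueued_def)
      next
        assume "test_val (Eq (Cell aL (Reg rM)) (Const 0)) s3"
        then have new: "X \<notin> set Qs" using 3(1) free by simp
        let ?P = "\<lambda>s'. cell s' aL = (cell s3 aL)(set_encode X := 1)"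
        show "wp (4 * n + 3) (Seq (Store aL (Reg rM) (Const 1)) ?A) (queue (enqueued X Qs)) s3"
        proof (rule wp_Seq[where t = 1 and t' = "4 * n + 2" and P = ?P])
          show "wp 1 (Store aL (Reg rM) (Const 1)) ?P s3" using 3(1) by (intro wp_simple) auto
          fix s4 assume 4: "?P s4" "preserved (Store aL (Reg rM) (Const 1)) s3 s4"
          have s4: "reg s4 rN = n" "bits n (cell s4 aX) X" "reg s4 rW = length Qs * n"
            "\<And>k i. k < length Qs \<Longrightarrow> i < n \<Longrightarrow> cell s4 aQ (k * n + i) = (if i \<in> Qs ! k then 1 else 0)"
            using s3 4(2) by (auto simp: frame_def queue_def)
          show "wp (4 * n + 2) ?A (queue (enqueued X Qs)) s4"
          proof (rule wp_For_simple[where N = n and I = "\<lambda>i s'. reg s' rW = length Qs * n + i \<and>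
                (\<forall>j<length Qs * n. cell s' aQ j = cell s4 aQ j) \<and>
                (\<forall>j<i. cell s' aQ (length Qs * n + j) = (if j \<in> X then 1 else 0))"])
            fix s5 assume 5: "reg s5 rW = length Qs * n + n \<and>
                (\<forall>j<length Qs * n. cell s5 aQ j = cell s4 aQ j) \<and>
                (\<forall>j<n. cell s5 aQ (length Qs * n + j) = (if j \<in> X then 1 else 0))" "preserved ?A s4 s5"
            have enq: "enqueued X Qs = Qs @ [X]" using new by (simp add: enqueued_def)
            have vis: "cell s5 aL = (cell s3 aL)(set_encode X := 1)" using 5(2) 4(1) by (simp add: frame_def)
            have "cell s5 aQ (k * n + i) = (if i \<in> (Qs @ [X]) ! k then 1 else 0)"
              if k: "k < Suc (length Qs)" "i < n" for k i
            proof (cases "k < length Qs")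
              case True
              \<comment> \<open>An old block ends before the newly written one starts.\<close>
              then have "Suc k * n \<le> length Qs * n" by (intro mult_le_mono1) simp
              then have "k * n + i < length Qs * n" using k(2) by simp
              then show ?thesis using 5(1) s4(4) True k(2) by (simp add: nth_append)
            next
              case False
              then have "k = length Qs" using k by simp
              then show ?thesis using 5(1) k(2) by simp
            qed
            then show "queue (enqueued X Qs) s5"
              using s3(3) 5(1) X new unfolding queue_def enq vis by auto
          qed (use s4 in \<open>auto simp: frame_def bits_def less_Suc_eq\<close>)
        qed auto
      qed auto
    qed auto
  qed auto
qed (simp, rule size_bounds)

lemma exclude_correct:
  assumes L: "stored L s" and S: "bits n (cell s aS) S" and v: "reg s rV = v" "v < n"
    and ab: "(a, b, N) = (aT, aH, {y. (v, y) \<in> E}) \<or> (a, b, N) = (aH, aT, {y. (y, v) \<in> E})"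
  shows "wp (10 * (n * sz)) (exclude a b)
    (\<lambda>s'. bits n (cell s' aX) {v} \<and> bits n (cell s' aD) (insert v ({..<n} - S \<union> N))) s"
proof -
  let ?c1 = "For rI (Reg rN) (Seq (Store aD (Reg rI) (Sub (Const 1) (cur aS))) (Store aX (Reg rI) (Const 0)))"
  let ?c2 = "For rI (Reg rA) (If (Eq (cur a) (Reg rV)) (Store aD (cur b) (Const 1)) Skip)"
  let ?N = "\<lambda>F. if a = aT then {y. (v, y) \<in> F} else {y. (y, v) \<in> F}"
  have N: "N = ?N E" using ab by auto
  let ?P = "\<lambda>s. stored L s \<and> reg s rV = v"
  show ?thesis unfolding exclude_def
  proof (rule wp_Seq[where t = "4 * n + 2" and t' = "4 * m + 4" and
        P = "\<lambda>s'. bits n (cell s' aX) {} \<and> bits n (cell s' aD) ({..<n} - S)"])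
    show "wp (4 * n + 2) ?c1 (\<lambda>s'. bits n (cell s' aX) {} \<and> bits n (cell s' aD) ({..<n} - S)) s"
      by (rule wp_For_simple[where N = n and
            I = "\<lambda>i s'. bits i (cell s' aX) {} \<and> bits i (cell s' aD) ({..<n} - S)"])
        (use L S in \<open>auto simp: bits_def frame_def stored_def less_Suc_eq\<close>)
    fix s1 assume 1: "bits n (cell s1 aX) {} \<and> bits n (cell s1 aD) ({..<n} - S)" "preserved ?c1 s s1"
    have P1: "?P s1" using L v 1(2) by (auto simp: frame_def stored_def holds_list_def)
    let ?Q = "\<lambda>s. ?P s \<and> bits n (cell s aX) {v} \<and> bits n (cell s aD) ({..<n} - S)"
    show "wp (4 * m + 4) (Seq (Store aX (Reg rV) (Const 1)) (Seq (Store aD (Reg rV) (Const 1)) ?c2))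
      (\<lambda>s'. bits n (cell s' aX) {v} \<and> bits n (cell s' aD) (insert v ({..<n} - S \<union> N))) s1"
    proof (rule wp_Seq[where t = 1 and t' = "4 * m + 3" and P = ?Q])
      show "wp 1 (Store aX (Reg rV) (Const 1)) ?Q s1"
        using 1(1) P1 by (intro wp_simple) (auto simp: bits_def stored_def holds_list_def)
      fix s2 assume 2: "?Q s2"
      let ?R = "\<lambda>s. ?P s \<and> bits n (cell s aX) {v} \<and> bits n (cell s aD) (insert v ({..<n} - S))"
      show "wp (4 * m + 3) (Seq (Store aD (Reg rV) (Const 1)) ?c2)
        (\<lambda>s'. bits n (cell s' aX) {v} \<and> bits n (cell s' aD) (insert v ({..<n} - S \<union> N))) s2"
      proof (rule wp_Seq[where t = 1 and t' = "4 * m + 2" and P = ?R])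
        show "wp 1 (Store aD (Reg rV) (Const 1)) ?R s2"
          using 2 by (intro wp_simple) (auto simp: bits_def stored_def holds_list_def)
        fix s3 assume 3: "?R s3"
        show "wp (4 * m + 2) ?c2
          (\<lambda>s'. bits n (cell s' aX) {v} \<and> bits n (cell s' aD) (insert v ({..<n} - S \<union> N))) s3"
        proof (rule wp_For_simple[where N = m and
              I = "\<lambda>i s'. bits n (cell s' aD) (insert v ({..<n} - S \<union> ?N (set (take i L))))"])
          fix i s4 assume i: "i < m" "bits n (cell s4 aD) (insert v ({..<n} - S \<union> ?N (set (take i L))))"
            "reg s4 rI = i" and p: "preserved ?c2 s3 s4"
          have s4: "stored L s4" "reg s4 rV = v"
            using 3 p by (auto simp: frame_def stored_def holds_list_def)
          obtain x y where xy: "L ! i = (x, y)" "cell s4 aT i = x" "cell s4 aH i = y" "x < n" "y < n"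
            using stored_nth[OF s4(1) i(1)] by metis
          have tk: "set (take (Suc i) L) = insert (x, y) (set (take i L))"
            using xy i(1) s4(1) by (simp add: take_Suc_conv_app_nth stored_def)
          show "bits n (cell (run (If (Eq (cur a) (Reg rV)) (Store aD (cur b) (Const 1)) Skip) s4
            \<lparr>reg := (reg (run (If (Eq (cur a) (Reg rV)) (Store aD (cur b) (Const 1)) Skip) s4))(rI := Suc i)\<rparr>) aD)
            (insert v ({..<n} - S \<union> ?N (set (take (Suc i) L))))"
            using ab
          proof
            assume "(a, b, N) = (aT, aH, {y. (v, y) \<in> E})"
            then show ?thesis using i(2,3) s4(2) xy unfolding bits_def tk by auto
          next
            assume "(a, b, N) = (aH, aT, {y. (y, v) \<in> E})"
            then show ?thesis using i(2,3) s4(2) xy unfolding bits_def tk by auto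
          qed
        qed (use 3 N in \<open>auto simp: frame_def stored_def bits_def\<close>)
      qed auto
    qed auto
  qed (simp, rule size_bounds)
qed

text \<open>An arc inside \<open>{v}\<close> would be a loop. Hence a growth from a single vertex
  may start with the arcs in whatever order the previous growth left them.\<close>

lemma topological_singleton: "set L = E \<Longrightarrow> topological {v} L"
  using arcs_irrefl unfolding topological_def irrefl_def sorted_wrt_iff_nth_less
  by (metis SigmaE fst_conv nth_mem order.strict_trans singletonD snd_conv)

lemma complete_correct:
  assumes L: "stored L s" "topological X L" "bits n (cell s aX) X" and X: "dag_set E X" "X \<subseteq> {..<n}"
    and Qs: "queue Qs s"
  shows "wp (104 * (n * sz)) complete
    (\<lambda>s'. \<exists>L'. stored L' s' \<and> queue (enqueued (completion E {..<n} X) Qs) s') s"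
proof -
  let ?c = "For rI (Reg rN) (Store aD (Reg rI) (cur aX))"
  show ?thesis unfolding complete_def
  proof (rule wp_Seq[where t = "3 * n + 2" and t' = "99 * (n * sz)" and P = "\<lambda>s'. bits n (cell s' aD) X"])
    show "wp (3 * n + 2) ?c (\<lambda>s'. bits n (cell s' aD) X) s"
      by (rule wp_For_simple[where N = n and I = "\<lambda>i s'. bits i (cell s' aD) X"])
        (use L in \<open>auto simp: bits_def frame_def stored_def less_Suc_eq\<close>)
    fix s1 assume 1: "bits n (cell s1 aD) X" "preserved ?c s s1"
    have W1: "working L X X s1" and Q1: "queue Qs s1"
      using 1 L Qs by (auto simp: working_def frame_def stored_def holds_list_def queue_def)
    show "wp (99 * (n * sz)) (Seq grow enqueue)
      (\<lambda>s'. \<exists>L'. stored L' s' \<and> queue (enqueued (completion E {..<n} X) Qs) s') s1"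
    proof (rule wp_Seq[where t = "82 * n * sz" and t' = "17 * (n * sz)"])
      show "wp (82 * n * sz) grow (\<lambda>s'. \<exists>L' T'. working L' (grown E n X X) T' s') s1"
        by (rule grow_correct[OF W1 X(1) order.refl X(2)])
      fix s2 assume 2: "\<exists>L' T'. working L' (grown E n X X) T' s2" "preserved grow s1 s2"
      then obtain L' T' where W2: "working L' (completion E {..<n} X) T' s2" by (auto simp: completion_def)
      have Q2: "queue Qs s2" using Q1 2(2) by (auto simp: frame_def written queue_def)
      have sub: "completion E {..<n} X \<subseteq> {..<n}"
        using completion_maximal(2)[OF arcs_subset _ X(2,1)] by (simp add: maximal_dag_sets_def)
      have "wp (17 * (n * sz)) enqueue (queue (enqueued (completion E {..<n} X) Qs)) s2"
        using W2 by (intro enqueue_correct Q2 sub) (auto simp: working_def stored_def)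
      then have "wp (17 * (n * sz)) enqueue
        (\<lambda>s'. queue (enqueued (completion E {..<n} X) Qs) s' \<and> preserved enqueue s2 s') s2"
        by (rule wp_preserved) (simp add: silent_programs)
      then show "wp (17 * (n * sz)) enqueue
        (\<lambda>s'. \<exists>L'. stored L' s' \<and> queue (enqueued (completion E {..<n} X) Qs) s') s2"
      proof (rule wp_weaken)
        fix s3 assume 3: "queue (enqueued (completion E {..<n} X) Qs) s3 \<and> preserved enqueue s2 s3"
        then have "stored L' s3" using W2 by (auto simp: working_def frame_def written stored_def holds_list_def)
        then show "\<exists>L'. stored L' s3 \<and> queue (enqueued (completion E {..<n} X) Qs) s3" using 3 by auto
      qed simp
    qed (auto simp: silent_programs)
  qed (simp, rule size_bounds)
qed

text \<open>The first growth leaves the arcs in an order that is topological on the grown set, which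
  is what \<open>complete\<close> requires. The constant is \<open>10 + 82 + 104\<close>.\<close>

lemma make_neighbour_correct:
  assumes L: "stored L s" and S: "bits n (cell s aS) S" and v: "reg s rV = v" "v < n" and Qs: "queue Qs s"
    and ab: "(a, b, N) = (aT, aH, {y. (v, y) \<in> E}) \<or> (a, b, N) = (aH, aT, {y. (y, v) \<in> E})"
  shows "wp (196 * (n * sz)) (make_neighbour a b)
    (\<lambda>s'. \<exists>L'. stored L' s' \<and> queue (enqueued (neighbour E {..<n} S v N) Qs) s') s"
  unfolding make_neighbour_def
proof (rule wp_Seq[where t = "10 * (n * sz)" and t' = "186 * (n * sz)"])
  let ?T = "insert v ({..<n} - S \<union> N)"
  let ?X = "grown E n {v} ?T"
  have T: "{v} \<subseteq> ?T" "?T \<subseteq> {..<n}" using ab arcs_subset v by auto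
  note dag = dag_set_singleton[OF arcs_irrefl, of v]
  note g = grown_properties[OF arcs_subset _ T dag, simplified]
  show "wp (10 * (n * sz)) (exclude a b)
    (\<lambda>s'. bits n (cell s' aX) {v} \<and> bits n (cell s' aD) ?T) s"
    by (rule exclude_correct[OF L S v ab])
  fix s1 assume 1: "bits n (cell s1 aX) {v} \<and> bits n (cell s1 aD) ?T" "preserved (exclude a b) s s1"
  have L1: "stored L s1" "queue Qs s1"
    using L Qs 1(2) by (auto simp: written frame_def stored_def holds_list_def queue_def)
  then have W1: "working L {v} ?T s1"
    using 1(1) topological_singleton by (auto simp: working_def stored_def)
  show "wp (186 * (n * sz)) (Seq grow complete)
    (\<lambda>s'. \<exists>L'. stored L' s' \<and> queue (enqueued (neighbour E {..<n} S v N) Qs) s') s1"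
  proof (rule wp_Seq[where t = "82 * n * sz" and t' = "104 * (n * sz)"])
    show "wp (82 * n * sz) grow (\<lambda>s'. \<exists>L' T'. working L' ?X T' s') s1"
      by (rule grow_correct[OF W1 dag T])
    fix s2 assume 2: "\<exists>L' T'. working L' ?X T' s2" "preserved grow s1 s2"
    then obtain L' T' where W2: "working L' ?X T' s2" by auto
    have "queue Qs s2" using L1 2(2) by (auto simp: frame_def written queue_def)
    then show "wp (104 * (n * sz)) complete
      (\<lambda>s'. \<exists>L'. stored L' s' \<and> queue (enqueued (neighbour E {..<n} S v N) Qs) s') s2"
      using complete_correct[of L' s2 ?X Qs] W2 g
      by (simp add: working_def neighbour_def)
  qed (auto simp: silent_programs)
qed (auto simp: silent_programs)

text \<open>New sets are appended, so the old queue remains a prefix and the reading position stays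
  valid. Two neighbours per vertex cost \<open>2 * 196 = 392\<close>; the remaining \<open>5\<close>
  covers the conditional and the loop.\<close>

lemma make_neighbours_correct:
  assumes L: "stored L s" and S: "bits n (cell s aS) S" and Qs: "queue Qs s"
  shows "wp (397 * (n * (n * sz))) make_neighbours
    (\<lambda>s'. \<exists>L' Rs. stored L' s' \<and> queue (Qs @ Rs) s' \<and> set (Qs @ Rs) = set Qs \<union> neighbour_sets E {..<n} S) s"
  unfolding make_neighbours_def
proof (rule wp_For[where N = n and k = "392 * (n * sz) + 1" and
      I = "\<lambda>i s'. \<exists>L' Rs. stored L' s' \<and> queue (Qs @ Rs) s' \<and> set (Qs @ Rs) = set Qs \<union>
        (\<Union>v\<in>{..<i} - S. neighbour E {..<n} S v ` neighbourhoods E v)"])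
  let ?c = "If (Eq (Cell aS (Reg rV)) (Const 0)) (Seq (make_neighbour aT aH) (make_neighbour aH aT)) Skip"
  let ?I = "\<lambda>i s'. \<exists>L' Rs. stored L' s' \<and> queue (Qs @ Rs) s' \<and> set (Qs @ Rs) = set Qs \<union>
        (\<Union>v\<in>{..<i} - S. neighbour E {..<n} S v ` neighbourhoods E v)"
  fix v s1 assume v: "v < n" "?I v s1" "reg s1 rV = v" and p: "preserved (For rV (Reg rN) ?c) s s1"
  obtain L1 Rs where L1: "stored L1 s1" "queue (Qs @ Rs) s1" "set (Qs @ Rs) = set Qs \<union>
        (\<Union>v\<in>{..<v} - S. neighbour E {..<n} S v ` neighbourhoods E v)"
    using v(2) by blast
  have S1: "bits n (cell s1 aS) S" using S p by (auto simp: frame_def written)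
  have "wp (392 * (n * sz) + 1) ?c (?I (Suc v)) s1"
  proof (rule wp_If[where t = "392 * (n * sz)"])
    assume "\<not> test_val (Eq (Cell aS (Reg rV)) (Const 0)) s1"
    then have "v \<in> S" using S1 v by (auto simp: bits_def split: if_splits)
    then have "{..<Suc v} - S = {..<v} - S" by (auto simp: less_Suc_eq)
    then show "wp (392 * (n * sz)) Skip (?I (Suc v)) s1"
      using v(2) size_bounds by (intro wp_simple) auto
  next
    assume "test_val (Eq (Cell aS (Reg rV)) (Const 0)) s1"
    then have "v \<notin> S" using S1 v by (auto simp: bits_def split: if_splits)
    then have vS: "{..<Suc v} - S = insert v ({..<v} - S)" by auto
    let ?A = "neighbour E {..<n} S v {y. (v, y) \<in> E}" and ?B = "neighbour E {..<n} S v {y. (y, v) \<in> E}"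
    show "wp (392 * (n * sz)) (Seq (make_neighbour aT aH) (make_neighbour aH aT)) (?I (Suc v)) s1"
    proof (rule wp_Seq[where t = "196 * (n * sz)" and t' = "196 * (n * sz)"])
      show "wp (196 * (n * sz)) (make_neighbour aT aH)
        (\<lambda>s'. \<exists>L'. stored L' s' \<and> queue (enqueued ?A (Qs @ Rs)) s') s1"
        by (rule make_neighbour_correct[OF L1(1) S1 v(3,1) L1(2)]) simp
      fix s2 assume 2: "\<exists>L'. stored L' s2 \<and> queue (enqueued ?A (Qs @ Rs)) s2"
        "preserved (make_neighbour aT aH) s1 s2"
      then obtain L2 where L2: "stored L2 s2" "queue (enqueued ?A (Qs @ Rs)) s2" by auto
      have s2: "bits n (cell s2 aS) S" "reg s2 rV = v" using S1 v 2(2) by (auto simp: frame_def written)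
      have "wp (196 * (n * sz)) (make_neighbour aH aT)
        (\<lambda>s'. \<exists>L'. stored L' s' \<and> queue (enqueued ?B (enqueued ?A (Qs @ Rs))) s') s2"
        by (rule make_neighbour_correct[OF L2(1) s2 v(1) L2(2)]) simp
      then show "wp (196 * (n * sz)) (make_neighbour aH aT) (?I (Suc v)) s2"
      proof (rule wp_weaken)
        fix s3 assume "\<exists>L'. stored L' s3 \<and> queue (enqueued ?B (enqueued ?A (Qs @ Rs))) s3"
        moreover obtain Rs' where "enqueued ?B (enqueued ?A (Qs @ Rs)) = Qs @ Rs'"
          "set (Qs @ Rs') = insert ?B (insert ?A (set (Qs @ Rs)))"
          using enqueued_append[of ?A "Qs @ Rs"] enqueued_append[of ?B "enqueued ?A (Qs @ Rs)"]
          by (metis append_assoc)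
        ultimately show "?I (Suc v) s3"
          unfolding vS L1(3) by (auto simp: neighbourhoods_def)
      qed simp
    qed (auto simp: silent_programs)
  qed simp
  then have "wp (392 * (n * sz) + 1) ?c (\<lambda>s'. ?I (Suc v) s' \<and> preserved ?c s1 s') s1"
    by (rule wp_preserved) (simp add: silent_programs)
  then show "wp (392 * (n * sz) + 1) ?c
    (\<lambda>s'. reg s' rV = v \<and> ?I (Suc v) (s'\<lparr>reg := (reg s')(rV := Suc v)\<rparr>)) s1"
  proof (rule wp_weaken)
    fix s' assume s': "?I (Suc v) s' \<and> preserved ?c s1 s'"
    moreover have "stored L' (s'\<lparr>reg := (reg s')(rV := Suc v)\<rparr>) = stored L' s'"
      "queue Rs (s'\<lparr>reg := (reg s')(rV := Suc v)\<rparr>) = queue Rs s'" for L' Rs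
      by (simp_all add: stored_def holds_list_def queue_def)
    moreover have "reg s' rV = v" using s' v(3) by (auto simp: frame_def written)
    ultimately show "reg s' rV = v \<and> ?I (Suc v) (s'\<lparr>reg := (reg s')(rV := Suc v)\<rparr>)" by simp
  qed simp
next
  let ?s = "s\<lparr>reg := (reg s)(rV := 0)\<rparr>"
  have "stored L ?s" "queue Qs ?s" using L Qs by (simp_all add: stored_def holds_list_def queue_def)
  then show "\<exists>L' Rs. stored L' ?s \<and> queue (Qs @ Rs) ?s \<and> set (Qs @ Rs) = set Qs \<union>
        (\<Union>v\<in>{..<0} - S. neighbour E {..<n} S v ` neighbourhoods E v)"
    by (intro exI[of _ L] exI[of _ "[]"]) simp
  define w where "w = n * sz"
  have "1 * 1 \<le> n * w" "n * 1 \<le> n * w"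
    unfolding w_def using n_pos size_bounds(4) by (intro mult_le_mono; simp)+
  then have "n * (392 * w) + n * 3 + 2 \<le> 397 * (n * w)" by linarith
  then have "2 + n * (392 * w + 1 + 2) \<le> 397 * (n * w)" by (simp add: distrib_left)
  then show "2 + n * (392 * (n * sz) + 1 + 2) \<le> 397 * (n * (n * sz))" unfolding w_def .
qed (use L in \<open>auto simp: silent_programs stored_def frame_def written neighbour_sets_def\<close>)

end

section \<open>Programs for the three tasks\<close>

definition dequeue :: com where
  "dequeue = For rI (Reg rN) (Seq (Store aS (Reg rI) (Cell aQ (Reg rR))) (Assign rR (Add (Reg rR) (Const 1))))"

definition emit :: com where
  "emit = For rI (Reg rN) (If (nonzero (cur aS)) (Put (Reg rI)) Skip)"

text \<open>With \<open>make_neighbours\<close> as \<open>c\<close> this is the search; with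
  \<open>Skip\<close> it prints a queue that has been filled before.\<close>

definition process :: "com \<Rightarrow> com" where
  "process c = While (Less (Reg rR) (Reg rW)) (Seq dequeue (Seq emit (Seq Flush c)))"

definition seed :: com where
  "seed = Seq (Store aX (Const 0) (Const 1)) complete"

text \<open>Register and array \<open>3\<close> hold the argument solution as a list of vertex
  numbers, here turned into a characteristic vector.\<close>

definition load :: com where
  "load = For rI (Reg 3) (Store aS (Cell 3 (Reg rI)) (Const 1))"

definition prepare :: com where
  "prepare = Assign rN (Cell 0 (Const 0))"

definition solution_program :: com where
  "solution_program = Seq prepare (Seq seed (process Skip))"

definition neighbours_program :: com where
  "neighbours_program = Seq prepare (Seq load (Seq make_neighbours (process Skip)))"

definition listing_program :: com where
  "listing_program = Seq prepare (Seq seed (process make_neighbours))"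

section \<open>Outputs and delay of the queue loop\<close>

lemma gaps_silent: "outputs tr = [] \<Longrightarrow> gaps p (tr @ tr') = gaps (p + length tr) tr'"
  by (induction p tr rule: gaps.induct) auto

definition members :: "nat \<Rightarrow> nat set \<Rightarrow> nat list" where
  "members n S = filter (\<lambda>i. i \<in> S) [0..<n]"

context numbered_digraph
begin

lemma dequeue_correct:
  assumes "stored L s" "queue Qs s" "reg s rR = k * n" "k < length Qs"
  shows "wp (4 * n + 2) dequeue (\<lambda>s'. bits n (cell s' aS) (Qs ! k) \<and> reg s' rR = Suc k * n) s"
  unfolding dequeue_def
  by (rule wp_For_simple[where N = n and I = "\<lambda>i s'. bits i (cell s' aS) (Qs ! k) \<and> reg s' rR = k * n + i"])
    (use assms in \<open>auto simp: stored_def frame_def bits_def queue_def less_Suc_eq\<close>)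

lemma emit_correct:
  assumes "reg s rN = n" "bits n (cell s aS) S" "buffer s = []"
  shows "wp (4 * n + 2) emit (\<lambda>s'. buffer s' = members n S) s"
  unfolding emit_def
  by (rule wp_For_simple[where N = n and I = "\<lambda>i s'. buffer s' = members i S"])
    (use assms in \<open>auto simp: frame_def bits_def members_def\<close>)

text \<open>The finite set \<open>U\<close> bounds the queue, so \<open>card U - k\<close> decreases
  with every set read. For \<open>k = 0\<close> the clause on \<open>nb\<close> says that the final
  list is closed under \<open>nb\<close>. A count \<open>p\<close> may be pending at the start,
  because work done after one output belongs to the gap before the next.\<close>

lemma process_correct:
  fixes c :: com and U :: "nat set set" and nb :: "nat set \<Rightarrow> nat set set"
  assumes c: "quiet c" "rR \<notin> written_regs c"
    and step: "\<And>L Qs S s. stored L s \<Longrightarrow> queue Qs s \<Longrightarrow> bits n (cell s aS) S \<Longrightarrow>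
      wp K c (\<lambda>s'. \<exists>L' Rs. stored L' s' \<and> queue (Qs @ Rs) s' \<and> set (Qs @ Rs) = set Qs \<union> nb S) s"
    and U: "\<And>S. S \<in> U \<Longrightarrow> nb S \<subseteq> U" "finite U"
    and s: "stored L s" "queue Qs s" "set Qs \<subseteq> U" "reg s rR = k * n" "k \<le> length Qs" "buffer s = []"
  shows "\<exists>tr s' Rs. exec (process c) s tr s' \<and> distinct (Qs @ Rs) \<and> set (Qs @ Rs) \<subseteq> U \<and>
    (\<forall>S\<in>set (drop k (Qs @ Rs)). nb S \<subseteq> set (Qs @ Rs)) \<and>
    outputs tr = map (members n) (drop k (Qs @ Rs)) \<and>
    length tr \<le> Suc (length (drop k (Qs @ Rs)) * (8 * n + 6 + K)) \<and>
    (\<forall>p\<le>K. \<forall>g\<in>set (gaps p tr). g \<le> K + (8 * n + 6))"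
  using s
proof (induction "card U - k" arbitrary: k L Qs s rule: less_induct)
  case less
  note s = less.prems
  have dist: "distinct Qs" using s(2) by (simp add: queue_def)
  have rW: "reg s rW = length Qs * n" using s(2) by (simp add: queue_def)
  let ?body = "Seq dequeue (Seq emit (Seq Flush c))"
  show ?case
  proof (cases "k = length Qs")
    case True
    then have "exec (process c) s [Tick] s"
      unfolding process_def using rW s(4) by (intro exec.WhileFalse) auto
    then show ?thesis using True dist s(3)
      by (intro exI[of _ "[Tick]"] exI[of _ s] exI[of _ "[]"]) auto
  next
    case False
    then have k: "k < length Qs" using s(5) by simp
    define S where "S = Qs ! k"
    have SU: "S \<in> U" using k s(3) by (auto simp: S_def)
    have kU: "k < card U" using k card_mono[OF U(2) s(3)] distinct_card[OF dist] by simp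
    obtain tr1 s1 where 1: "exec dequeue s tr1 s1" "length tr1 \<le> 4 * n + 2" "outputs tr1 = []"
      "bits n (cell s1 aS) S" "reg s1 rR = Suc k * n" "preserved dequeue s s1" "buffer s1 = buffer s"
      using wp_quiet[OF wp_preserved[OF dequeue_correct[OF s(1,2,4) k]]]
      by (auto simp: wp_def dequeue_def S_def)
    have s1: "stored L s1" "queue Qs s1" "buffer s1 = []"
      using 1(6,7) s by (auto simp: frame_def dequeue_def stored_def holds_list_def queue_def)
    obtain tr2 s2 where 2: "exec emit s1 tr2 s2" "length tr2 \<le> 4 * n + 2" "outputs tr2 = []"
      "buffer s2 = members n S" "preserved emit s1 s2"
      using wp_preserved[OF emit_correct[OF _ 1(4) s1(3)]] s1(1) by (auto simp: wp_def emit_def stored_def)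
    let ?s2 = "s2\<lparr>buffer := []\<rparr>"
    have s2: "stored L ?s2" "queue Qs ?s2" "bits n (cell ?s2 aS) S" "reg ?s2 rR = Suc k * n"
      using 1 2(5) s1 by (auto simp: frame_def emit_def stored_def holds_list_def queue_def)
    obtain tr3 s3 L3 Rs where 3: "exec c ?s2 tr3 s3" "length tr3 \<le> K" "outputs tr3 = []"
      "stored L3 s3" "queue (Qs @ Rs) s3" "set (Qs @ Rs) = set Qs \<union> nb S" "preserved c ?s2 s3" "buffer s3 = []"
      using wp_quiet[OF wp_preserved[OF step[OF s2(1-3)]]] c quiet_silent by (auto simp: wp_def)
    have rR: "reg s3 rR = Suc k * n" using 3(7) c(2) s2(4) by (simp add: frame_def)
    have sub: "set (Qs @ Rs) \<subseteq> U" using 3(6) s(3) U(1)[OF SU] by auto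
    have "card U - Suc k < card U - k" using kU by simp
    then obtain tr4 s4 Rs' where 4: "exec (process c) s3 tr4 s4" "distinct ((Qs @ Rs) @ Rs')"
      "set ((Qs @ Rs) @ Rs') \<subseteq> U" "\<forall>S\<in>set (drop (Suc k) ((Qs @ Rs) @ Rs')). nb S \<subseteq> set ((Qs @ Rs) @ Rs')"
      "outputs tr4 = map (members n) (drop (Suc k) ((Qs @ Rs) @ Rs'))"
      "length tr4 \<le> Suc (length (drop (Suc k) ((Qs @ Rs) @ Rs')) * (8 * n + 6 + K))"
      "\<forall>p\<le>K. \<forall>g\<in>set (gaps p tr4). g \<le> K + (8 * n + 6)"
      using less.hyps[OF _ 3(4,5) sub rR _ 3(8)] k by auto
    define tr where "tr = Tick # (tr1 @ tr2 @ [Out (members n S)] @ tr3) @ tr4"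
    have "exec Flush s2 [Out (members n S)] ?s2" using exec.Flush[of s2] 2(4) by simp
    then have "exec ?body s (tr1 @ tr2 @ [Out (members n S)] @ tr3) s3"
      using 1(1) 2(1) 3(1) by (intro exec.Seq)
    moreover have "test_val (Less (Reg rR) (Reg rW)) s" using rW s(4) k n_pos by simp
    ultimately have ex: "exec (process c) s tr s4"
      unfolding tr_def process_def using 4(1)[unfolded process_def] by (intro exec.WhileTrue)
    have drop: "drop k (Qs @ Rs @ Rs') = S # drop (Suc k) (Qs @ Rs @ Rs')"
      using k by (simp add: Cons_nth_drop_Suc[symmetric] S_def nth_append)
    have "outputs tr = map (members n) (drop k (Qs @ Rs @ Rs'))"
      unfolding drop tr_def using 1 2 3 4(5) by (simp add: outputs_append)
    moreover have "\<forall>T\<in>set (drop k (Qs @ Rs @ Rs')). nb T \<subseteq> set (Qs @ Rs @ Rs')"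
      unfolding drop using 4(4) 3(6) by auto
    moreover have "length tr \<le> Suc (length (drop k (Qs @ Rs @ Rs')) * (8 * n + 6 + K))"
      unfolding drop tr_def using 1(2) 2(2) 3(2) 4(6) by simp
    moreover have "\<forall>p\<le>K. \<forall>g\<in>set (gaps p tr). g \<le> K + (8 * n + 6)"
    proof (intro allI impI ballI)
      fix p g assume p: "p \<le> K" "g \<in> set (gaps p tr)"
      \<comment> \<open>The gap consists of the pending steps, the loop test,
        \<open>dequeue\<close>, \<open>emit\<close> and \<open>Flush\<close>. The steps
        \<open>tr3\<close> of \<open>c\<close> become the pending count for the rest of the loop,
        and \<open>K\<close> bounds them.\<close>
      have "gaps p tr = Suc (Suc p + length tr1 + length tr2) # gaps (length tr3) tr4"
        unfolding tr_def using 1(3) 2(3) 3(3) by (simp add: gaps_silent)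
      then show "g \<le> K + (8 * n + 6)" using p 1(2) 2(2) 3(2) 4(7) by auto
    qed
    ultimately show ?thesis using ex 4(2,3)
      by (intro exI[of _ tr] exI[of _ s4] exI[of _ "Rs @ Rs'"]) auto
  qed
qed

definition fresh :: "(nat \<times> nat) list \<Rightarrow> state \<Rightarrow> bool" where
  "fresh L s \<longleftrightarrow> stored L s \<and> (\<forall>i. cell s aX i = 0) \<and> (\<forall>i. cell s aL i = 0) \<and> reg s rR = 0 \<and>
     reg s rW = 0 \<and> buffer s = []"

lemma fresh_queue: "fresh L s \<Longrightarrow> queue [] s"
  by (simp add: fresh_def queue_def)

definition first_solution :: "nat set" where
  "first_solution = completion E {..<n} {0}"

lemma first_solution_maximal: "first_solution \<in> maximal_dag_sets E {..<n}"
  unfolding first_solution_def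
  using completion_maximal(2)[OF arcs_subset _ _ dag_set_singleton[OF arcs_irrefl]] n_pos by simp

lemma seed_correct:
  assumes s: "fresh L s"
  shows "wp (1 + 104 * (n * sz)) seed
    (\<lambda>s'. (\<exists>L'. stored L' s' \<and> queue [first_solution] s') \<and> reg s' rR = 0 \<and> buffer s' = []) s"
proof -
  have "wp (1 + 104 * (n * sz)) seed (\<lambda>s'. \<exists>L'. stored L' s' \<and> queue [first_solution] s') s"
    unfolding seed_def
  proof (rule wp_Seq[where t = 1 and t' = "104 * (n * sz)" and P = "\<lambda>s'. bits n (cell s' aX) {0}"])
    show "wp 1 (Store aX (Const 0) (Const 1)) (\<lambda>s'. bits n (cell s' aX) {0}) s"
      using s by (intro wp_simple) (auto simp: fresh_def bits_def)
    fix s1 assume 1: "bits n (cell s1 aX) {0}" "preserved (Store aX (Const 0) (Const 1)) s s1"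
    have s1: "stored L s1" "queue [] s1"
      using s fresh_queue[OF s] 1(2) by (auto simp: fresh_def frame_def stored_def holds_list_def queue_def)
    have top: "topological {0} L" using s1(1) topological_singleton by (simp add: stored_def)
    show "wp (104 * (n * sz)) complete (\<lambda>s'. \<exists>L'. stored L' s' \<and> queue [first_solution] s') s1"
      using complete_correct[OF s1(1) top 1(1) dag_set_singleton[OF arcs_irrefl] _ s1(2)] n_pos
      by (simp add: first_solution_def enqueued_def)
  qed auto
  then have "wp (1 + 104 * (n * sz)) seed (\<lambda>s'. ((\<exists>L'. stored L' s' \<and> queue [first_solution] s') \<and>
      preserved seed s s') \<and> buffer s' = buffer s) s"
    by (intro wp_quiet wp_preserved) (auto simp: seed_def silent_programs quiet_programs)
  then show ?thesis
    by (rule wp_weaken) (use s in \<open>auto simp: frame_def seed_def written fresh_def\<close>)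
qed

text \<open>Joins a prefix without output, known through \<open>wp\<close>, to a rest that is
  described by its trace.\<close>

lemma wp_exec_Seq:
  assumes "wp t c P s" "\<And>s'. P s' \<Longrightarrow> \<exists>tr s''. exec d s' tr s'' \<and> Q tr s''"
  shows "\<exists>tr' tr s''. exec (Seq c d) s (tr' @ tr) s'' \<and> outputs tr' = [] \<and> length tr' \<le> t \<and> Q tr s''"
  using assms exec.Seq unfolding wp_def by metis

text \<open>Instance of \<open>process_correct\<close> with \<open>nb\<close> constantly empty.
  Taking \<open>set Qs\<close> for \<open>U\<close> forces the appended part \<open>Rs\<close> to be
  empty, since \<open>Qs @ Rs\<close> is distinct.\<close>

lemma process_Skip:
  assumes s: "stored L s" "queue Qs s" "reg s rR = 0" "buffer s = []"
  shows "\<exists>tr s'. exec (process Skip) s tr s' \<and> outputs tr = map (members n) Qs \<and>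
    length tr \<le> Suc (length Qs * (8 * n + 7))"
proof -
  have "\<exists>tr s' Rs. exec (process Skip) s tr s' \<and> distinct (Qs @ Rs) \<and> set (Qs @ Rs) \<subseteq> set Qs \<and>
    (\<forall>S\<in>set (drop 0 (Qs @ Rs)). {} \<subseteq> set (Qs @ Rs)) \<and>
    outputs tr = map (members n) (drop 0 (Qs @ Rs)) \<and>
    length tr \<le> Suc (length (drop 0 (Qs @ Rs)) * (8 * n + 6 + 1)) \<and>
    (\<forall>p\<le>1. \<forall>g\<in>set (gaps p tr). g \<le> 1 + (8 * n + 6))"
  proof (rule process_correct[where U = "set Qs"])
    fix L Qs S s assume "stored L s" "queue Qs s"
    then have "\<exists>L' Rs. stored L' s \<and> queue (Qs @ Rs) s \<and> set (Qs @ Rs) = set Qs \<union> {}"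
      by (intro exI[of _ L] exI[of _ "[]"]) auto
    then show "wp 1 Skip (\<lambda>s'. \<exists>L' Rs. stored L' s' \<and> queue (Qs @ Rs) s' \<and> set (Qs @ Rs) = set Qs \<union> {}) s"
      by (intro wp_simple) auto
  qed (use s in auto)
  then obtain tr s' Rs where tr: "exec (process Skip) s tr s'" "distinct (Qs @ Rs)" "set (Qs @ Rs) \<subseteq> set Qs"
    "outputs tr = map (members n) (Qs @ Rs)" "length tr \<le> Suc (length (Qs @ Rs) * (8 * n + 6 + 1))"
    unfolding drop_0 by blast
  have "set Qs \<inter> set Rs = {}" using tr(2) by (simp only: distinct_append)
  moreover have "set Rs \<subseteq> set Qs" using tr(3) by (simp only: set_append le_sup_iff)
  ultimately have "set Rs = {}" by (simp only: Int_absorb1)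
  then have "Rs = []" by simp
  then show ?thesis using tr(1,4,5) by (intro exI[of _ tr] exI[of _ s']) (simp add: add.commute)
qed

lemma seed_process_Skip:
  assumes s: "fresh L s"
  shows "\<exists>tr s'. exec (Seq seed (process Skip)) s tr s' \<and> outputs tr = [members n first_solution] \<and>
    length tr \<le> 104 * (n * sz) + 8 * n + 9"
proof -
  have "\<exists>tr' tr s''. exec (Seq seed (process Skip)) s (tr' @ tr) s'' \<and> outputs tr' = [] \<and>
    length tr' \<le> 1 + 104 * (n * sz) \<and> outputs tr = map (members n) [first_solution] \<and>
    length tr \<le> Suc (length [first_solution] * (8 * n + 7))"
    by (rule wp_exec_Seq[OF seed_correct[OF s]]) (use process_Skip in blast)
  then obtain tr' tr s'' where "exec (Seq seed (process Skip)) s (tr' @ tr) s''" "outputs tr' = []"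
    "length tr' \<le> 1 + 104 * (n * sz)" "outputs tr = [members n first_solution]" "length tr \<le> 8 * n + 8"
    by auto
  then show ?thesis by (intro exI[of _ "tr' @ tr"] exI[of _ s'']) (simp add: outputs_append)
qed

text \<open>The initial count \<open>1\<close> in \<open>gaps\<close> is the step of
  \<open>prepare\<close>, which precedes this trace.\<close>

lemma seed_process_neighbours:
  assumes s: "fresh L s"
  shows "\<exists>tr s' Qs. exec (Seq seed (process make_neighbours)) s tr s' \<and> distinct Qs \<and>
    set Qs = maximal_dag_sets E {..<n} \<and> outputs tr = map (members n) Qs \<and>
    (\<forall>g\<in>set (gaps 1 tr). g \<le> 518 * (n * (n * sz)))"
proof -
  \<comment> \<open>One bound has to cover both a computation of neighbours (factor
    \<open>397\<close>) and the start-up before the queue loop (factor \<open>106\<close>). The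
    final constant is \<open>518 = 504 + 8 + 6\<close>.\<close>
  let ?M = "maximal_dag_sets E {..<n}" and ?K = "504 * (n * (n * sz))"
  define w where "w = n * (n * sz)"
  have "1 * (n * sz) \<le> w" unfolding w_def using n_pos by (intro mult_le_mono1) simp
  then have w: "n * sz \<le> w" "n \<le> w" "1 \<le> w" using size_bounds(1,4) by linarith+
  have fin: "finite ?M" by (rule finite_subset[of _ "Pow {..<n}"]) (auto simp: maximal_dag_sets_def)
  have nb: "neighbour_sets E {..<n} S \<subseteq> ?M" if "S \<in> ?M" for S
    using neighbour_sets_maximal[OF arcs_subset arcs_irrefl _ that] by simp
  have "\<exists>tr' tr s''. exec (Seq seed (process make_neighbours)) s (tr' @ tr) s'' \<and> outputs tr' = [] \<and>
    length tr' \<le> 1 + 104 * (n * sz) \<and> (\<exists>Rs. distinct ([first_solution] @ Rs) \<and> set ([first_solution] @ Rs) \<subseteq> ?M \<and>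
    (\<forall>S\<in>set (drop 0 ([first_solution] @ Rs)). neighbour_sets E {..<n} S \<subseteq> set ([first_solution] @ Rs)) \<and>
    outputs tr = map (members n) (drop 0 ([first_solution] @ Rs)) \<and>
    length tr \<le> Suc (length (drop 0 ([first_solution] @ Rs)) * (8 * n + 6 + ?K)) \<and>
    (\<forall>p\<le>?K. \<forall>g\<in>set (gaps p tr). g \<le> ?K + (8 * n + 6)))"
  proof (rule wp_exec_Seq[OF seed_correct[OF s]])
    fix s1 assume s1: "(\<exists>L'. stored L' s1 \<and> queue [first_solution] s1) \<and> reg s1 rR = 0 \<and> buffer s1 = []"
    then obtain L1 where L1: "stored L1 s1" by auto
    have "\<exists>tr s'' Rs. exec (process make_neighbours) s1 tr s'' \<and> distinct ([first_solution] @ Rs) \<and>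
      set ([first_solution] @ Rs) \<subseteq> ?M \<and>
      (\<forall>S\<in>set (drop 0 ([first_solution] @ Rs)). neighbour_sets E {..<n} S \<subseteq> set ([first_solution] @ Rs)) \<and>
      outputs tr = map (members n) (drop 0 ([first_solution] @ Rs)) \<and>
      length tr \<le> Suc (length (drop 0 ([first_solution] @ Rs)) * (8 * n + 6 + ?K)) \<and>
      (\<forall>p\<le>?K. \<forall>g\<in>set (gaps p tr). g \<le> ?K + (8 * n + 6))"
    proof (rule process_correct[OF _ _ _ nb fin L1])
      fix L Qs S s assume "stored L s" "queue Qs s" "bits n (cell s aS) S"
      from make_neighbours_correct[OF this(1,3,2)]
      show "wp ?K make_neighbours (\<lambda>s'. \<exists>L' Rs. stored L' s' \<and> queue (Qs @ Rs) s' \<and>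
        set (Qs @ Rs) = set Qs \<union> neighbour_sets E {..<n} S) s"
        by (rule wp_weaken) auto
    qed (use s1 first_solution_maximal in \<open>auto simp: quiet_programs written\<close>)
    then show "\<exists>tr s''. exec (process make_neighbours) s1 tr s'' \<and> (\<exists>Rs. distinct ([first_solution] @ Rs) \<and>
      set ([first_solution] @ Rs) \<subseteq> ?M \<and>
      (\<forall>S\<in>set (drop 0 ([first_solution] @ Rs)). neighbour_sets E {..<n} S \<subseteq> set ([first_solution] @ Rs)) \<and>
      outputs tr = map (members n) (drop 0 ([first_solution] @ Rs)) \<and>
      length tr \<le> Suc (length (drop 0 ([first_solution] @ Rs)) * (8 * n + 6 + ?K)) \<and>
      (\<forall>p\<le>?K. \<forall>g\<in>set (gaps p tr). g \<le> ?K + (8 * n + 6)))" by blast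
  qed
  then obtain tr' tr s'' Rs where tr: "exec (Seq seed (process make_neighbours)) s (tr' @ tr) s''" "outputs tr' = []"
    "length tr' \<le> 1 + 104 * (n * sz)" "distinct (first_solution # Rs)" "set (first_solution # Rs) \<subseteq> ?M"
    "\<And>S. S \<in> set (first_solution # Rs) \<Longrightarrow> neighbour_sets E {..<n} S \<subseteq> set (first_solution # Rs)"
    "outputs tr = map (members n) (first_solution # Rs)"
    "\<forall>p\<le>?K. \<forall>g\<in>set (gaps p tr). g \<le> ?K + (8 * n + 6)"
    unfolding drop_0 append_Cons append_Nil by blast
  have "set (first_solution # Rs) = ?M"
    by (rule neighbour_closed_eq_maximal[OF arcs_subset arcs_irrefl _ tr(5)]) (use tr(6) in auto)
  moreover have "g \<le> 518 * (n * (n * sz))" if "g \<in> set (gaps 1 (tr' @ tr))" for g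
  proof -
    have "1 + length tr' \<le> ?K" using tr(3) w unfolding w_def[symmetric] by linarith
    moreover have "g \<in> set (gaps (1 + length tr') tr)" using that gaps_silent[OF tr(2)] by simp
    ultimately have "g \<le> ?K + (8 * n + 6)" using tr(8) by blast
    then show ?thesis using w unfolding w_def[symmetric] by linarith
  qed
  ultimately show ?thesis using tr(1,2,4,7)
    by (intro exI[of _ "tr' @ tr"] exI[of _ s''] exI[of _ "first_solution # Rs"]) (auto simp: outputs_append)
qed

section \<open>Neighbours of a given solution\<close>

lemma load_correct:
  assumes s: "fresh L s" "\<forall>i. cell s aS i = 0" "reg s 3 = length xs" "\<forall>i<length xs. cell s 3 i = xs ! i"
  shows "wp (2 + 3 * length xs) load (\<lambda>s'. bits n (cell s' aS) (set xs)) s"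
  unfolding load_def
  by (rule wp_For_simple[where N = "length xs" and I = "\<lambda>i s'. bits n (cell s' aS) (set (take i xs))"])
    (use s in \<open>auto simp: frame_def bits_def take_Suc_conv_app_nth\<close>)

text \<open>A queue has no repetitions, so this bounds its length and with it the time for printing
  it.\<close>

lemma card_neighbour_sets: "card (neighbour_sets E {..<n} S) \<le> 2 * n"
proof -
  have "card (neighbour_sets E {..<n} S) \<le>
    (\<Sum>v\<in>{..<n} - S. card (neighbour E {..<n} S v ` neighbourhoods E v))"
    unfolding neighbour_sets_def by (rule card_UN_le) simp
  also have "\<dots> \<le> (\<Sum>v\<in>{..<n} - S. 2)"
    by (rule sum_mono) (auto simp: neighbourhoods_def card_insert_if)
  also have "\<dots> \<le> 2 * n" using card_mono[of "{..<n}" "{..<n} - S"] by simp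
  finally show ?thesis .
qed

text \<open>As the queue is empty at the start, it ends up with exactly the neighbours of
  \<open>set xs\<close>. Finding them contributes the factor \<open>397\<close>, printing them
  \<open>30\<close>, and the rest of \<open>440\<close> absorbs lower-order terms.\<close>

lemma load_process_neighbours:
  assumes s: "fresh L s" "\<forall>i. cell s aS i = 0" "reg s 3 = length xs" "\<forall>i<length xs. cell s 3 i = xs ! i"
    and xs: "length xs \<le> n"
  shows "\<exists>tr s' Qs. exec (Seq load (Seq make_neighbours (process Skip))) s tr s' \<and>
    set Qs = neighbour_sets E {..<n} (set xs) \<and> outputs tr = map (members n) Qs \<and>
    length tr \<le> 440 * (n * (n * sz))"
proof -
  have "wp (2 + 3 * length xs) load (\<lambda>s'. (bits n (cell s' aS) (set xs) \<and> preserved load s s') \<and> buffer s' = buffer s) s"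
    by (intro wp_quiet wp_preserved load_correct[OF s]) (auto simp: load_def)
  then have 1: "wp (3 * n + 2) load (\<lambda>s'. fresh L s' \<and> bits n (cell s' aS) (set xs)) s"
    by (rule wp_weaken) (use xs s(1) in \<open>auto simp: load_def frame_def fresh_def stored_def holds_list_def\<close>)
  have 2: "wp (397 * (n * (n * sz))) make_neighbours (\<lambda>s'. (\<exists>L Qs. stored L s' \<and> queue Qs s' \<and>
      set Qs = neighbour_sets E {..<n} (set xs)) \<and> reg s' rR = 0 \<and> buffer s' = []) s1"
    if s1: "fresh L s1 \<and> bits n (cell s1 aS) (set xs)" for s1
  proof -
    have "wp (397 * (n * (n * sz))) make_neighbours (\<lambda>s'. ((\<exists>L' Rs. stored L' s' \<and> queue ([] @ Rs) s' \<and>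
      set ([] @ Rs) = set [] \<union> neighbour_sets E {..<n} (set xs)) \<and> preserved make_neighbours s1 s') \<and>
      buffer s' = buffer s1) s1"
      using s1 fresh_queue by (intro wp_quiet wp_preserved make_neighbours_correct[where Qs = "[]"])
        (auto simp: fresh_def silent_programs quiet_programs)
    then show ?thesis
      by (rule wp_weaken) (use s1 in \<open>auto simp: frame_def written fresh_def\<close>)
  qed
  have 3: "\<exists>tr s'. exec (process Skip) s2 tr s' \<and> (\<exists>Qs. set Qs = neighbour_sets E {..<n} (set xs) \<and>
      outputs tr = map (members n) Qs \<and> length tr \<le> Suc (2 * n * (8 * n + 7)))"
    if s2: "(\<exists>L Qs. stored L s2 \<and> queue Qs s2 \<and>
      set Qs = neighbour_sets E {..<n} (set xs)) \<and> reg s2 rR = 0 \<and> buffer s2 = []" for s2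
  proof -
    obtain L2 Qs where Qs: "stored L2 s2" "queue Qs s2" "set Qs = neighbour_sets E {..<n} (set xs)"
      using s2 by auto
    have "length Qs = card (set Qs)" using Qs(2) by (simp add: queue_def distinct_card)
    then have "length Qs * (8 * n + 7) \<le> 2 * n * (8 * n + 7)"
      using card_neighbour_sets[of "set xs"] Qs(3) by (intro mult_le_mono1) simp
    moreover obtain tr s' where "exec (process Skip) s2 tr s'" "outputs tr = map (members n) Qs"
      "length tr \<le> Suc (length Qs * (8 * n + 7))"
      using process_Skip[OF Qs(1,2)] s2 by auto
    ultimately show ?thesis using Qs(3) by (meson Suc_le_mono le_trans)
  qed
  have 4: "\<exists>tr s'. exec (Seq make_neighbours (process Skip)) s1 tr s' \<and>
      (\<exists>Qs. set Qs = neighbour_sets E {..<n} (set xs) \<and>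
      outputs tr = map (members n) Qs \<and> length tr \<le> 397 * (n * (n * sz)) + Suc (2 * n * (8 * n + 7)))"
    if s1: "fresh L s1 \<and> bits n (cell s1 aS) (set xs)" for s1
  proof -
    obtain tr' tr s'' Qs where "exec (Seq make_neighbours (process Skip)) s1 (tr' @ tr) s''" "outputs tr' = []"
      "length tr' \<le> 397 * (n * (n * sz))" "set Qs = neighbour_sets E {..<n} (set xs)"
      "outputs tr = map (members n) Qs" "length tr \<le> Suc (2 * n * (8 * n + 7))"
      using wp_exec_Seq[OF 2[OF s1] 3] by blast
    then show ?thesis
      by (intro exI[of _ "tr' @ tr"] exI[of _ s''] conjI exI[of _ Qs]) (auto simp: outputs_append)
  qed
  obtain tr' tr s'' Qs where tr: "exec (Seq load (Seq make_neighbours (process Skip))) s (tr' @ tr) s''"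
    "outputs tr' = []" "length tr' \<le> 3 * n + 2" "set Qs = neighbour_sets E {..<n} (set xs)"
    "outputs tr = map (members n) Qs" "length tr \<le> 397 * (n * (n * sz)) + Suc (2 * n * (8 * n + 7))"
    using wp_exec_Seq[OF 1 4] by blast
  define w where "w = n * (n * sz)"
  have "1 * (n * sz) \<le> w" unfolding w_def using n_pos by (intro mult_le_mono1) simp
  then have w: "n \<le> w" "1 \<le> w" using size_bounds(1,4) by linarith+
  have "n * n \<le> w" unfolding w_def using size_bounds(1) by (intro mult_le_mono2)
  then have "2 * n * (8 * n + 7) \<le> 16 * w + 14 * w" using w(1) by (simp add: distrib_left)
  then have "length (tr' @ tr) \<le> 440 * (n * (n * sz))"
    using tr(3,6) w unfolding w_def[symmetric] by simp
  then show ?thesis using tr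
    by (intro exI[of _ "tr' @ tr"] exI[of _ s''] exI[of _ Qs]) (auto simp: outputs_append)
qed

end

section \<open>Presented digraphs\<close>

text \<open>Connectivity and acyclicity speak only of subsets and of arcs between their elements, so
  they pass along an injection that preserves and reflects arcs.\<close>

lemma dag_set_image:
  assumes inj: "inj_on f J" and rel: "\<And>i j. i \<in> J \<Longrightarrow> j \<in> J \<Longrightarrow> (f i, f j) \<in> R \<longleftrightarrow> (i, j) \<in> E"
  shows "dag_set R (f ` J) \<longleftrightarrow> dag_set E J"
proof -
  have adj: "adjacent R (f i) (f j) \<longleftrightarrow> adjacent E i j" if "i \<in> J" "j \<in> J" for i j
    using that rel by (simp add: adjacent_def)
  have eq: "f ` Z = f ` J \<longleftrightarrow> Z = J" if "Z \<subseteq> J" for Z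
    using inj_on_image_eq_iff[OF inj that order.refl] .
  have cut: "(\<exists>a\<in>f ` Z. \<exists>b\<in>f ` J - f ` Z. adjacent R a b) \<longleftrightarrow> (\<exists>a\<in>Z. \<exists>b\<in>J - Z. adjacent E a b)"
    if "Z \<subseteq> J" for Z
  proof -
    have diff: "f ` J - f ` Z = f ` (J - Z)" using inj_on_image_set_diff[OF inj _ that, of J] by auto
    have "adjacent R (f a) (f b) \<longleftrightarrow> adjacent E a b" if "a \<in> Z" "b \<in> J - Z" for a b
      using that \<open>Z \<subseteq> J\<close> by (intro adj) auto
    then show ?thesis
      unfolding diff bex_simps by (intro bex_cong[OF refl])
  qed
  have "connected_in R (f ` J) \<longleftrightarrow> connected_in E J"
    unfolding connected_in_def imp_conjL all_subset_image using eq cut by auto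
  moreover have "acyclic_in R (f ` J) \<longleftrightarrow> acyclic_in E J"
    unfolding acyclic_in_def all_subset_image
  proof (rule iff_allI, rule imp_cong[OF refl])
    fix Z assume "Z \<subseteq> J"
    then show "(f ` Z \<noteq> {} \<longrightarrow> (\<exists>y\<in>f ` Z. \<forall>z\<in>f ` Z. (y, z) \<notin> R)) =
      (Z \<noteq> {} \<longrightarrow> (\<exists>y\<in>Z. \<forall>z\<in>Z. (y, z) \<notin> E))"
      using rel by (simp add: subset_iff cong: bex_cong_simp)
  qed
  ultimately show ?thesis by (simp add: dag_set_def)
qed

text \<open>A path that leaves \<open>Y\<close> has an arc crossing the cut at \<open>Y\<close>.
  Conversely, the set reachable from \<open>u\<close> would be a cut without a crossing arc if it
  missed some \<open>v\<close>. The symmetric closure makes reachability ignore directions.\<close>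

lemma connected_induce_subgraph_iff:
  assumes "wf_digraph G"
  shows "connected (G \<restriction> S) \<longleftrightarrow> connected_in (arcs_ends G) S"
proof -
  define A where "A = arcs_ends (with_proj (mk_symmetric (G \<restriction> S)))"
  have A: "(x, y) \<in> A \<longleftrightarrow> x \<in> S \<and> y \<in> S \<and> adjacent (arcs_ends G) x y" for x y
    unfolding A_def adjacent_def mk_symmetric_def by (auto simp: arcs_ends_conv)
  have con: "connected (G \<restriction> S) \<longleftrightarrow> S \<noteq> {} \<and> (\<forall>u\<in>S. \<forall>v\<in>S. (u, v) \<in> rtrancl_on S A)"
    unfolding Digraph_Component.connected_def strongly_connected_def reachable_def A_def
    by (simp add: mk_symmetric_def)
  show ?thesis
  proof
    assume "connected (G \<restriction> S)"
    then have S: "S \<noteq> {}" and reach: "\<And>u v. u \<in> S \<Longrightarrow> v \<in> S \<Longrightarrow> (u, v) \<in> rtrancl_on S A"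
      by (auto simp: con)
    show "connected_in (arcs_ends G) S" unfolding connected_in_def
    proof (intro conjI allI impI S)
      fix Y assume Y: "Y \<subseteq> S \<and> Y \<noteq> {} \<and> Y \<noteq> S"
      then obtain u v where uv: "u \<in> Y" "v \<in> S" "v \<notin> Y" by blast
      show "\<exists>a\<in>Y. \<exists>b\<in>S - Y. adjacent (arcs_ends G) a b"
      proof (rule ccontr)
        assume no: "\<not> ?thesis"
        have "(u, v) \<in> rtrancl_on S A" using reach uv Y by auto
        then have "v \<in> Y"
          by (induction rule: rtrancl_on_induct) (use uv(1) no A in auto)
        then show False using uv by simp
      qed
    qed
  next
    assume c: "connected_in (arcs_ends G) S"
    have "(u, v) \<in> rtrancl_on S A" if uv: "u \<in> S" "v \<in> S" for u v
    proof (rule ccontr)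
      assume no: "(u, v) \<notin> rtrancl_on S A"
      have "\<exists>a\<in>{w \<in> S. (u, w) \<in> rtrancl_on S A}. \<exists>b\<in>S - {w \<in> S. (u, w) \<in> rtrancl_on S A}.
        adjacent (arcs_ends G) a b"
        using uv no by (intro connected_in_cut[OF c]) auto
      then obtain a b where "a \<in> S" "b \<in> S" "(u, a) \<in> rtrancl_on S A" "(u, b) \<notin> rtrancl_on S A"
        "adjacent (arcs_ends G) a b" by blast
      then show False using A rtrancl_on_into_rtrancl_on[of u a S A b] by blast
    qed
    then show "connected (G \<restriction> S)" using c by (auto simp: con connected_in_def)
  qed
qed

text \<open>A closed walk contains a cycle, and closed walks correspond to pairs
  \<open>(u, u)\<close> in the transitive closure, which is how \<open>acyclic\<close> is
  defined.\<close>

lemma cycle_induce_subgraph_iff: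
  assumes G: "wf_digraph G" and S: "S \<subseteq> verts G" "finite S"
  shows "(\<exists>p. pre_digraph.cycle (G \<restriction> S) p) \<longleftrightarrow> \<not> acyclic_in (arcs_ends G) S"
proof -
  interpret G: wf_digraph G by (rule G)
  interpret H: wf_digraph "G \<restriction> S" by (rule G.wellformed_induce_subgraph)
  have ends: "arcs_ends (G \<restriction> S) = arcs_ends G \<inter> S \<times> S" by (auto simp: arcs_ends_conv)
  have "(\<exists>p. H.cycle p) \<longleftrightarrow> (\<exists>p. H.closed_w p)"
    using H.closed_w_imp_cycle H.cycle_altdef by blast
  also have "\<dots> \<longleftrightarrow> (\<exists>u. (u, u) \<in> (arcs_ends (G \<restriction> S))\<^sup>+)"
    unfolding H.closed_w_def H.reachable1_awalk by auto
  also have "\<dots> \<longleftrightarrow> \<not> acyclic_in (arcs_ends G) S"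
    unfolding acyclic_in_iff[OF S(2)] ends acyclic_def by blast
  finally show ?thesis .
qed

lemma connected_acyclic_set_iff:
  assumes "fin_digraph G"
  shows "connected_acyclic_set G S \<longleftrightarrow> S \<subseteq> verts G \<and> dag_set (arcs_ends G) S"
proof -
  interpret fin_digraph G by fact
  show ?thesis
    unfolding connected_acyclic_set_def dag_set_def
    using connected_induce_subgraph_iff[OF wf_digraph, of S] cycle_induce_subgraph_iff[OF wf_digraph, of S]
      finite_subset[OF _ finite_verts] by blast
qed

section \<open>Vertex numbers and vertex sets\<close>

lemma position_nth: "distinct vs \<Longrightarrow> i < length vs \<Longrightarrow> position vs (vs ! i) = i"
  unfolding position_def by (rule the_equality) (auto simp: nth_eq_iff_index_eq)

lemma position_less: "distinct vs \<Longrightarrow> v \<in> set vs \<Longrightarrow> position vs v < length vs"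
  by (metis in_set_conv_nth position_nth)

lemma nth_position: "distinct vs \<Longrightarrow> v \<in> set vs \<Longrightarrow> vs ! position vs v = v"
  by (metis in_set_conv_nth position_nth)

definition arc_list :: "('a, 'b) presented_digraph \<Rightarrow> (nat \<times> nat) list" where
  "arc_list = (\<lambda>(G, vs, as). map (\<lambda>a. (position vs (tail G a), position vs (head G a))) as)"

definition indices :: "'a list \<Rightarrow> 'a set \<Rightarrow> nat set" where
  "indices vs S = {i. i < length vs \<and> vs ! i \<in> S}"

locale presented =
  fixes G :: "('a, 'b) pre_digraph" and vs :: "'a list" and as :: "'b list"
  assumes inst: "(G, vs, as) \<in> presented_digraphs"
begin

sublocale digraph G using inst by (simp add: presented_digraphs_def)

abbreviation "E \<equiv> set (arc_list (G, vs, as))"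

lemma vs: "distinct vs" "set vs = verts G" and as: "distinct as" "set as = arcs G"
  and nonempty: "verts G \<noteq> {}" and no_isolated: "\<And>v. v \<in> verts G \<Longrightarrow> \<exists>a\<in>arcs G. tail G a = v \<or> head G a = v"
  using inst by (auto simp: presented_digraphs_def)

lemma arc_iff:
  assumes "i < length vs" "j < length vs"
  shows "(vs ! i, vs ! j) \<in> arcs_ends G \<longleftrightarrow> (i, j) \<in> E"
proof
  assume "(vs ! i, vs ! j) \<in> arcs_ends G"
  then obtain a where a: "a \<in> arcs G" "vs ! i = tail G a" "vs ! j = head G a" by (auto simp: arcs_ends_conv)
  then have "i = position vs (tail G a)" "j = position vs (head G a)"
    using position_nth[OF vs(1)] assms by metis+
  then show "(i, j) \<in> E" using a(1) by (auto simp: arc_list_def as(2))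
next
  assume "(i, j) \<in> E"
  then obtain a where "a \<in> arcs G" "i = position vs (tail G a)" "j = position vs (head G a)"
    using as by (auto simp: arc_list_def)
  then show "(vs ! i, vs ! j) \<in> arcs_ends G"
    using nth_position[OF vs(1)] vs(2) by (auto simp: arcs_ends_conv)
qed

sublocale numbered_digraph "length vs" "length as" E
proof
  show "E \<subseteq> {..<length vs} \<times> {..<length vs}"
    using as vs position_less[OF vs(1)] by (auto simp: arc_list_def)
  show "irrefl E" unfolding irrefl_def
  proof (intro allI notI)
    fix i assume i: "(i, i) \<in> E"
    then obtain a where "a \<in> arcs G" "i = position vs (tail G a)" "i = position vs (head G a)"
      using as by (auto simp: arc_list_def)
    then show False using no_loops nth_position[OF vs(1)] vs(2) by (metis head_in_verts tail_in_verts)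
  qed
  show "0 < length vs" using nonempty vs by auto
qed

lemma inj: "inj_on ((!) vs) {..<length vs}"
  using vs(1) by (auto simp: inj_on_def nth_eq_iff_index_eq)

lemma image_indices: "S \<subseteq> verts G \<Longrightarrow> (!) vs ` indices vs S = S"
  using vs by (auto simp: indices_def image_iff) (metis in_set_conv_nth subsetD)

lemma indices_image: "J \<subseteq> {..<length vs} \<Longrightarrow> indices vs ((!) vs ` J) = J"
  using vs(1) by (auto simp: indices_def nth_eq_iff_index_eq subset_iff)

lemma image_subset_verts: "J \<subseteq> {..<length vs} \<Longrightarrow> (!) vs ` J \<subseteq> verts G"
  unfolding vs(2)[symmetric] by auto

lemma connected_acyclic_set_image:
  assumes "J \<subseteq> {..<length vs}"
  shows "connected_acyclic_set G ((!) vs ` J) \<longleftrightarrow> dag_set E J"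
proof -
  have "dag_set (arcs_ends G) ((!) vs ` J) \<longleftrightarrow> dag_set E J"
    using assms by (intro dag_set_image inj_on_subset[OF inj] arc_iff) auto
  then show ?thesis
    using connected_acyclic_set_iff[OF fin_digraph] image_subset_verts[OF assms] by blast
qed

text \<open>\<open>indices vs\<close> and the image under \<open>(!) vs\<close> are mutually inverse
  between vertex sets and sets of vertex numbers and preserve inclusion, so maximality carries
  over.\<close>

lemma maximal_image:
  "maximal_connected_acyclic_sets G = (`) ((!) vs) ` maximal_dag_sets E {..<length vs}"
proof (intro equalityI subsetI)
  fix S assume S: "S \<in> maximal_connected_acyclic_sets G"
  then have sub: "S \<subseteq> verts G"
    by (simp add: maximal_connected_acyclic_sets_def connected_acyclic_set_def)
  define J where "J = indices vs S"
  have J: "J \<subseteq> {..<length vs}" "S = (!) vs ` J" using image_indices[OF sub] by (auto simp: J_def indices_def)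
  have "\<not> dag_set E K" if "J \<subset> K" "K \<subseteq> {..<length vs}" for K
  proof -
    have "(!) vs ` J \<subset> (!) vs ` K" 
      using that indices_image[OF J(1)] indices_image[OF that(2)] by (metis image_mono psubset_eq)
    then show ?thesis
      using S J connected_acyclic_set_image[OF that(2)] by (auto simp: maximal_connected_acyclic_sets_def)
  qed
  then have "J \<in> maximal_dag_sets E {..<length vs}"
    using S J connected_acyclic_set_image[OF J(1)]
    by (auto simp: maximal_dag_sets_def maximal_connected_acyclic_sets_def)
  then show "S \<in> (`) ((!) vs) ` maximal_dag_sets E {..<length vs}" using J by auto
next
  fix S assume "S \<in> (`) ((!) vs) ` maximal_dag_sets E {..<length vs}"
  then obtain J where J: "J \<in> maximal_dag_sets E {..<length vs}" "S = (!) vs ` J" by auto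
  then have sub: "J \<subseteq> {..<length vs}" and "dag_set E J" by (auto simp: maximal_dag_sets_def)
  then have "connected_acyclic_set G S" using connected_acyclic_set_image J by simp
  moreover have "\<not> connected_acyclic_set G S'" if "S \<subset> S'" for S'
  proof
    assume S': "connected_acyclic_set G S'"
    then have im: "(!) vs ` indices vs S' = S'" by (intro image_indices) (simp add: connected_acyclic_set_def)
    have "indices vs S' \<subseteq> {..<length vs}" by (auto simp: indices_def)
    moreover from this have "dag_set E (indices vs S')" using connected_acyclic_set_image S' im by metis
    moreover have "J \<subset> indices vs S'"
      using that im J sub by (auto simp: indices_def)
    ultimately show False using J by (auto simp: maximal_dag_sets_def)
  qed
  ultimately show "S \<in> maximal_connected_acyclic_sets G" by (auto simp: maximal_connected_acyclic_sets_def)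
qed

lemma represents_members:
  assumes "J \<subseteq> {..<length vs}"
  shows "represents vs (members (length vs) J) ((!) vs ` J)"
  using assms by (auto simp: represents_def members_def image_iff)

lemma list_all2_represents:
  "\<forall>J\<in>set Js. J \<subseteq> {..<length vs} \<Longrightarrow>
    list_all2 (represents vs) (map (members (length vs)) Js) (map ((`) ((!) vs)) Js)"
  by (induction Js) (auto intro: represents_members)

text \<open>Input occupies at most the registers and arrays \<open>0\<close> to \<open>3\<close>, so
  everything that the programs use from \<open>4\<close> upwards starts at zero.\<close>

lemma prepare_fresh:
  fixes extra :: "nat list list"
  defines "s \<equiv> initial (encode_digraph (G, vs, as) @ extra)"
  assumes "length extra \<le> 1"
  shows "\<exists>s'. exec prepare s [Tick] s' \<and> fresh (arc_list (G, vs, as)) s' \<and> (\<forall>i. cell s' aS i = 0) \<and>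
    reg s' 3 = reg s 3 \<and> cell s' 3 = cell s 3"
proof -
  let ?s = "s\<lparr>reg := (reg s)(rN := length vs)\<rparr>"
  have len: "length (encode_digraph (G, vs, as) @ extra) \<le> 4" using assms by simp
  have c0: "cell s 0 0 = length vs" by (simp add: s_def initial_def)
  have "exec prepare s [Tick] ?s"
    unfolding prepare_def using exec.Assign[of rN "Cell 0 (Const 0)" s] c0 by simp
  moreover have "fresh (arc_list (G, vs, as)) ?s"
    using len unfolding fresh_def stored_def holds_list_def
    by (auto simp: s_def initial_def arc_list_def)
  moreover have "\<forall>i. cell ?s aS i = 0" using len by (simp add: s_def initial_def)
  ultimately show ?thesis by (intro exI[of _ ?s]) auto
qed

lemma exec_prepare_Seq:
  assumes "length extra \<le> 1"
    and "\<And>s. fresh (arc_list (G, vs, as)) s \<Longrightarrow> \<forall>i. cell s aS i = 0 \<Longrightarrow>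
      reg s 3 = reg (initial (encode_digraph (G, vs, as) @ extra)) 3 \<Longrightarrow>
      cell s 3 = cell (initial (encode_digraph (G, vs, as) @ extra)) 3 \<Longrightarrow> \<exists>tr s'. exec c s tr s' \<and> Q tr"
  shows "\<exists>tr s'. exec (Seq prepare c) (initial (encode_digraph (G, vs, as) @ extra)) (Tick # tr) s' \<and> Q tr"
proof -
  obtain s where s: "exec prepare (initial (encode_digraph (G, vs, as) @ extra)) [Tick] s"
    "fresh (arc_list (G, vs, as)) s" "\<forall>i. cell s aS i = 0"
    "reg s 3 = reg (initial (encode_digraph (G, vs, as) @ extra)) 3"
    "cell s 3 = cell (initial (encode_digraph (G, vs, as) @ extra)) 3"
    using prepare_fresh[OF assms(1)] by blast
  then obtain tr s' where "exec c s tr s'" "Q tr" using assms(2) by blast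
  then show ?thesis using exec.Seq[OF s(1)] by force
qed

text \<open>Every vertex is an end of an arc and an arc has two ends, so there are at most twice as
  many vertices as arcs.\<close>

lemma size_le_arcs: "length vs + length as \<le> 3 * length as"
proof -
  have "verts G \<subseteq> tail G ` arcs G \<union> head G ` arcs G" using no_isolated by blast
  then have "card (verts G) \<le> card (tail G ` arcs G) + card (head G ` arcs G)"
    using card_mono[of "tail G ` arcs G \<union> head G ` arcs G"] card_Un_le le_trans by (meson finite_UnI finite_arcs finite_imageI)
  also have "\<dots> \<le> card (arcs G) + card (arcs G)"
    by (intro add_mono card_image_le finite_arcs)
  finally show ?thesis using vs as distinct_card[of vs] distinct_card[of as] by simp
qed

text \<open>Polynomial time is measured in the number of vertices alone, so the number of arcs has
  to be bounded by it; this uses the absence of parallel arcs.\<close>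

lemma size_le_square: "length vs + length as \<le> 2 * (length vs * length vs)"
proof -
  have "inj_on (arc_to_ends G) (arcs G)" using no_multi_arcs by (auto simp: inj_on_def)
  then have "card (arcs G) \<le> card (verts G \<times> verts G)"
    by (rule card_inj_on_le) (auto simp: arc_to_ends_def)
  then have "length as \<le> length vs * length vs"
    using vs as distinct_card[of vs] distinct_card[of as] by (simp add: card_cartesian_product)
  then show ?thesis using le_square[of "length vs"] by linarith
qed

lemma card_verts: "card (set vs) = length vs"
  using vs distinct_card by blast

lemma solution_program_correct:
  "\<exists>tr s xs S. exec solution_program (initial (encode_digraph (G, vs, as))) tr s \<and>
     length tr \<le> 300 * length vs ^ 3 \<and> outputs tr = [xs] \<and> represents vs xs S \<and>
     S \<in> maximal_connected_acyclic_sets G"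
proof -
  let ?n = "length vs"
  have J: "first_solution \<subseteq> {..<?n}"
    using first_solution_maximal by (simp add: maximal_dag_sets_def)
  obtain tr s where tr: "exec solution_program (initial (encode_digraph (G, vs, as) @ [])) (Tick # tr) s"
    "outputs tr = [members ?n first_solution]"
    "length tr \<le> 104 * (?n * (?n + length as)) + 8 * ?n + 9"
  proof -
    have "\<exists>tr s. exec solution_program (initial (encode_digraph (G, vs, as) @ [])) (Tick # tr) s \<and>
      (outputs tr = [members ?n first_solution] \<and> length tr \<le> 104 * (?n * (?n + length as)) + 8 * ?n + 9)"
      unfolding solution_program_def
      by (rule exec_prepare_Seq) (simp, rule seed_process_Skip)
    then show ?thesis using that by blast
  qed
  define w where "w = ?n * (?n * ?n)"
  have "?n * (?n + length as) \<le> ?n * (2 * (?n * ?n))" using size_le_square by (intro mult_le_mono2)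
  also have "\<dots> = 2 * w" by (simp add: w_def)
  finally have "?n * (?n + length as) \<le> 2 * w" .
  moreover have "?n * (1 * 1) \<le> w" "1 * (1 * 1) \<le> w"
    unfolding w_def using n_pos by (intro mult_le_mono; simp add: Suc_le_eq)+
  \<comment> \<open>The sum is \<open>2 * 104 + 8 + 9 + 1 = 226\<close> times \<open>w\<close> at
    most.\<close>
  ultimately have "length (Tick # tr) \<le> 300 * w" using tr(3) by simp
  then have "length (Tick # tr) \<le> 300 * ?n ^ 3" by (simp add: w_def power3_eq_cube)
  moreover have "represents vs (members ?n first_solution) ((!) vs ` first_solution)"
    using J by (rule represents_members)
  moreover have "(!) vs ` first_solution \<in> maximal_connected_acyclic_sets G"
    using first_solution_maximal maximal_image by blast
  ultimately show ?thesis using tr(1,2)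
    by (intro exI[of _ "Tick # tr"] exI[of _ s] exI[of _ "members ?n first_solution"]
        exI[of _ "(!) vs ` first_solution"]) simp
qed

lemma neighbours_program_correct:
  assumes S: "S \<in> maximal_connected_acyclic_sets G" and xs: "represents vs xs S"
  shows "\<exists>tr s Ss. exec neighbours_program (initial (encode_digraph (G, vs, as) @ [xs])) tr s \<and>
     length tr \<le> 900 * length vs ^ 4 \<and> list_all2 (represents vs) (outputs tr) Ss \<and>
     set Ss = (`) ((!) vs) ` neighbour_sets E {..<length vs} (indices vs S)"
proof -
  let ?n = "length vs"
  have xs': "distinct xs" "set xs \<subseteq> {..<?n}" "indices vs S = set xs"
    using xs indices_image by (auto simp: represents_def)
  then have len: "length xs \<le> ?n"
    using card_mono[OF finite_lessThan xs'(2)] by (simp add: distinct_card)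
  have "S = (!) vs ` set xs" using xs by (simp add: represents_def)
  moreover obtain J where "J \<in> maximal_dag_sets E {..<?n}" "S = (!) vs ` J" using S maximal_image by auto
  ultimately have max: "set xs \<in> maximal_dag_sets E {..<?n}"
    using indices_image xs'(2,3) by (metis (no_types, lifting) maximal_dag_sets_def mem_Collect_eq)
  obtain tr s Qs where tr: "exec neighbours_program (initial (encode_digraph (G, vs, as) @ [xs])) (Tick # tr) s"
    "set Qs = neighbour_sets E {..<?n} (set xs)" "outputs tr = map (members ?n) Qs"
    "length tr \<le> 440 * (?n * (?n * (?n + length as)))"
  proof -
    have "\<exists>tr s. exec neighbours_program (initial (encode_digraph (G, vs, as) @ [xs])) (Tick # tr) s \<and>
      (\<exists>Qs. set Qs = neighbour_sets E {..<?n} (set xs) \<and> outputs tr = map (members ?n) Qs \<and>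
      length tr \<le> 440 * (?n * (?n * (?n + length as))))"
      unfolding neighbours_program_def
    proof (rule exec_prepare_Seq)
      fix s assume s: "fresh (arc_list (G, vs, as)) s" "\<forall>i. cell s aS i = 0"
        "reg s 3 = reg (initial (encode_digraph (G, vs, as) @ [xs])) 3"
        "cell s 3 = cell (initial (encode_digraph (G, vs, as) @ [xs])) 3"
      have "reg s 3 = length xs" "\<forall>i<length xs. cell s 3 i = xs ! i"
        using s(3,4) by (simp_all add: initial_def)
      then show "\<exists>tr s'. exec (Seq load (Seq make_neighbours (process Skip))) s tr s' \<and>
        (\<exists>Qs. set Qs = neighbour_sets E {..<?n} (set xs) \<and> outputs tr = map (members ?n) Qs \<and>
        length tr \<le> 440 * (?n * (?n * (?n + length as))))"
        using load_process_neighbours[OF s(1,2) _ _ len] by blast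
    qed simp
    then show ?thesis using that by blast
  qed
  have "set Qs \<subseteq> maximal_dag_sets E {..<?n}"
    using tr(2) neighbour_sets_maximal[OF arcs_subset arcs_irrefl _ max] by simp
  then have "\<forall>J\<in>set Qs. J \<subseteq> {..<?n}" by (auto simp: maximal_dag_sets_def)
  then have "list_all2 (represents vs) (outputs (Tick # tr)) (map ((`) ((!) vs)) Qs)"
    using list_all2_represents tr(3) by simp
  moreover have "set (map ((`) ((!) vs)) Qs) = (`) ((!) vs) ` neighbour_sets E {..<?n} (indices vs S)"
    using tr(2) xs'(3) by simp
  moreover have "length (Tick # tr) \<le> 900 * ?n ^ 4"
  proof -
    define w where "w = ?n * (?n * (?n * ?n))"
    have "?n * (?n * (?n + length as)) \<le> ?n * (?n * (2 * (?n * ?n)))"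
      using size_le_square by (intro mult_le_mono2)
    also have "\<dots> = 2 * w" by (simp add: w_def)
    finally have "?n * (?n * (?n + length as)) \<le> 2 * w" .
    moreover have "1 * (1 * (1 * 1)) \<le> w"
      unfolding w_def using n_pos by (intro mult_le_mono; simp add: Suc_le_eq)
    \<comment> \<open>The sum is \<open>2 * 440 + 1 = 881\<close> times \<open>w\<close> at
      most.\<close>
    ultimately have "length (Tick # tr) \<le> 900 * w" using tr(4) by simp
    then show ?thesis by (simp add: w_def numeral_eq_Suc)
  qed
  ultimately show ?thesis using tr(1) by blast
qed

lemma listing_program_correct:
  "\<exists>tr s. exec listing_program (initial (encode_digraph (G, vs, as))) tr s \<and>
     lists_exactly_once connected_acyclic_listing (G, vs, as) tr \<and>
     delay tr \<le> 1554 * (card (arcs G) * card (verts G) ^ 2)"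
proof -
  let ?n = "length vs"
  obtain tr s Qs where tr: "exec listing_program (initial (encode_digraph (G, vs, as) @ [])) (Tick # tr) s"
    "distinct Qs" "set Qs = maximal_dag_sets E {..<?n}" "outputs tr = map (members ?n) Qs"
    "\<forall>g\<in>set (gaps 1 tr). g \<le> 518 * (?n * (?n * (?n + length as)))"
  proof -
    have "\<exists>tr s. exec listing_program (initial (encode_digraph (G, vs, as) @ [])) (Tick # tr) s \<and>
      (\<exists>Qs. distinct Qs \<and> set Qs = maximal_dag_sets E {..<?n} \<and> outputs tr = map (members ?n) Qs \<and>
      (\<forall>g\<in>set (gaps 1 tr). g \<le> 518 * (?n * (?n * (?n + length as)))))"
      unfolding listing_program_def
      by (rule exec_prepare_Seq) (simp, use seed_process_neighbours in blast)
    then show ?thesis using that by blast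
  qed
  have sub: "\<forall>J\<in>set Qs. J \<subseteq> {..<?n}" using tr(3) by (auto simp: maximal_dag_sets_def)
  have "inj_on ((`) ((!) vs)) (set Qs)"
    using sub indices_image by (metis inj_onI)
  then have "distinct (map ((`) ((!) vs)) Qs)" using tr(2) by (simp add: distinct_map)
  moreover have "set (map ((`) ((!) vs)) Qs) = maximal_connected_acyclic_sets G"
    using tr(3) maximal_image by simp
  moreover have "list_all2 (represents vs) (outputs (Tick # tr)) (map ((`) ((!) vs)) Qs)"
    using list_all2_represents[OF sub] tr(4) by simp
  ultimately have "lists_exactly_once connected_acyclic_listing (G, vs, as) (Tick # tr)"
    unfolding lists_exactly_once_def connected_acyclic_listing_def by auto
  moreover have "delay (Tick # tr) \<le> 1554 * (card (arcs G) * card (verts G) ^ 2)"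
  proof -
    have ne: "gaps k tr' \<noteq> []" for k tr' by (induction k tr' rule: gaps.induct) auto
    have "delay (Tick # tr) \<le> 518 * (?n * (?n * (?n + length as)))"
      unfolding delay_def using tr(5) ne by (intro Max.boundedI) auto
    \<comment> \<open>The absence of isolated vertices removes the number of vertices from the last
      factor; \<open>1554\<close> is \<open>3 * 518\<close>.\<close>
    also have "\<dots> \<le> 518 * (?n * (?n * (3 * length as)))"
      using size_le_arcs by (intro mult_le_mono2)
    also have "\<dots> = 1554 * (length as * ?n ^ 2)" by (simp add: power2_eq_square)
    finally show ?thesis using vs as distinct_card by metis
  qed
  ultimately show ?thesis using tr(1) by auto
qed

end

theorem theorem10p5:
  shows "proximity_searchable
           (connected_acyclic_listing :: (('a, 'b) presented_digraph, 'a) listing_problem) \<and>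
         (\<exists>C :: nat. listable_with_delay
           (connected_acyclic_listing :: (('a, 'b) presented_digraph, 'a) listing_problem)
           (\<lambda>(G, vs, as). C * (card (arcs G) * card (verts G) ^ 2)))"
proof
  let ?P = "connected_acyclic_listing :: (('a, 'b) presented_digraph, 'a) listing_problem"
  \<comment> \<open>Proximity is taken between sets of vertex numbers and mapped back to vertices;
    \<open>(!) vs\<close> is injective on the numbers, so cardinalities agree.\<close>
  define prox :: "('a, 'b) presented_digraph \<Rightarrow> 'a set \<Rightarrow> 'a set \<Rightarrow> 'a set" where
    "prox = (\<lambda>(G, vs, as) S T. (!) vs ` proximity (set (arc_list (G, vs, as))) (indices vs S) (indices vs T))"
  define nbs :: "('a, 'b) presented_digraph \<Rightarrow> 'a set \<Rightarrow> 'a set set" where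
    "nbs = (\<lambda>(G, vs, as) S. (`) ((!) vs) `
      neighbour_sets (set (arc_list (G, vs, as))) {..<length vs} (indices vs S))"
  have solution: "poly_time_solution ?P"
    unfolding poly_time_solution_def
  proof (intro exI[of _ solution_program] exI[of _ "monom 300 3"] ballI)
    fix i assume "i \<in> instances ?P"
    then obtain G vs as where i: "i = (G, vs, as)" and "(G, vs, as) \<in> presented_digraphs"
      by (cases i) (auto simp: connected_acyclic_listing_def)
    then interpret presented G vs as by unfold_locales
    show "\<exists>tr s xs S. exec solution_program (initial (encoding ?P i)) tr s \<and>
        length tr \<le> poly (monom 300 3) (card (set (elems ?P i))) \<and>
        outputs tr = [xs] \<and> represents (elems ?P i) xs S \<and> S \<in> solutions ?P i"
      using solution_program_correct
      by (simp add: i connected_acyclic_listing_def poly_monom card_verts del: encode_digraph.simps)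
  qed
  have neighbours: "poly_time_neighbors ?P nbs"
    unfolding poly_time_neighbors_def
  proof (intro exI[of _ neighbours_program] exI[of _ "monom 900 4"] ballI allI impI)
    fix i S xs assume "i \<in> instances ?P" and S: "S \<in> solutions ?P i" and xs: "represents (elems ?P i) xs S"
    then obtain G vs as where i: "i = (G, vs, as)" and "(G, vs, as) \<in> presented_digraphs"
      by (cases i) (auto simp: connected_acyclic_listing_def)
    then interpret presented G vs as by unfold_locales
    show "\<exists>tr s Ss. exec neighbours_program (initial (encoding ?P i @ [xs])) tr s \<and>
        length tr \<le> poly (monom 900 4) (card (set (elems ?P i))) \<and>
        list_all2 (represents (elems ?P i)) (outputs tr) Ss \<and> set Ss = nbs i S"
      using neighbours_program_correct[of S xs] S xs
      by (simp add: i connected_acyclic_listing_def poly_monom card_verts nbs_def del: encode_digraph.simps)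
  qed
  show "proximity_searchable ?P"
    unfolding proximity_searchable_def
  proof (intro exI[of _ prox] exI[of _ nbs] conjI solution neighbours ballI impI)
    fix i S T assume "i \<in> instances ?P" and S: "S \<in> solutions ?P i" and T: "T \<in> solutions ?P i"
    then obtain G vs as where i: "i = (G, vs, as)" and "(G, vs, as) \<in> presented_digraphs"
      by (cases i) (auto simp: connected_acyclic_listing_def)
    then interpret presented G vs as by unfold_locales
    let ?M = "maximal_dag_sets (set (arc_list (G, vs, as))) {..<length vs}"
    have M: "indices vs U \<in> ?M" "U = (!) vs ` indices vs U" if U: "U \<in> solutions ?P i" for U
    proof -
      obtain J where "J \<in> ?M" "U = (!) vs ` J"
        using U maximal_image by (auto simp: i connected_acyclic_listing_def)
      moreover from this have "J \<subseteq> {..<length vs}" by (auto simp: maximal_dag_sets_def)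
      ultimately show "indices vs U \<in> ?M" "U = (!) vs ` indices vs U" using indices_image by auto
    qed
    let ?prox = "proximity (set (arc_list (G, vs, as)))"
    have sub: "?prox J (indices vs T) \<subseteq> {..<length vs}" for J
      using M(1)[OF T] proximity_subset[of "indices vs T" _ J] finite_subset[of "indices vs T" "{..<length vs}"]
      by (auto simp: maximal_dag_sets_def)
    then show "prox i S T \<subseteq> set (elems ?P i)"
      using image_subset_verts[OF sub] vs(2) by (simp add: prox_def i connected_acyclic_listing_def)
    have card: "card (prox i U T) = card (?prox (indices vs U) (indices vs T))" for U
      unfolding prox_def i by (simp add: card_image inj_on_subset[OF inj sub])
    show "\<exists>S'\<in>nbs i S. card (prox i S T) < card (prox i S' T)" if "S \<noteq> T"
    proof -
      have "indices vs S \<noteq> indices vs T" using M(2) S T that by metis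
      then obtain J where J: "J \<in> neighbour_sets (set (arc_list (G, vs, as))) {..<length vs} (indices vs S)"
        "card (?prox (indices vs S) (indices vs T)) < card (?prox J (indices vs T))"
        using neighbour_sets_proximity[OF arcs_subset arcs_irrefl _ M(1)[OF S] M(1)[OF T]] by auto
      have "J \<in> ?M" using neighbour_sets_maximal[OF arcs_subset arcs_irrefl _ M(1)[OF S]] J(1) by auto
      then have "indices vs ((!) vs ` J) = J" by (intro indices_image) (simp add: maximal_dag_sets_def)
      then have "card (prox i S T) < card (prox i ((!) vs ` J) T)" using J(2) card by simp
      moreover have "(!) vs ` J \<in> nbs i S" using J(1) by (auto simp: nbs_def i)
      ultimately show ?thesis by blast
    qed
  next
    fix i S assume "i \<in> instances ?P" and S: "S \<in> solutions ?P i"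
    then obtain G vs as where i: "i = (G, vs, as)" and "(G, vs, as) \<in> presented_digraphs"
      by (cases i) (auto simp: connected_acyclic_listing_def)
    then interpret presented G vs as by unfold_locales
    obtain J where J: "J \<in> maximal_dag_sets (set (arc_list (G, vs, as))) {..<length vs}" "S = (!) vs ` J"
      using S maximal_image by (auto simp: i connected_acyclic_listing_def)
    then have "indices vs S = J" using indices_image by (auto simp: maximal_dag_sets_def)
    then show "nbs i S \<subseteq> solutions ?P i"
      using neighbour_sets_maximal[OF arcs_subset arcs_irrefl _ J(1)] maximal_image
      by (auto simp: nbs_def i connected_acyclic_listing_def)
  qed
  show "\<exists>C. listable_with_delay ?P (\<lambda>(G, vs, as). C * (card (arcs G) * card (verts G) ^ 2))"
    unfolding listable_with_delay_def
  proof (intro exI[of _ 1554] exI[of _ listing_program] ballI)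
    fix i assume "i \<in> instances ?P"
    then obtain G vs as where i: "i = (G, vs, as)" and "(G, vs, as) \<in> presented_digraphs"
      by (cases i) (auto simp: connected_acyclic_listing_def)
    then interpret presented G vs as by unfold_locales
    show "\<exists>tr s. exec listing_program (initial (encoding ?P i)) tr s \<and> lists_exactly_once ?P i tr \<and>
        delay tr \<le> (case i of (G, vs, as) \<Rightarrow> 1554 * (card (arcs G) * card (verts G) ^ 2))"
      using listing_program_correct
      by (simp add: i connected_acyclic_listing_def del: encode_digraph.simps)
  qed
qed

end
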